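(* Let $n\ge2$ and $k\ge 2$ be integers and fix $\delta>0$. Then there is a constant $c>0$ (depending only on $n,k,\delta$) such that the set of $\psi\in C^k([0,1]^{n-1})$ for which there exist arbitrarily large $R\ge1$, functions $f\in L^2(\Sigma_\psi)$ and weights $w\colon\mathbb{B}_R^n\to[0,\infty)$ satisfying $$\|\mathcal{E}_{\Sigma_\psi}f\|_{L^2(\mathbb{R}^n,w\,dx)}^2\ge c\,R^{\frac{n-1}{n-1+k}}R^{-\delta}\,\|Xw\|_{L^\infty}\,\|f\|_{L^2(\Sigma_\psi)}^2$$ contains a dense $G_\delta$-set in the $C^k$-topology.
   Context: $C^k([0,1]^{n-1})$ is the space of real-valued $C^k$ functions on $[0,1]^{n-1}$, with the topology given by the norm $\|\psi\|_{C^k}=\max_{0\le|\alpha|\le k}\|D^\alpha\psi\|_{L^\infty}$. For such $\psi$, $\Sigma_\psi=\{(\xi,\psi(\xi)):\xi\in[0,1]^{n-1}\}\subseteq\mathbb{R}^n$, with surface measure $\sigma$, and $\mathcal{E}_{\Sigma_\psi}f(x)=\int_{\Sigma_\psi}e^{2\pi i x\cdot y}f(y)\,d\sigma(y)$ is the Fourier extension operator. $\mathbb{B}_R^n$ is the ball of radius $R$ about the origin in $\mathbb{R}^n$; a weight on $\mathbb{B}_R^n$ is a measurable nonnegative function, extended by zero to $\mathbb{R}^n$. $Xw(\ell)=\int_\ell w$ is the X-ray transform, defined for affine lines $\ell\subseteq\mathbb{R}^n$, and $\|Xw\|_{L^\infty}$ is its $L^\infty$ norm over the space of all affine lines in $\mathbb{R}^n$.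 $\|g\|_{L^2(\mathbb{R}^n,w\,dx)}^2=\int_{\mathbb{R}^n}|g|^2w\,dx$. *)

theory Defs
  imports "HOL-Probability.Essential_Supremum"
begin

text \<open>
  The index type \<open>'d\<close> has \<open>n - 1\<close> elements; the ambient space \<open>\<real>\<^sup>n\<close> is
  \<open>(real^'d) \<times> real\<close>, whose norm, inner product and Lebesgue measure are the Euclidean ones.
\<close>

section \<open>The space of \<open>C\<^sup>k\<close> functions on the closed unit cube\<close>

abbreviation unit_cube :: "(real^'d) set" where
  "unit_cube \<equiv> cbox 0 1"

definition cube_line :: "'d::finite \<Rightarrow> real^'d \<Rightarrow> real set" where
  "cube_line i x = {t. x + t *\<^sub>R axis i 1 \<in> unit_cube}"

text \<open>Partial derivatives relative to the closed cube: one-sided on the boundary.\<close>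

definition has_partial :: "'d::finite \<Rightarrow> (real^'d \<Rightarrow> real) \<Rightarrow> real^'d \<Rightarrow> bool" where
  "has_partial i \<psi> x \<longleftrightarrow> (\<lambda>t. \<psi> (x + t *\<^sub>R axis i 1)) differentiable (at 0 within cube_line i x)"

definition partial_deriv :: "'d::finite \<Rightarrow> (real^'d \<Rightarrow> real) \<Rightarrow> real^'d \<Rightarrow> real" where
  "partial_deriv i \<psi> x =
     vector_derivative (\<lambda>t. \<psi> (x + t *\<^sub>R axis i 1)) (at 0 within cube_line i x)"

text \<open>
  \<open>D\<^sup>\<alpha>\<close> is written as an iterated partial derivative along a word of \<open>|\<alpha>|\<close> indices. Every
  multi-index arises from some word, and for \<open>C\<^sup>k\<close> functions and \<open>|\<alpha>| \<le> k\<close> all words with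
  the same multi-index give the same derivative on the cube.
\<close>

primrec iter_partial :: "'d::finite list \<Rightarrow> (real^'d \<Rightarrow> real) \<Rightarrow> real^'d \<Rightarrow> real" where
  "iter_partial [] \<psi> = \<psi>"
| "iter_partial (i # \<alpha>) \<psi> = partial_deriv i (iter_partial \<alpha> \<psi>)"

text \<open>
  A function on the cube is represented by its extension by zero; no definition below
  evaluates it outside the cube.
\<close>

definition Ck_cube :: "nat \<Rightarrow> (real^'d::finite \<Rightarrow> real) set" where
  "Ck_cube k = {\<psi>. (\<forall>x. x \<notin> unit_cube \<longrightarrow> \<psi> x = 0) \<and>
     (\<forall>\<alpha> i. length \<alpha> < k \<longrightarrow> (\<forall>x\<in>unit_cube. has_partial i (iter_partial \<alpha> \<psi>) x)) \<and>
     (\<forall>\<alpha>. length \<alpha> \<le> k \<longrightarrow> continuous_on unit_cube (iter_partial \<alpha> \<psi>))}"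

definition Ck_norm :: "nat \<Rightarrow> (real^'d::finite \<Rightarrow> real) \<Rightarrow> real" where
  "Ck_norm k \<psi> = Max ((\<lambda>\<alpha>. SUP x\<in>unit_cube. \<bar>iter_partial \<alpha> \<psi> x\<bar>) ` {\<alpha>. length \<alpha> \<le> k})"

text \<open>The value off the space is irrelevant; \<open>Metric_space\<close> asks for a total function.\<close>

definition Ck_dist :: "nat \<Rightarrow> (real^'d::finite \<Rightarrow> real) \<Rightarrow> (real^'d \<Rightarrow> real) \<Rightarrow> real" where
  "Ck_dist k \<psi> \<phi> =
     (if \<psi> \<in> Ck_cube k \<and> \<phi> \<in> Ck_cube k then Ck_norm k (\<lambda>x. \<psi> x - \<phi> x) else 0)"

definition Ck_topology :: "nat \<Rightarrow> (real^'d::finite \<Rightarrow> real) topology" where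
  "Ck_topology k = Metric_space.mtopology (Ck_cube k) (Ck_dist k)"

section \<open>The hypersurface and its extension operator\<close>

text \<open>
  Surface measure on the graph of \<open>\<psi>\<close>, as a measure on \<open>\<real>\<^sup>n\<close> concentrated on the graph:
  the push-forward of \<open>sqrt (1 + |\<nabla>\<psi>|\<^sup>2) d\<xi>\<close> under \<open>\<xi> \<mapsto> (\<xi>, \<psi> \<xi>)\<close>.
\<close>

definition surface_measure :: "(real^'d::finite \<Rightarrow> real) \<Rightarrow> ((real^'d) \<times> real) measure" where
  "surface_measure \<psi> =
     distr (density (restrict_space lborel unit_cube)
              (\<lambda>\<xi>. ennreal (sqrt (1 + (\<Sum>i\<in>UNIV. (partial_deriv i \<psi> \<xi>)\<^sup>2)))))
       borel (\<lambda>\<xi>. (\<xi>, \<psi> \<xi>))"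

definition L2_norm_sq :: "'a measure \<Rightarrow> ('a \<Rightarrow> complex) \<Rightarrow> ennreal" where
  "L2_norm_sq M g = (\<integral>\<^sup>+ y. ennreal ((cmod (g y))\<^sup>2) \<partial>M)"

definition L2_space :: "'a measure \<Rightarrow> ('a \<Rightarrow> complex) set" where
  "L2_space M = {g. g \<in> borel_measurable M \<and> L2_norm_sq M g < \<infinity>}"

definition extension_op ::
    "(real^'d::finite \<Rightarrow> real) \<Rightarrow> ((real^'d) \<times> real \<Rightarrow> complex) \<Rightarrow> (real^'d) \<times> real \<Rightarrow> complex" where
  "extension_op \<psi> f x =
     (LINT y|surface_measure \<psi>. exp (2 * of_real pi * \<i> * of_real (x \<bullet> y)) * f y)"

section \<open>Weights and the X-ray transform\<close>

definition weight_on_ball :: "real \<Rightarrow> ('a::euclidean_space \<Rightarrow> real) \<Rightarrow> bool" where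
  "weight_on_ball R w \<longleftrightarrow> w \<in> borel_measurable borel \<and> (\<forall>x. 0 \<le> w x) \<and> (\<forall>x. x \<notin> ball 0 R \<longrightarrow> w x = 0)"

text \<open>The integral of \<open>w\<close> over the line through \<open>x\<close> with direction \<open>v \<noteq> 0\<close>, by arc length.\<close>

definition Xray :: "('a::euclidean_space \<Rightarrow> real) \<Rightarrow> 'a \<times> 'a \<Rightarrow> ennreal" where
  "Xray w = (\<lambda>(x, v). \<integral>\<^sup>+ t. ennreal (w (x + t *\<^sub>R sgn v)) \<partial>lborel)"

text \<open>
  A set of affine lines is null for the invariant measure iff the set of pairs \<open>(x, v)\<close>,
  \<open>v \<noteq> 0\<close>, spanning a line of the set is Lebesgue null. Hence the \<open>L\<^sup>\<infinity>\<close> norm over the space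
  of lines is the essential supremum over such pairs; those with \<open>v = 0\<close> form a null set.
\<close>

definition Xray_norm :: "('a::euclidean_space \<Rightarrow> real) \<Rightarrow> ennreal" where
  "Xray_norm w = esssup lborel (Xray w)"

section \<open>The \<open>C\<^sup>k\<close> distance is a metric\<close>

lemma cube_line_eq:
  assumes "x \<in> unit_cube"
  shows "cube_line i x = cbox (- (x $ i)) (1 - x $ i)"
proof -
  have *: "(x + t *\<^sub>R axis i 1) $ j = (if j = i then x $ i + t else x $ j)" for t j
    by (simp add: axis_def)
  have "0 \<le> x $ j" "x $ j \<le> 1" for j
    using assms by (simp_all add: mem_box_cart)
  then have "(\<forall>j. 0 \<le> (if j = i then x $ i + t else x $ j) \<and> (if j = i then x $ i + t else x $ j) \<le> 1)
      \<longleftrightarrow> 0 \<le> x $ i + t \<and> x $ i + t \<le> 1" for t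
    by auto
  then have "(x + t *\<^sub>R axis i 1 \<in> unit_cube) \<longleftrightarrow> (0 \<le> x $ i + t \<and> x $ i + t \<le> 1)" for t
    unfolding mem_box_cart * zero_index one_index .
  then have "cube_line i x = {t. 0 \<le> x $ i + t \<and> x $ i + t \<le> 1}"
    unfolding cube_line_def by (rule Collect_cong)
  also have "\<dots> = cbox (- (x $ i)) (1 - x $ i)"
    by auto
  finally show ?thesis .
qed

lemma partial_deriv_works:
  assumes "x \<in> unit_cube" "has_partial i \<psi> x"
  shows "((\<lambda>t. \<psi> (x + t *\<^sub>R axis i 1)) has_vector_derivative partial_deriv i \<psi> x)
           (at 0 within cube_line i x)"
  using assms(2) unfolding partial_deriv_def has_partial_def
  by (simp add: vector_derivative_works)

lemma partial_deriv_eqI: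
  assumes x: "x \<in> unit_cube"
    and D: "((\<lambda>t. \<psi> (x + t *\<^sub>R axis i 1)) has_vector_derivative D) (at 0 within cube_line i x)"
  shows "partial_deriv i \<psi> x = D"
proof -
  have "0 \<in> cbox (- (x $ i)) (1 - x $ i)"
    using x by (auto simp: mem_box_cart)
  then show ?thesis
    using D unfolding partial_deriv_def cube_line_eq[OF x]
    by (intro vector_derivative_within_cbox) auto
qed

lemma iter_partial_diff:
  assumes "\<psi> \<in> Ck_cube k" "\<phi> \<in> Ck_cube k" "length \<alpha> \<le> k" "x \<in> unit_cube"
  shows "iter_partial \<alpha> (\<lambda>x. \<psi> x - \<phi> x) x = iter_partial \<alpha> \<psi> x - iter_partial \<alpha> \<phi> x"
  using assms(3,4)
proof (induction \<alpha> arbitrary: x)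
  case Nil
  then show ?case by simp
next
  case (Cons i \<alpha>)
  have *: "has_partial i (iter_partial \<alpha> \<psi>) x" "has_partial i (iter_partial \<alpha> \<phi>) x"
    using assms(1,2) Cons.prems unfolding Ck_cube_def by auto
  have "((\<lambda>t. iter_partial \<alpha> \<psi> (x + t *\<^sub>R axis i 1) - iter_partial \<alpha> \<phi> (x + t *\<^sub>R axis i 1))
     has_vector_derivative
       partial_deriv i (iter_partial \<alpha> \<psi>) x - partial_deriv i (iter_partial \<alpha> \<phi>) x)
     (at 0 within cube_line i x)"
    by (intro has_vector_derivative_diff partial_deriv_works * Cons.prems)
  then have "((\<lambda>t. iter_partial \<alpha> (\<lambda>x. \<psi> x - \<phi> x) (x + t *\<^sub>R axis i 1)) has_vector_derivative
       partial_deriv i (iter_partial \<alpha> \<psi>) x - partial_deriv i (iter_partial \<alpha> \<phi>) x)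
     (at 0 within cube_line i x)"
    by (rule has_vector_derivative_transform[rotated 2])
      (use Cons in \<open>auto simp: cube_line_def\<close>)
  then show ?case
    using partial_deriv_eqI[OF Cons.prems(2)] by simp
qed

lemma finite_words: "finite {\<alpha> :: 'd::finite list. length \<alpha> \<le> k}"
  using finite_lists_length_le[of "UNIV :: 'd set" k] by simp

lemma iter_partial_bdd:
  assumes "\<psi> \<in> Ck_cube k" "\<phi> \<in> Ck_cube k" "length \<alpha> \<le> k"
  shows "bdd_above ((\<lambda>x. \<bar>iter_partial \<alpha> (\<lambda>x. \<psi> x - \<phi> x) x\<bar>) ` unit_cube)"
proof -
  have "continuous_on unit_cube (\<lambda>x. \<bar>iter_partial \<alpha> \<psi> x - iter_partial \<alpha> \<phi> x\<bar>)"
    using assms unfolding Ck_cube_def by (intro continuous_intros) auto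
  then have "bdd_above ((\<lambda>x. \<bar>iter_partial \<alpha> \<psi> x - iter_partial \<alpha> \<phi> x\<bar>) ` unit_cube)"
    by (intro bounded_imp_bdd_above compact_imp_bounded compact_continuous_image) auto
  moreover have "(\<lambda>x. \<bar>iter_partial \<alpha> (\<lambda>x. \<psi> x - \<phi> x) x\<bar>) ` unit_cube
    = (\<lambda>x. \<bar>iter_partial \<alpha> \<psi> x - iter_partial \<alpha> \<phi> x\<bar>) ` unit_cube"
    using iter_partial_diff[OF assms] by (intro image_cong) auto
  ultimately show ?thesis by simp
qed

lemma zero_in_unit_cube: "0 \<in> unit_cube"
  by (auto simp: mem_box_cart)

lemma Ck_dist_upper:
  assumes "\<psi> \<in> Ck_cube k" "\<phi> \<in> Ck_cube k" "length \<alpha> \<le> k" "x \<in> unit_cube"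
  shows "\<bar>iter_partial \<alpha> \<psi> x - iter_partial \<alpha> \<phi> x\<bar> \<le> Ck_dist k \<psi> \<phi>"
proof -
  have "\<bar>iter_partial \<alpha> (\<lambda>x. \<psi> x - \<phi> x) x\<bar>
      \<le> (SUP x\<in>unit_cube. \<bar>iter_partial \<alpha> (\<lambda>x. \<psi> x - \<phi> x) x\<bar>)"
    by (rule cSUP_upper[OF assms(4) iter_partial_bdd[OF assms(1-3)]])
  also have "\<dots> \<le> Ck_dist k \<psi> \<phi>"
    unfolding Ck_dist_def Ck_norm_def using assms(1-3) finite_words
    by (auto intro!: Max_ge)
  finally show ?thesis
    using iter_partial_diff[OF assms] by simp
qed

lemma Ck_dist_least:
  assumes "\<psi> \<in> Ck_cube k" "\<phi> \<in> Ck_cube k"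
    and "\<And>\<alpha> x. length \<alpha> \<le> k \<Longrightarrow> x \<in> unit_cube \<Longrightarrow>
           \<bar>iter_partial \<alpha> \<psi> x - iter_partial \<alpha> \<phi> x\<bar> \<le> B"
  shows "Ck_dist k \<psi> \<phi> \<le> B"
proof -
  have "Ck_norm k (\<lambda>x. \<psi> x - \<phi> x) \<le> B"
    unfolding Ck_norm_def
  proof (rule Max.boundedI)
    show "finite ((\<lambda>\<alpha>. SUP x\<in>unit_cube. \<bar>iter_partial \<alpha> (\<lambda>x. \<psi> x - \<phi> x) x\<bar>) ` {\<alpha>. length \<alpha> \<le> k})"
      using finite_words by blast
    show "(\<lambda>\<alpha>. SUP x\<in>unit_cube. \<bar>iter_partial \<alpha> (\<lambda>x. \<psi> x - \<phi> x) x\<bar>) ` {\<alpha>. length \<alpha> \<le> k} \<noteq> {}"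
      by (auto intro: exI[of _ "[]"])
  next
    fix a assume "a \<in> (\<lambda>\<alpha>. SUP x\<in>unit_cube. \<bar>iter_partial \<alpha> (\<lambda>x. \<psi> x - \<phi> x) x\<bar>) ` {\<alpha>. length \<alpha> \<le> k}"
    then obtain \<alpha> where \<alpha>: "length \<alpha> \<le> k"
      and a: "a = (SUP x\<in>unit_cube. \<bar>iter_partial \<alpha> (\<lambda>x. \<psi> x - \<phi> x) x\<bar>)" by auto
    show "a \<le> B"
      unfolding a using iter_partial_diff[OF assms(1,2) \<alpha>] assms(3)[OF \<alpha>] zero_in_unit_cube
      by (intro cSUP_least) auto
  qed
  then show ?thesis
    using assms(1,2) by (simp add: Ck_dist_def)
qed

lemma Metric_space_Ck: "Metric_space (Ck_cube k) (Ck_dist k :: (real^'d::finite \<Rightarrow> real) \<Rightarrow> _)"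
proof -
  have nonneg: "0 \<le> Ck_dist k f g" if "f \<in> Ck_cube k" "g \<in> Ck_cube k" for f g :: "real^'d \<Rightarrow> real"
    using order_trans[OF abs_ge_zero Ck_dist_upper[OF that _ zero_in_unit_cube, of "[]"]] by simp
  have minus: "Ck_dist k f g \<le> Ck_dist k g f" if "f \<in> Ck_cube k" "g \<in> Ck_cube k"
    for f g :: "real^'d \<Rightarrow> real"
    using Ck_dist_upper[OF that(2,1)] by (intro Ck_dist_least that) (simp add: abs_minus_commute)
  have tri: "Ck_dist k f h \<le> Ck_dist k f g + Ck_dist k g h"
    if "f \<in> Ck_cube k" "g \<in> Ck_cube k" "h \<in> Ck_cube k" for f g h :: "real^'d \<Rightarrow> real"
  proof (intro Ck_dist_least that)
    fix \<alpha> :: "'d list" and x :: "real^'d" assume \<alpha>: "length \<alpha> \<le> k" "x \<in> unit_cube"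
    show "\<bar>iter_partial \<alpha> f x - iter_partial \<alpha> h x\<bar> \<le> Ck_dist k f g + Ck_dist k g h"
      using Ck_dist_upper[OF that(1,2) \<alpha>] Ck_dist_upper[OF that(2,3) \<alpha>] by linarith
  qed
  have zero: "Ck_dist k f g = 0 \<longleftrightarrow> f = g" if fg: "f \<in> Ck_cube k" "g \<in> Ck_cube k"
    for f g :: "real^'d \<Rightarrow> real"
  proof
    assume 0: "Ck_dist k f g = 0"
    show "f = g"
    proof
      fix x show "f x = g x"
        using Ck_dist_upper[OF fg, of "[]" x] 0 fg unfolding Ck_cube_def
        by (cases "x \<in> unit_cube") auto
    qed
  next
    assume "f = g"
    then have "Ck_dist k f g \<le> 0"
      by (intro Ck_dist_least fg) auto
    with nonneg[OF fg] show "Ck_dist k f g = 0" by simp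
  qed
  have off: "Ck_dist k f g = 0" if "f \<notin> Ck_cube k \<or> g \<notin> Ck_cube k" for f g :: "real^'d \<Rightarrow> real"
    using that unfolding Ck_dist_def by auto
  show ?thesis
  proof
    fix f g :: "real^'d \<Rightarrow> real"
    show "0 \<le> Ck_dist k f g"
      using nonneg[of f g] off[of f g] by fastforce
    show "Ck_dist k f g = Ck_dist k g f"
      using minus[of f g] minus[of g f] off[of f g] off[of g f] by fastforce
  qed (use tri zero in auto)
qed

end

theory Submission
  imports Defs "HOL-Probability.Characteristic_Functions" "HOL-Number_Theory.Cong"
begin

text \<open>
  Write \<open>d = n - 1\<close> and \<open>e(t) = exp (2 \<pi> i t)\<close>.

  \<^bold>\<open>Duality.\<close> Let \<open>f\<close> be the indicator of a piece \<open>Y\<close> of the surface and \<open>w\<close> a weight on the ball of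
  radius \<open>R\<close>. By Fubini, \<open>\<integral> E f w\<close> is the integral over \<open>Y\<close> of the Fourier transform of \<open>w\<close>, so by
  Cauchy-Schwarz \<open>\<integral> |E f|\<^sup>2 w\<close> is at least \<open>(\<integral>\<^sub>Y w^ d\<sigma>)\<^sup>2 / \<integral> w\<close>, while \<open>\<integral> w \<le> (2 R)\<^sup>d \<parallel>X w\<parallel>\<close> because
  the ball is a union of parallel line segments. What is wanted is a weight with small X-ray transform
  whose Fourier transform is large on \<open>R\<^sup>-\<^sup>1\<close>-neighbourhoods of many points of the surface
  (\<open>weighted_extension_lower_bound\<close>).

  \<^bold>\<open>The weight.\<close> It is the autocorrelation of a ball times \<open>|\<Sum>\<^sub>a e (x \<bullet> P a)|\<^sup>2\<close>, where \<open>a\<close> runs over a box in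
  a lattice of large rank and \<open>P\<close> is a linear map of this lattice to \<open>\<real>\<^sup>n\<close> with randomly chosen
  generators \<open>g\<^sub>1, \<dots>, g\<^sub>M\<close> besides the unit vectors. Its Fourier transform is a sum of nonnegative peaks
  at the differences \<open>P a - P a'\<close>, so nothing cancels. Along a line of direction \<open>u\<close>, a Gaussian majorant
  bounds the X-ray transform by \<open>R\<close> times the number of pairs with \<open>|(P a - P a') \<bullet> u| < \<tau>\<close>, where \<open>\<tau>\<close>
  is slightly larger than \<open>1 / R\<close>. A random choice of generators keeps the number of such \<open>a'\<close> below a small
  power of \<open>R\<close> for all \<open>a\<close> and \<open>u\<close> at once (\<open>plank_count\<close>): if a plank contained too many points, then \<open>p\<close> differences whose last
  nonzero coordinates sit at distinct places would lie in it, an event whose probability beats a union bound over all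
  directions and all differences. This needs \<open>p\<close> much larger than \<open>n\<close> and the rank \<open>M\<close> much larger than
  \<open>p\<close>, which is why the rank must be large; for rank \<open>n\<close> the weight would
  concentrate near a lattice in \<open>\<real>\<^sup>n\<close>, which has far too many points on some lines.

  \<^bold>\<open>The surface.\<close> Cut the cube into \<open>m\<^sup>d\<close> cells. Moving the surface vertically by
  \<open>s = \<eta> / m\<^sup>k\<close> near one point of each cell changes \<open>\<psi>\<close> by \<open>O(\<eta>)\<close> in \<open>C\<^sup>k\<close> (\<open>Ck_perturb\<close>). A second
  moment argument (\<open>card_missing_gens\<close>) shows that as soon as the number of frequencies
  exceeds \<open>m\<^sup>d / s = m\<^sup>d\<^sup>+\<^sup>k / \<eta>\<close> by a large factor, at least half of the cells contain a frequency within
  \<open>s\<close> of the surface. There are about \<open>R\<close> frequencies up to a small power of \<open>R\<close>, hence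
  \<open>m\<^sup>d\<close> is about \<open>R\<close> to the power \<open>d / (d + k)\<close>. This number of caps is the gain.

  \<^bold>\<open>Genericity.\<close> The construction survives perturbations of \<open>\<psi>\<close> of size \<open>1 / (12 R)\<close> in the sup norm, so the
  surfaces violating the inequality at some scale beyond \<open>j\<close> contain a dense open set, and the
  intersection over \<open>j\<close> is dense because \<open>C\<^sup>k\<close> is complete (\<open>Ck_complete\<close>). The
  small powers of \<open>R\<close> lost on the way are absorbed in \<open>R powr (- \<delta>)\<close>, so \<open>c = 1\<close> is possible.
\<close>

section \<open>Functions of class \<open>C\<^sup>k\<close> on the cube\<close>

text \<open>
  A family \<open>F\<close> indexed by words that is consistent under differentiation certifies membership and
  identifies all derivatives at once. Limits and perturbations both enter the space through this rule.
\<close>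

lemma Ck_cubeI:
  fixes \<psi> :: "real^'d::finite \<Rightarrow> real" and F :: "'d list \<Rightarrow> real^'d \<Rightarrow> real"
  assumes zero: "\<And>x. x \<notin> unit_cube \<Longrightarrow> \<psi> x = 0"
    and base: "\<And>x. x \<in> unit_cube \<Longrightarrow> \<psi> x = F [] x"
    and der: "\<And>\<alpha> i x. length \<alpha> < k \<Longrightarrow> x \<in> unit_cube \<Longrightarrow>
      ((\<lambda>t. F \<alpha> (x + t *\<^sub>R axis i 1)) has_vector_derivative F (i # \<alpha>) x) (at 0 within cube_line i x)"
    and cont: "\<And>\<alpha>. length \<alpha> \<le> k \<Longrightarrow> continuous_on unit_cube (F \<alpha>)"
  shows "\<psi> \<in> Ck_cube k"
    and "length \<alpha> \<le> k \<Longrightarrow> x \<in> unit_cube \<Longrightarrow> iter_partial \<alpha> \<psi> x = F \<alpha> x"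
proof -
  have *: "((\<lambda>t. g (x + t *\<^sub>R axis i 1)) has_vector_derivative F (i # \<alpha>) x) (at 0 within cube_line i x)"
    if "length \<alpha> < k" "x \<in> unit_cube" "\<And>x. x \<in> unit_cube \<Longrightarrow> g x = F \<alpha> x" for g \<alpha> i x
    by (rule has_vector_derivative_transform[OF _ _ der[OF that(1,2)]])
      (use that in \<open>auto simp: cube_line_def\<close>)
  have eq: "length \<alpha> \<le> k \<Longrightarrow> x \<in> unit_cube \<Longrightarrow> iter_partial \<alpha> \<psi> x = F \<alpha> x" for \<alpha> x
  proof (induction \<alpha> arbitrary: x)
    case Nil
    then show ?case using base by simp
  next
    case (Cons i \<alpha>)
    then show ?case
      using partial_deriv_eqI[OF Cons.prems(2) *[of \<alpha> x "iter_partial \<alpha> \<psi>" i]] by simp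
  qed
  then show "length \<alpha> \<le> k \<Longrightarrow> x \<in> unit_cube \<Longrightarrow> iter_partial \<alpha> \<psi> x = F \<alpha> x" .
  have "has_partial i (iter_partial \<alpha> \<psi>) x" if "length \<alpha> < k" "x \<in> unit_cube" for \<alpha> i x
    unfolding has_partial_def
    by (rule differentiableI_vector[OF *[OF that]]) (use that eq in auto)
  moreover have "continuous_on unit_cube (iter_partial \<alpha> \<psi>)" if "length \<alpha> \<le> k" for \<alpha>
    by (rule continuous_on_eq[OF cont[OF that]]) (simp add: eq that)
  ultimately show "\<psi> \<in> Ck_cube k"
    unfolding Ck_cube_def using zero by auto
qed

lemma Ck_deriv:
  assumes "\<psi> \<in> Ck_cube k" "length \<alpha> < k" "x \<in> unit_cube"
  shows "((\<lambda>t. iter_partial \<alpha> \<psi> (x + t *\<^sub>R axis i 1)) has_vector_derivative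
    iter_partial (i # \<alpha>) \<psi> x) (at 0 within cube_line i x)"
  using partial_deriv_works[OF assms(3), of i "iter_partial \<alpha> \<psi>"] assms
  unfolding Ck_cube_def by simp

lemma Ck_cont: "\<psi> \<in> Ck_cube k \<Longrightarrow> length \<alpha> \<le> k \<Longrightarrow> continuous_on unit_cube (iter_partial \<alpha> \<psi>)"
  unfolding Ck_cube_def by auto

text \<open>
  The derivative at \<open>0\<close> along the line through a shifted base point is the derivative at \<open>s\<close> along the
  original one; this turns the pointwise definition into differentiability on a whole segment.
\<close>

lemma Ck_deriv_line:
  assumes \<psi>: "\<psi> \<in> Ck_cube k" "length \<alpha> < k" and x: "x \<in> unit_cube" and s: "s \<in> cube_line i x"
  shows "((\<lambda>t. iter_partial \<alpha> \<psi> (x + t *\<^sub>R axis i 1)) has_vector_derivative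
    iter_partial (i # \<alpha>) \<psi> (x + s *\<^sub>R axis i 1)) (at s within cube_line i x)"
proof -
  let ?x = "x + s *\<^sub>R axis i 1"
  have x': "?x \<in> unit_cube"
    using s by (simp add: cube_line_def)
  have img: "(\<lambda>t. t - s) ` cube_line i x = cube_line i ?x"
    unfolding cube_line_def image_def
    by (auto simp: algebra_simps intro!: exI[of _ "_ + s"])
  have "((\<lambda>t. t - s) has_vector_derivative 1) (at s within cube_line i x)"
    by (auto intro!: derivative_eq_intros)
  then have "((\<lambda>t. iter_partial \<alpha> \<psi> (?x + t *\<^sub>R axis i 1)) \<circ> (\<lambda>t. t - s) has_vector_derivative
      1 *\<^sub>R iter_partial (i # \<alpha>) \<psi> ?x) (at s within cube_line i x)"
    using Ck_deriv[OF \<psi> x', of i] by (intro vector_diff_chain_within) (simp_all add: img)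
  then show ?thesis
    by (simp add: o_def algebra_simps)
qed

lemma convex_cube_line: "x \<in> unit_cube \<Longrightarrow> convex (cube_line i x)"
  by (simp add: cube_line_eq)

lemma zero_in_cube_line: "x \<in> unit_cube \<Longrightarrow> 0 \<in> cube_line i x"
  by (simp add: cube_line_def)

text \<open>
  On each coordinate segment this is the classical theorem on uniform convergence of derivatives.
\<close>

lemma Ck_limit:
  fixes \<sigma> :: "nat \<Rightarrow> real^'d::finite \<Rightarrow> real"
  assumes \<sigma>: "\<And>n. \<sigma> n \<in> Ck_cube k"
    and F: "\<And>\<alpha>. length \<alpha> \<le> k \<Longrightarrow> uniform_limit unit_cube (\<lambda>n. iter_partial \<alpha> (\<sigma> n)) (F \<alpha>) sequentially"
  defines "\<psi> \<equiv> \<lambda>x. if x \<in> unit_cube then F [] x else 0"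
  shows "\<psi> \<in> Ck_cube k"
    and "length \<alpha> \<le> k \<Longrightarrow> x \<in> unit_cube \<Longrightarrow> iter_partial \<alpha> \<psi> x = F \<alpha> x"
proof -
  have der: "((\<lambda>t. F \<alpha> (x + t *\<^sub>R axis i 1)) has_vector_derivative F (i # \<alpha>) x) (at 0 within cube_line i x)"
    if a: "length \<alpha> < k" and x: "x \<in> unit_cube" for \<alpha> i x
  proof -
    let ?S = "cube_line i x" and ?e = "axis i 1 :: real^'d"
    have "\<exists>g. \<forall>t\<in>?S. (\<lambda>n. iter_partial \<alpha> (\<sigma> n) (x + t *\<^sub>R ?e)) \<longlonglongrightarrow> g t \<and>
        (g has_derivative (\<lambda>h. h * F (i # \<alpha>) (x + t *\<^sub>R ?e))) (at t within ?S)"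
    proof (rule has_derivative_sequence[OF convex_cube_line[OF x]
        _ _ zero_in_cube_line[OF x]])
      show "((\<lambda>t. iter_partial \<alpha> (\<sigma> n) (x + t *\<^sub>R ?e)) has_derivative
        (\<lambda>h. h * iter_partial (i # \<alpha>) (\<sigma> n) (x + t *\<^sub>R ?e))) (at t within ?S)" if "t \<in> ?S" for n t
        using Ck_deriv_line[OF \<sigma> a x that] by (simp add: has_vector_derivative_def)
      show "(\<lambda>n. iter_partial \<alpha> (\<sigma> n) (x + 0 *\<^sub>R ?e)) \<longlonglongrightarrow> F \<alpha> x"
        using tendsto_uniform_limitI[OF F x] a by simp
      show "\<forall>\<^sub>F n in sequentially. \<forall>t\<in>?S. \<forall>h. norm (h * iter_partial (i # \<alpha>) (\<sigma> n) (x + t *\<^sub>R ?e)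
          - h * F (i # \<alpha>) (x + t *\<^sub>R ?e)) \<le> e * norm h" if "e > 0" for e
      proof -
        have "\<forall>\<^sub>F n in sequentially. \<forall>y\<in>unit_cube. dist (iter_partial (i # \<alpha>) (\<sigma> n) y) (F (i # \<alpha>) y) < e"
          using uniform_limitD[OF F that, of "i # \<alpha>"] a by simp
        then show ?thesis
        proof (rule eventually_mono)
          fix n assume n: "\<forall>y\<in>unit_cube. dist (iter_partial (i # \<alpha>) (\<sigma> n) y) (F (i # \<alpha>) y) < e"
          show "\<forall>t\<in>?S. \<forall>h. norm (h * iter_partial (i # \<alpha>) (\<sigma> n) (x + t *\<^sub>R ?e)
              - h * F (i # \<alpha>) (x + t *\<^sub>R ?e)) \<le> e * norm h"
          proof (intro ballI allI)
            fix t h :: real assume "t \<in> ?S"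
            then have "\<bar>iter_partial (i # \<alpha>) (\<sigma> n) (x + t *\<^sub>R ?e) - F (i # \<alpha>) (x + t *\<^sub>R ?e)\<bar> \<le> e"
              using n unfolding cube_line_def dist_real_def by fastforce
            from mult_right_mono[OF this, of "\<bar>h\<bar>"] show "norm (h * iter_partial (i # \<alpha>) (\<sigma> n) (x + t *\<^sub>R ?e)
                - h * F (i # \<alpha>) (x + t *\<^sub>R ?e)) \<le> e * norm h"
              by (simp add: abs_mult[symmetric] algebra_simps)
          qed
        qed
      qed
    qed
    then obtain g where g: "\<And>t. t \<in> ?S \<Longrightarrow> (\<lambda>n. iter_partial \<alpha> (\<sigma> n) (x + t *\<^sub>R ?e)) \<longlonglongrightarrow> g t"
      "\<And>t. t \<in> ?S \<Longrightarrow> (g has_derivative (\<lambda>h. h * F (i # \<alpha>) (x + t *\<^sub>R ?e))) (at t within ?S)"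
      by auto
    have "F \<alpha> (x + t *\<^sub>R ?e) = g t" if "t \<in> ?S" for t
      using g(1)[OF that] tendsto_uniform_limitI[OF F[of \<alpha>], of "x + t *\<^sub>R ?e"] that a
      by (auto simp: cube_line_def intro: LIMSEQ_unique)
    moreover have "(g has_vector_derivative F (i # \<alpha>) x) (at 0 within ?S)"
      using g(2)[OF zero_in_cube_line[OF x]] by (simp add: has_vector_derivative_def)
    ultimately show ?thesis
      by (rule has_vector_derivative_transform[OF zero_in_cube_line[OF x]])
  qed
  have cont: "continuous_on unit_cube (F \<alpha>)" if "length \<alpha> \<le> k" for \<alpha>
    by (rule uniform_limit_theorem[OF _ F[OF that]]) (auto intro!: always_eventually Ck_cont[OF \<sigma> that])
  show "\<psi> \<in> Ck_cube k"
    by (rule Ck_cubeI(1)[of \<psi> F]) (auto simp: \<psi>_def der cont)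
  show "length \<alpha> \<le> k \<Longrightarrow> x \<in> unit_cube \<Longrightarrow> iter_partial \<alpha> \<psi> x = F \<alpha> x"
    by (rule Ck_cubeI(2)[of \<psi> F k]) (auto simp: \<psi>_def der cont)
qed

lemma Ck_complete:
  "Metric_space.mcomplete (Ck_cube k) (Ck_dist k :: (real^'d::finite \<Rightarrow> real) \<Rightarrow> _)"
proof -
  interpret Metric_space "Ck_cube k" "Ck_dist k :: (real^'d::finite \<Rightarrow> real) \<Rightarrow> _"
    by (rule Metric_space_Ck)
  show ?thesis
    unfolding mcomplete_def
  proof (intro allI impI)
    fix \<sigma> :: "nat \<Rightarrow> real^'d \<Rightarrow> real"
    assume C: "MCauchy \<sigma>"
    have \<sigma>: "\<sigma> n \<in> Ck_cube k" for n
      using C unfolding MCauchy_def by blast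
    have cau: "\<exists>N. \<forall>n\<ge>N. \<forall>m\<ge>N. \<forall>\<alpha> x. length \<alpha> \<le> k \<longrightarrow> x \<in> unit_cube \<longrightarrow>
        \<bar>iter_partial \<alpha> (\<sigma> n) x - iter_partial \<alpha> (\<sigma> m) x\<bar> < e" if e: "e > 0" for e
    proof -
      obtain N where "\<forall>n m. N \<le> n \<longrightarrow> N \<le> m \<longrightarrow> Ck_dist k (\<sigma> n) (\<sigma> m) < e"
        using C e unfolding MCauchy_def by blast
      then show ?thesis
        using order_le_less_trans[OF Ck_dist_upper[OF \<sigma> \<sigma>]] by blast
    qed
    define F where "F \<alpha> x = lim (\<lambda>n. iter_partial \<alpha> (\<sigma> n) x)" for \<alpha> x
    have F: "uniform_limit unit_cube (\<lambda>n. iter_partial \<alpha> (\<sigma> n)) (F \<alpha>) sequentially" if "length \<alpha> \<le> k" for \<alpha>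
    proof -
      have "uniformly_Cauchy_on unit_cube (\<lambda>n. iter_partial \<alpha> (\<sigma> n))"
        unfolding uniformly_Cauchy_on_def dist_real_def
      proof (intro allI impI)
        fix e :: real assume "e > 0"
        from cau[OF this] that show "\<exists>M. \<forall>x\<in>unit_cube. \<forall>m\<ge>M. \<forall>n\<ge>M.
            \<bar>iter_partial \<alpha> (\<sigma> m) x - iter_partial \<alpha> (\<sigma> n) x\<bar> < e"
          by blast
      qed
      then have "uniformly_convergent_on unit_cube (\<lambda>n. iter_partial \<alpha> (\<sigma> n))"
        by (rule Cauchy_uniformly_convergent)
      then show ?thesis
        unfolding F_def[abs_def] uniformly_convergent_uniform_limit_iff .
    qed
    define \<psi> where "\<psi> = (\<lambda>x. if x \<in> unit_cube then F [] x else 0)"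
    note lim = Ck_limit[of \<sigma> k F, OF \<sigma> F, folded \<psi>_def]
    show "\<exists>\<psi>. limitin mtopology \<sigma> \<psi> sequentially"
    proof (intro exI)
      show "limitin mtopology \<sigma> \<psi> sequentially"
        unfolding limit_metric_sequentially
      proof (intro conjI allI impI)
        show "\<psi> \<in> Ck_cube k" using lim(1) by simp
        fix e :: real assume e: "e > 0"
        then obtain N where N: "\<And>n m \<alpha> x. n \<ge> N \<Longrightarrow> m \<ge> N \<Longrightarrow> length \<alpha> \<le> k \<Longrightarrow> x \<in> unit_cube \<Longrightarrow>
          \<bar>iter_partial \<alpha> (\<sigma> n) x - iter_partial \<alpha> (\<sigma> m) x\<bar> < e / 2"
          using cau[OF half_gt_zero[OF e]] by blast
        have "Ck_dist k (\<sigma> n) \<psi> \<le> e / 2" if n: "n \<ge> N" for n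
        proof (rule Ck_dist_least[OF \<sigma> lim(1)])
          fix \<alpha> :: "'d list" and x :: "real^'d" assume a: "length \<alpha> \<le> k" and x: "x \<in> unit_cube"
          have "(\<lambda>m. \<bar>iter_partial \<alpha> (\<sigma> n) x - iter_partial \<alpha> (\<sigma> m) x\<bar>) \<longlonglongrightarrow>
              \<bar>iter_partial \<alpha> (\<sigma> n) x - F \<alpha> x\<bar>"
            by (intro tendsto_intros tendsto_uniform_limitI[OF F[OF a] x])
          then have "\<bar>iter_partial \<alpha> (\<sigma> n) x - F \<alpha> x\<bar> \<le> e / 2"
            by (rule LIMSEQ_le_const2) (use N[OF n _ a x] in \<open>auto intro!: exI[of _ N] less_imp_le\<close>)
          then show "\<bar>iter_partial \<alpha> (\<sigma> n) x - iter_partial \<alpha> \<psi> x\<bar> \<le> e / 2"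
            using lim(2)[OF _ a x] by simp
        qed simp
        then show "\<exists>N. \<forall>n\<ge>N. \<sigma> n \<in> Ck_cube k \<and> Ck_dist k (\<sigma> n) \<psi> < e"
          using \<sigma> e by (intro exI[of _ N]) fastforce
      qed
    qed
  qed
qed

text \<open>
  Pass from \<open>x\<close> to \<open>y\<close> by changing one coordinate at a time, which stays in the cube.
\<close>

lemma Lipschitz_of_partials:
  fixes \<psi> :: "real^'d::finite \<Rightarrow> real"
  assumes \<psi>: "\<psi> \<in> Ck_cube k" "k \<ge> 1"
    and B: "\<And>i x. x \<in> unit_cube \<Longrightarrow> \<bar>iter_partial [i] \<psi> x\<bar> \<le> B"
    and x: "x \<in> unit_cube" and y: "y \<in> unit_cube"
  shows "\<bar>\<psi> x - \<psi> y\<bar> \<le> B * (\<Sum>i\<in>UNIV. \<bar>x $ i - y $ i\<bar>)"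
proof -
  have axis: "(v + t *\<^sub>R axis i 1) $ j = (if j = i then v $ i + t else v $ j)" for v :: "real^'d" and t i j
    by (simp add: axis_def)
  define z where "z S = (\<chi> i. if i \<in> S then y $ i else x $ i)" for S
  have z: "z S \<in> unit_cube" for S
    using x y by (auto simp: z_def mem_box_cart)
  have main: "\<bar>\<psi> x - \<psi> (z S)\<bar> \<le> B * (\<Sum>i\<in>S. \<bar>x $ i - y $ i\<bar>)" for S
  proof (induction S rule: finite_induct[OF finite])
    case 1
    then show ?case by (simp add: z_def)
  next
    case (2 i S)
    let ?s = "y $ i - x $ i"
    have zi: "z (insert i S) = z S + ?s *\<^sub>R axis i 1"
      using 2(2) by (auto simp: vec_eq_iff axis_def z_def)
    have s: "?s \<in> cube_line i (z S)"
      using z[of "insert i S"] by (simp add: cube_line_def zi)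
    have "norm (\<psi> (z S + ?s *\<^sub>R axis i 1) - \<psi> (z S + 0 *\<^sub>R axis i 1)) \<le> B * norm (?s - 0)"
    proof (rule differentiable_bound[OF convex_cube_line[OF z] _ _ s zero_in_cube_line[OF z]])
      fix t assume t: "t \<in> cube_line i (z S)"
      show "((\<lambda>t. \<psi> (z S + t *\<^sub>R axis i 1)) has_derivative
          (\<lambda>h. h *\<^sub>R iter_partial [i] \<psi> (z S + t *\<^sub>R axis i 1))) (at t within cube_line i (z S))"
        using Ck_deriv_line[OF \<psi>(1) _ z t, of "[]"] \<psi>(2) by (simp add: has_vector_derivative_def)
      have "z S + t *\<^sub>R axis i 1 \<in> unit_cube"
        using t by (simp add: cube_line_def)
      then show "onorm (\<lambda>h. h *\<^sub>R iter_partial [i] \<psi> (z S + t *\<^sub>R axis i 1)) \<le> B"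
        using B[of _ i] by (intro onorm_le) (simp add: mult.commute[of B] abs_mult mult_left_mono)
    qed
    then have "\<bar>\<psi> (z (insert i S)) - \<psi> (z S)\<bar> \<le> B * \<bar>x $ i - y $ i\<bar>"
      by (simp add: zi abs_minus_commute)
    then have "\<bar>\<psi> x - \<psi> (z (insert i S))\<bar>
        \<le> B * (\<Sum>i\<in>S. \<bar>x $ i - y $ i\<bar>) + B * \<bar>x $ i - y $ i\<bar>"
      using 2(3) by linarith
    then show ?case
      using 2(1,2) by (simp add: distrib_left)
  qed
  have "z UNIV = y" by (simp add: z_def vec_eq_iff)
  with main[of UNIV] show ?thesis by simp
qed

lemma Ck_partials_bounded:
  fixes \<psi> :: "real^'d::finite \<Rightarrow> real"
  assumes "\<psi> \<in> Ck_cube k"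
  shows "\<exists>B\<ge>0. \<forall>\<alpha> x. length \<alpha> \<le> k \<longrightarrow> x \<in> unit_cube \<longrightarrow> \<bar>iter_partial \<alpha> \<psi> x\<bar> \<le> B"
proof -
  have *: "(\<lambda>x::real^'d. 0::real) \<in> Ck_cube k" "length \<alpha> \<le> k \<Longrightarrow> x \<in> unit_cube \<Longrightarrow> iter_partial \<alpha> (\<lambda>x::real^'d. 0) x = 0"
    for \<alpha> and x :: "real^'d"
    using Ck_cubeI[of "\<lambda>x::real^'d. 0" "\<lambda>_ _. 0" k] by auto
  interpret Metric_space "Ck_cube k" "Ck_dist k :: (real^'d::finite \<Rightarrow> real) \<Rightarrow> _"
    by (rule Metric_space_Ck)
  show ?thesis
    using Ck_dist_upper[OF assms *(1)] *(2) by (intro exI[of _ "Ck_dist k \<psi> (\<lambda>x. 0)"]) simp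
qed

section \<open>Perturbation by bumps\<close>

text \<open>
  Truncated powers are \<open>C\<^sup>j\<^sup>-\<^sup>1\<close> and are closed under differentiation up to a factor, so products
  of two of them give bumps whose derivatives obey an explicit recursion.
\<close>

definition tpow :: "nat \<Rightarrow> real \<Rightarrow> real" where "tpow j t = (max 0 t) ^ j"

lemma tpow_deriv:
  assumes "j \<ge> 2"
  shows "(tpow j has_real_derivative real j * tpow (j - 1) t) (at t)"
proof (cases "t = 0")
  case False
  have "((\<lambda>t. max 0 t ^ j) has_real_derivative real j * max 0 t ^ (j - 1) * (if t > 0 then 1 else 0)) (at t)"
  proof (cases "t > 0")
    case True
    have D: "((\<lambda>t. t ^ j) has_real_derivative real j * t ^ (j - 1)) (at t)"
      by (auto intro!: derivative_eq_intros)
    have ev: "\<forall>\<^sub>F x in nhds t. x ^ j = max 0 x ^ j"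
      using eventually_nhds_in_open[of "{0<..}" t] True by (auto elim!: eventually_mono)
    show ?thesis
      using DERIV_cong_ev[OF refl ev refl, THEN iffD1, OF D] True by simp
  next
    case f: False
    have D: "((\<lambda>t. 0) has_real_derivative 0) (at t)"
      by (auto intro!: derivative_eq_intros)
    have ev: "\<forall>\<^sub>F x in nhds t. 0 = max (0::real) x ^ j"
      using eventually_nhds_in_open[of "{..<0}" t] f False assms by (auto elim!: eventually_mono)
    show ?thesis
      using DERIV_cong_ev[OF refl ev refl, THEN iffD1, OF D] f by simp
  qed
  moreover have "real j * max 0 t ^ (j - 1) * (if t > 0 then 1 else 0) = real j * tpow (j - 1) t"
    using assms by (auto simp: tpow_def max_def)
  ultimately have "((\<lambda>t. max 0 t ^ j) has_real_derivative real j * tpow (j - 1) t) (at t)"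
    by (simp only:)
  then show ?thesis by (simp only: tpow_def[abs_def])
next
  case True
  have "((\<lambda>h. tpow j h / h) \<longlongrightarrow> 0) (at 0)"
  proof (rule Lim_null_comparison)
    show "((\<lambda>h::real. \<bar>h\<bar> ^ (j - 1)) \<longlongrightarrow> 0) (at 0)"
      by (intro tendsto_null_power tendsto_rabs_zero tendsto_ident_at) (use assms in auto)
    have "\<bar>tpow j h / h\<bar> \<le> \<bar>h\<bar> ^ (j - 1)" if "h \<noteq> 0" for h :: real
    proof -
      have "max 0 h ^ j \<le> \<bar>h\<bar> ^ j" by (intro power_mono) auto
      also have "\<dots> = \<bar>h\<bar> ^ (j - 1) * \<bar>h\<bar>" using assms by (metis One_nat_def Suc_1 Suc_le_D diff_Suc_1 power_Suc2)
      finally show ?thesis using that by (simp add: tpow_def divide_le_eq)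
    qed
    then show "\<forall>\<^sub>F h in at 0. norm (tpow j h / h) \<le> \<bar>h\<bar> ^ (j - 1)"
      by (auto simp: eventually_at_filter)
  qed
  then show ?thesis
    using True assms by (simp add: has_field_derivative_iff tpow_def power_0_left)
qed

text \<open>
  The \<open>m\<close>-th derivative of \<open>(1 + t)\<^sub>+\<^sup>i (1 - t)\<^sub>+\<^sup>j\<close> when \<open>i\<close> and \<open>j\<close> exceed \<open>m\<close>.
\<close>

fun bump_deriv :: "nat \<Rightarrow> nat \<Rightarrow> nat \<Rightarrow> real \<Rightarrow> real" where
  "bump_deriv 0 i j t = tpow i (1 + t) * tpow j (1 - t)"
| "bump_deriv (Suc m) i j t = real i * bump_deriv m (i - 1) j t - real j * bump_deriv m i (j - 1) t"

lemma bump_deriv_DERIV: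
  assumes "i \<ge> m + 2" "j \<ge> m + 2"
  shows "(bump_deriv m i j has_real_derivative bump_deriv (Suc m) i j t) (at t)"
  using assms
proof (induction m arbitrary: i j)
  case 0
  have "((\<lambda>t. tpow i (1 + t)) has_real_derivative real i * tpow (i - 1) (1 + t) * 1) (at t)"
    using 0 by (intro DERIV_chain2[OF tpow_deriv]) (auto intro!: derivative_eq_intros)
  moreover have "((\<lambda>t. tpow j (1 - t)) has_real_derivative real j * tpow (j - 1) (1 - t) * (-1)) (at t)"
    using 0 by (intro DERIV_chain2[OF tpow_deriv]) (auto intro!: derivative_eq_intros)
  ultimately show ?case
    unfolding bump_deriv.simps[abs_def] by (auto intro!: derivative_eq_intros)
next
  case (Suc m)
  have "((\<lambda>t. real i * bump_deriv m (i - 1) j t - real j * bump_deriv m i (j - 1) t)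
    has_real_derivative real i * bump_deriv (Suc m) (i - 1) j t - real j * bump_deriv (Suc m) i (j - 1) t) (at t)"
    by (intro DERIV_diff DERIV_cmult Suc) (use Suc.prems in auto)
  then show ?case
    by (simp only: bump_deriv.simps(2)[of "Suc m"] bump_deriv.simps(2)[of m i j, abs_def])
qed

lemma bump_deriv_cont: "continuous_on S (bump_deriv m i j)"
proof (induction m arbitrary: i j)
  case 0
  show ?case unfolding bump_deriv.simps[abs_def] tpow_def by (intro continuous_intros)
next
  case (Suc m)
  show ?case unfolding bump_deriv.simps[abs_def] by (intro continuous_intros Suc)
qed

lemma bump_deriv_zero:
  assumes "i \<ge> m + 1" "j \<ge> m + 1" "\<bar>t\<bar> \<ge> 1"
  shows "bump_deriv m i j t = 0"
  using assms(1,2)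
proof (induction m arbitrary: i j)
  case 0
  then show ?case using assms(3) by (auto simp: tpow_def abs_if split: if_splits)
next
  case (Suc m)
  then show ?case by simp
qed

lemma bump_deriv_at_0: "bump_deriv 0 i j 0 = 1"
  by (simp add: tpow_def)

lemma bump_deriv_bounded: "\<exists>C. \<forall>t. \<bar>t\<bar> \<le> 1 \<longrightarrow> \<bar>bump_deriv m i j t\<bar> \<le> C"
proof -
  have "compact (bump_deriv m i j ` {-1..1})"
    by (intro compact_continuous_image bump_deriv_cont) auto
  then obtain C where C: "\<And>y. y \<in> bump_deriv m i j ` {-1..1} \<Longrightarrow> norm y \<le> C"
    using compact_imp_bounded bounded_iff by metis
  have "\<bar>bump_deriv m i j t\<bar> \<le> C" if "\<bar>t\<bar> \<le> 1" for t
  proof -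
    have "bump_deriv m i j t \<in> bump_deriv m i j ` {-1..1}"
      by (rule imageI) (use that in auto)
    then show ?thesis using C[of "bump_deriv m i j t"] by simp
  qed
  then show ?thesis by blast
qed

lemma smooth_bump_exists:
  "\<exists>(b :: nat \<Rightarrow> real \<Rightarrow> real) C. C \<ge> 1 \<and>
    (\<forall>m<k. \<forall>t. (b m has_real_derivative b (Suc m) t) (at t)) \<and>
    (\<forall>m\<le>k. continuous_on UNIV (b m)) \<and>
    (\<forall>m\<le>k. \<forall>t. \<bar>t\<bar> \<ge> 1 \<longrightarrow> b m t = 0) \<and> b 0 0 = 1 \<and>
    (\<forall>m\<le>k. \<forall>t. \<bar>b m t\<bar> \<le> C)"
proof -
  define b where "b m = bump_deriv m (k + 2) (k + 2)" for m
  obtain C where C: "\<And>m t. \<bar>t\<bar> \<le> 1 \<Longrightarrow> \<bar>b m t\<bar> \<le> C m"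
    using bump_deriv_bounded[of _ "k + 2" "k + 2"] unfolding b_def by metis
  define D where "D = Max (insert 1 (C ` {..k}))"
  have D: "C m \<le> D" if "m \<le> k" for m
    unfolding D_def using that by (intro Max_ge) auto
  have D1: "D \<ge> 1" unfolding D_def by (intro Max_ge) auto
  have z: "b m t = 0" if "m \<le> k" "\<bar>t\<bar> \<ge> 1" for m t
    unfolding b_def using that by (intro bump_deriv_zero) auto
  have "\<bar>b m t\<bar> \<le> D" if "m \<le> k" for m t
    using C[of t m] D[OF that] D1 z[OF that, of t] by (cases "\<bar>t\<bar> \<le> 1") auto
  moreover have "(b m has_real_derivative b (Suc m) t) (at t)" if "m < k" for m t
    unfolding b_def using that by (intro bump_deriv_DERIV) auto
  ultimately show ?thesis
    using D1 z bump_deriv_at_0[of "k + 2" "k + 2"] bump_deriv_cont[of UNIV _ "k + 2" "k + 2"]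
    unfolding b_def[symmetric] by (intro exI[of _ b] exI[of _ D]) blast
qed

text \<open>
  Product bumps of width \<open>\<rho>\<close> centred at the points of \<open>Z\<close> have disjoint supports, so at each point at
  most one of them contributes to a derivative, and the price of a bump of height \<open>s\<close> is \<open>s / \<rho>\<^sup>k\<close>
  irrespective of the number of points.
\<close>

lemma Ck_perturb:
  fixes k :: nat
  shows "\<exists>C>0. \<forall>(\<psi> :: real^'d::finite \<Rightarrow> real) (Z :: (real^'d) set) h \<rho> s. \<psi> \<in> Ck_cube k \<longrightarrow> finite Z \<longrightarrow>
    0 < \<rho> \<longrightarrow> \<rho> \<le> 1 \<longrightarrow> 0 \<le> s \<longrightarrow> (\<forall>z\<in>Z. \<bar>h z\<bar> \<le> s) \<longrightarrow>
    (\<forall>z\<in>Z. \<forall>z'\<in>Z. \<forall>x. (\<forall>i. \<bar>x $ i - z $ i\<bar> < \<rho>) \<longrightarrow> (\<forall>i. \<bar>x $ i - z' $ i\<bar> < \<rho>) \<longrightarrow> z = z') \<longrightarrow>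
    (\<exists>\<phi>\<in>Ck_cube k. Ck_dist k \<psi> \<phi> \<le> C * s / \<rho> ^ k \<and>
       (\<forall>z\<in>Z. z \<in> unit_cube \<longrightarrow> \<phi> z = \<psi> z + h z))"
proof -
  obtain b C where C: "C \<ge> 1"
    and b: "\<And>m t. m < k \<Longrightarrow> (b m has_real_derivative b (Suc m) t) (at t)"
    and cont: "\<And>m. m \<le> k \<Longrightarrow> continuous_on UNIV (b m)"
    and zero: "\<And>m t. m \<le> k \<Longrightarrow> \<bar>t\<bar> \<ge> 1 \<Longrightarrow> b m t = 0"
    and b0: "b 0 0 = (1::real)"
    and bd: "\<And>m t. m \<le> k \<Longrightarrow> \<bar>b m t\<bar> \<le> C"
    using smooth_bump_exists[of k] by metis
  show ?thesis
  proof (intro exI[of _ "C ^ CARD('d)"] conjI allI impI)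
    show "0 < C ^ CARD('d)" using C by simp
    fix \<psi> :: "real^'d \<Rightarrow> real" and Z and h :: "real^'d \<Rightarrow> real" and \<rho> s :: real
    assume \<psi>: "\<psi> \<in> Ck_cube k" and Z: "finite (Z :: (real^'d) set)" and \<rho>: "0 < \<rho>" "\<rho> \<le> 1" and s: "0 \<le> s"
      and h: "\<forall>z\<in>Z. \<bar>h z\<bar> \<le> s"
      and disj: "\<forall>z\<in>Z. \<forall>z'\<in>Z. \<forall>x. (\<forall>i. \<bar>x $ i - z $ i\<bar> < \<rho>) \<longrightarrow> (\<forall>i. \<bar>x $ i - z' $ i\<bar> < \<rho>) \<longrightarrow> z = z'"
    define P where "P \<alpha> z x = (\<Prod>j\<in>UNIV. b (count_list \<alpha> j) ((x $ j - z $ j) / \<rho>))"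
      for \<alpha> :: "'d list" and z x :: "real^'d"
    define F where "F \<alpha> x = iter_partial \<alpha> \<psi> x + (\<Sum>z\<in>Z. h z / \<rho> ^ length \<alpha> * P \<alpha> z x)"
      for \<alpha> :: "'d list" and x :: "real^'d"
    define \<phi> where "\<phi> x = (if x \<in> unit_cube then F [] x else 0)" for x
    have cnt: "count_list \<alpha> j \<le> k" if "length \<alpha> \<le> k" for \<alpha> and j :: 'd
      using count_le_length[of \<alpha> j] that by linarith
    have Pder: "((\<lambda>t. P \<alpha> z (x + t *\<^sub>R axis i 1)) has_real_derivative P (i # \<alpha>) z x / \<rho>) (at 0)"
      if a: "length \<alpha> < k" for \<alpha> i z x
    proof -
      let ?R = "\<Prod>j\<in>UNIV - {i}. b (count_list \<alpha> j) ((x $ j - z $ j) / \<rho>)"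
      have "P \<alpha> z (x + t *\<^sub>R axis i 1) = b (count_list \<alpha> i) ((x $ i + t - z $ i) / \<rho>) * ?R" for t
        unfolding P_def by (subst prod.remove[of _ i]) (auto simp: axis_def intro!: prod.cong)
      moreover have "P (i # \<alpha>) z x = b (Suc (count_list \<alpha> i)) ((x $ i - z $ i) / \<rho>) * ?R"
        unfolding P_def by (subst prod.remove[of _ i]) (auto intro!: prod.cong)
      moreover have "((\<lambda>t. b (count_list \<alpha> i) ((x $ i + t - z $ i) / \<rho>)) has_real_derivative
          b (Suc (count_list \<alpha> i)) ((x $ i + 0 - z $ i) / \<rho>) * (1 / \<rho>)) (at 0)"
        by (rule DERIV_chain2[OF b])
          (use a \<rho> count_le_length[of \<alpha> i] in \<open>auto intro!: derivative_eq_intros\<close>)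
      ultimately show ?thesis
        by (auto intro!: derivative_eq_intros)
    qed
    have der: "((\<lambda>t. F \<alpha> (x + t *\<^sub>R axis i 1)) has_vector_derivative F (i # \<alpha>) x) (at 0 within cube_line i x)"
      if a: "length \<alpha> < k" and x: "x \<in> unit_cube" for \<alpha> i x
    proof -
      have "((\<lambda>t. \<Sum>z\<in>Z. h z / \<rho> ^ length \<alpha> * P \<alpha> z (x + t *\<^sub>R axis i 1)) has_real_derivative
        (\<Sum>z\<in>Z. h z / \<rho> ^ length \<alpha> * (P (i # \<alpha>) z x / \<rho>))) (at 0 within cube_line i x)"
        by (intro DERIV_sum DERIV_cmult has_field_derivative_at_within[OF Pder[OF a]])
      then have "((\<lambda>t. \<Sum>z\<in>Z. h z / \<rho> ^ length \<alpha> * P \<alpha> z (x + t *\<^sub>R axis i 1)) has_vector_derivative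
        (\<Sum>z\<in>Z. h z / \<rho> ^ length (i # \<alpha>) * P (i # \<alpha>) z x)) (at 0 within cube_line i x)"
        by (simp add: has_real_derivative_iff_has_vector_derivative mult.commute)
      then show ?thesis
        unfolding F_def by (intro has_vector_derivative_add Ck_deriv[OF \<psi> a x])
    qed
    have contF: "continuous_on unit_cube (F \<alpha>)" if a: "length \<alpha> \<le> k" for \<alpha>
      unfolding F_def P_def using \<rho>
      by (intro continuous_intros Ck_cont[OF \<psi> a] continuous_on_compose2[OF cont[OF cnt[OF a]]]) auto
    note \<phi> = Ck_cubeI[of \<phi> F k, OF _ _ der contF]
    have \<phi>1: "\<phi> \<in> Ck_cube k" by (rule \<phi>(1)) (auto simp: \<phi>_def)
    have \<phi>2: "iter_partial \<alpha> \<phi> x = F \<alpha> x" if "length \<alpha> \<le> k" "x \<in> unit_cube" for \<alpha> x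
      by (rule \<phi>(2)) (use that in \<open>auto simp: \<phi>_def\<close>)
    have Pzero: "P \<alpha> z x = 0" if a: "length \<alpha> \<le> k" and ne: "\<not> (\<forall>i. \<bar>x $ i - z $ i\<bar> < \<rho>)" for \<alpha> z x
    proof -
      obtain i where "\<bar>x $ i - z $ i\<bar> \<ge> \<rho>" using ne by (meson not_less)
      then have "b (count_list \<alpha> i) ((x $ i - z $ i) / \<rho>) = 0"
        using \<rho> by (intro zero cnt a) (auto simp: le_divide_eq)
      then show ?thesis unfolding P_def by (auto intro!: prod_zero)
    qed
    have PC: "\<bar>P \<alpha> z x\<bar> \<le> C ^ CARD('d)" if "length \<alpha> \<le> k" for \<alpha> z x
      unfolding P_def abs_prod
      using prod_mono[of UNIV "\<lambda>j. \<bar>b (count_list \<alpha> j) ((x $ j - z $ j) / \<rho>)\<bar>" "\<lambda>_. C"] bd[OF cnt[OF that]]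
      by simp
    have small: "\<bar>\<Sum>z\<in>Z. h z / \<rho> ^ length \<alpha> * P \<alpha> z x\<bar> \<le> C ^ CARD('d) * s / \<rho> ^ k" if a: "length \<alpha> \<le> k" for \<alpha> x
    proof (cases "\<exists>z0\<in>Z. \<forall>i. \<bar>x $ i - z0 $ i\<bar> < \<rho>")
      case True
      then obtain z0 where z0: "z0 \<in> Z" "\<forall>i. \<bar>x $ i - z0 $ i\<bar> < \<rho>" by blast
      have "P \<alpha> z x = 0" if "z \<in> Z - {z0}" for z
        using disj z0 that by (intro Pzero[OF a]) blast
      then have "(\<Sum>z\<in>Z. h z / \<rho> ^ length \<alpha> * P \<alpha> z x) = h z0 / \<rho> ^ length \<alpha> * P \<alpha> z0 x"
        by (subst sum.remove[OF Z z0(1)]) auto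
      also have "\<bar>\<dots>\<bar> = \<bar>h z0\<bar> / \<rho> ^ length \<alpha> * \<bar>P \<alpha> z0 x\<bar>"
        using \<rho> by (simp add: abs_mult)
      also have "\<dots> \<le> s / \<rho> ^ k * C ^ CARD('d)"
      proof (intro mult_mono frac_le)
        show "\<rho> ^ k \<le> \<rho> ^ length \<alpha>" using \<rho> a by (intro power_decreasing) auto
      qed (use s h z0 \<rho> PC[OF a] in auto)
      finally show ?thesis by (simp add: mult.commute)
    next
      case False
      then have "(\<Sum>z\<in>Z. h z / \<rho> ^ length \<alpha> * P \<alpha> z x) = 0"
        using Pzero[OF a] by (intro sum.neutral) auto
      then show ?thesis using s \<rho> C by simp
    qed
    show "\<exists>\<phi>\<in>Ck_cube k. Ck_dist k \<psi> \<phi> \<le> C ^ CARD('d) * s / \<rho> ^ k \<and>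
       (\<forall>z\<in>Z. z \<in> unit_cube \<longrightarrow> \<phi> z = \<psi> z + h z)"
    proof (intro bexI[OF _ \<phi>1] conjI ballI impI)
      show "Ck_dist k \<psi> \<phi> \<le> C ^ CARD('d) * s / \<rho> ^ k"
      proof (rule Ck_dist_least[OF \<psi> \<phi>1])
        fix \<alpha> :: "'d list" and x :: "real^'d" assume a: "length \<alpha> \<le> k" "x \<in> unit_cube"
        show "\<bar>iter_partial \<alpha> \<psi> x - iter_partial \<alpha> \<phi> x\<bar> \<le> C ^ CARD('d) * s / \<rho> ^ k"
          using small[OF a(1), of x] unfolding \<phi>2[OF a] F_def by simp
      qed
      fix z0 assume z0: "z0 \<in> Z" "z0 \<in> unit_cube"
      have "P [] z z0 = 0" if "z \<in> Z - {z0}" for z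
        using disj z0 that \<rho> by (intro Pzero) force+
      then have "(\<Sum>z\<in>Z. h z / \<rho> ^ length [] * P [] z z0) = h z0 * P [] z0 z0"
        by (subst sum.remove[OF Z z0(1)]) auto
      then show "\<phi> z0 = \<psi> z0 + h z0"
        using z0 b0 unfolding \<phi>_def F_def by (simp add: P_def)
    qed
  qed
qed

section \<open>Random generators: few points in a plank\<close>

text \<open>
  Read each \<open>a\<close> as a path in a tree, from the last coordinate to the first. An element is determined by
  \<open>e\<close> and by its coordinates at the levels where some two elements branch, so a large set must
  branch at many levels. The difference of two elements branching at level \<open>l\<close> has last
  nonzero coordinate \<open>l\<close>: this produces vectors in triangular position without linear algebra.
\<close>

lemma branching_indices:
  fixes T :: "((nat \<Rightarrow> int) \<times> 'e) set" and H :: int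
  assumes T: "T \<subseteq> PiE {..<M} (\<lambda>_. {-H..H}) \<times> E" and E: "finite E" and H: "H \<ge> 0"
    and big: "card T > card E * nat (2 * H + 1) ^ p"
  obtains I where "I \<subseteq> {..<M}" "card I = p"
    "\<And>l. l \<in> I \<Longrightarrow> \<exists>a a' e. (a, e) \<in> T \<and> (a', e) \<in> T \<and> a l \<noteq> a' l \<and> (\<forall>i. l < i \<longrightarrow> a i = a' i)"
proof -
  define Br where "Br = {l \<in> {..<M}. \<exists>a a' e. (a, e) \<in> T \<and> (a', e) \<in> T \<and> a l \<noteq> a' l \<and> (\<forall>i. l < i \<longrightarrow> a i = a' i)}"
  have finBr: "finite Br" unfolding Br_def by simp
  let ?f = "\<lambda>(a, e :: 'e). (restrict a Br, e)"
  have inj: "inj_on ?f T"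
  proof (rule inj_onI)
    fix x y assume xy: "x \<in> T" "y \<in> T" "?f x = ?f y"
    obtain a e a' e' where x: "x = (a, e)" and y: "y = (a', e')" by (cases x, cases y) blast
    have t: "(a, e) \<in> T" "(a', e') \<in> T" and eq: "restrict a Br = restrict a' Br"
      and ee: "e = e'"
      using xy unfolding x y by auto
    show "x = y"
    proof (rule ccontr)
      assume "x \<noteq> y"
      then have ne: "a \<noteq> a'" using ee x y by simp
      have pe: "a \<in> extensional {..<M}" "a' \<in> extensional {..<M}"
        using t T by (auto simp: PiE_def)
      define N where "N = {i. i < M \<and> a i \<noteq> a' i}"
      have N: "finite N" "N \<noteq> {}"
        using ne extensionalityI[OF pe] by (auto simp: N_def)
      define l where "l = Max N"
      have l: "l \<in> N" unfolding l_def using N by (rule Max_in)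
      have "a i = a' i" if "l < i" for i
      proof (cases "i < M")
        case True
        have "i \<notin> N" using Max_ge[OF N(1), of i] that by (auto simp flip: l_def)
        then show ?thesis using True by (simp add: N_def)
      qed (use pe in \<open>auto simp: extensional_def\<close>)
      then have "l \<in> Br"
        using l t ee unfolding Br_def N_def by blast
      then show False
        using fun_cong[OF eq, of l] l by (simp add: N_def)
    qed
  qed
  have "?f ` T \<subseteq> PiE Br (\<lambda>_. {-H..H}) \<times> E"
  proof (intro image_subsetI)
    fix x assume "x \<in> T"
    then obtain a e where x: "x = (a, e)" and a: "a \<in> PiE {..<M} (\<lambda>_. {-H..H})" and e: "e \<in> E"
      using T by (cases x) auto
    have "a i \<in> {-H..H}" if "i \<in> Br" for i
      using PiE_mem[OF a, of i] that by (simp add: Br_def)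
    then show "?f x \<in> PiE Br (\<lambda>_. {-H..H}) \<times> E"
      using e unfolding x by (simp add: restrict_PiE_iff)
  qed
  then have "card T \<le> card (PiE Br (\<lambda>_. {-H..H}) \<times> E)"
    using card_image[OF inj] card_mono[of "PiE Br (\<lambda>_. {-H..H}) \<times> E" "?f ` T"] finBr E
    by (simp add: finite_PiE)
  also have "\<dots> = card E * nat (2 * H + 1) ^ card Br"
    using finBr by (simp add: card_cartesian_product card_PiE add.commute mult.commute)
  finally have "card E * nat (2 * H + 1) ^ p < card E * nat (2 * H + 1) ^ card Br"
    using big by linarith
  moreover have "nat (2 * H + 1) ^ card Br \<le> nat (2 * H + 1) ^ p" if "card Br \<le> p"
    using H that by (intro power_increasing) auto
  ultimately have "p \<le> card Br"
    by (meson linorder_le_cases mult_le_mono2 not_le)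
  then obtain I where "I \<subseteq> Br" "card I = p"
    by (rule obtain_subset_with_card_n)
  then show thesis
    by (intro that[of I]) (auto simp: Br_def)
qed

text \<open>
  The generators are \<open>g (i, \<cdot>) / q\<close> with integer coordinates below \<open>q\<close>; choosing an element of this
  set uniformly at random becomes counting.
\<close>

definition gens :: "nat \<Rightarrow> int \<Rightarrow> (nat \<times> 'c::finite \<Rightarrow> int) set" where
  "gens M q = PiE ({..<M} \<times> UNIV) (\<lambda>_. {0..<q})"

definition comb :: "nat \<Rightarrow> (nat \<Rightarrow> int) \<Rightarrow> (nat \<times> 'c \<Rightarrow> int) \<Rightarrow> 'c \<Rightarrow> int" where
  "comb M a g \<kappa> = (\<Sum>i<M. a i * g (i, \<kappa>))"

lemma finite_gens: "finite (gens M q)"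
  unfolding gens_def by (intro finite_PiE) auto

lemma card_gens: "card (gens M q :: (nat \<times> 'c::finite \<Rightarrow> int) set) = nat q ^ (M * CARD('c))"
  unfolding gens_def by (simp add: card_PiE card_cartesian_product)

text \<open>
  Only the \<open>j\<close>-th coordinates of the generators are used. Since \<open>D l\<close> ends at \<open>l\<close> with a nonzero integer, two
  generator systems that agree elsewhere and at earlier indices but differ at \<open>(l, j)\<close> give values that
  differ by at least \<open>\<bar>z j\<bar>\<close>. Replacing these coordinates by the bins of the values is therefore
  injective, and each of the conditions leaves only \<open>2 W / \<bar>z j\<bar> + 2\<close> bins instead of \<open>q\<close> coordinates.
\<close>

lemma card_plank_gens:
  fixes z :: "'c::finite \<Rightarrow> int" and D :: "nat \<Rightarrow> nat \<Rightarrow> int" and W :: real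
  assumes I: "I \<subseteq> {..<M}" and z: "z j \<noteq> 0" and W: "W \<ge> 0" and q: "q > 0"
    and D: "\<And>l. l \<in> I \<Longrightarrow> D l l \<noteq> 0" "\<And>l i. l \<in> I \<Longrightarrow> l < i \<Longrightarrow> i < M \<Longrightarrow> D l i = 0"
  shows "real (card {g \<in> gens M q. \<forall>l\<in>I. \<bar>real_of_int (\<Sum>\<kappa>\<in>UNIV. z \<kappa> * comb M (D l) g \<kappa>)\<bar> < W})
    \<le> real_of_int q ^ (M * CARD('c) - card I) * (2 * W / \<bar>z j\<bar> + 2) ^ card I"
proof -
  define V where "V l g = (\<Sum>\<kappa>\<in>UNIV. z \<kappa> * comb M (D l) g \<kappa>)" for l g
  define X where "X = {g \<in> gens M q. \<forall>l\<in>I. \<bar>real_of_int (V l g)\<bar> < W}"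
  define w where "w = W / \<bar>z j\<bar>"
  define J where "J = {..<M} \<times> (UNIV :: 'c set) - I \<times> {j}"
  have finI: "finite I" using I finite_subset by blast
  let ?bin = "\<lambda>l g. \<lfloor>real_of_int (V l g) / \<bar>z j\<bar>\<rfloor>"
  let ?f = "\<lambda>g. (restrict g J, restrict (\<lambda>l. ?bin l g) I)"
  have zpos: "real_of_int \<bar>z j\<bar> > 0" using z by simp
  have inj: "inj_on ?f X"
  proof (rule inj_onI)
    fix g g' assume g: "g \<in> X" "g' \<in> X" and eq: "?f g = ?f g'"
    have ext: "g \<in> extensional ({..<M} \<times> UNIV)" "g' \<in> extensional ({..<M} \<times> UNIV)"
      using g by (auto simp: X_def gens_def PiE_def)
    have onJ: "g x = g' x" if "x \<in> J" for x
      using eq that by (metis prod.inject restrict_apply')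
    have bins: "?bin l g = ?bin l g'" if "l \<in> I" for l
      using eq that by (metis (no_types, lifting) prod.inject restrict_apply')
    have col: "g (l, j) = g' (l, j)" if "l < M" for l
      using that
    proof (induction l rule: less_induct)
      case (less l)
      show ?case
      proof (cases "l \<in> I")
        case False
        then show ?thesis using less.prems by (intro onJ) (auto simp: J_def)
      next
        case True
        have c: "comb M (D l) g \<kappa> = comb M (D l) g' \<kappa>" if "\<kappa> \<noteq> j" for \<kappa>
          unfolding comb_def using that by (intro sum.cong refl) (auto simp: J_def intro!: onJ)
        have "comb M (D l) g j - comb M (D l) g' j = (\<Sum>i<M. D l i * (g (i, j) - g' (i, j)))"
          by (simp add: comb_def sum_subtractf algebra_simps)
        also have "\<dots> = (\<Sum>i<M. if i = l then D l l * (g (l, j) - g' (l, j)) else 0)"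
        proof (intro sum.cong refl)
          fix i assume i: "i \<in> {..<M}"
          show "D l i * (g (i, j) - g' (i, j)) = (if i = l then D l l * (g (l, j) - g' (l, j)) else 0)"
            using less.IH[of i] D(2)[OF True, of i] i by (cases i l rule: linorder_cases) auto
        qed
        also have "\<dots> = D l l * (g (l, j) - g' (l, j))"
          using less.prems by simp
        finally have cj: "comb M (D l) g j - comb M (D l) g' j = D l l * (g (l, j) - g' (l, j))" .
        have "V l g - V l g' = (\<Sum>\<kappa>\<in>UNIV. z \<kappa> * (comb M (D l) g \<kappa> - comb M (D l) g' \<kappa>))"
          by (simp add: V_def sum_subtractf algebra_simps)
        also have "\<dots> = z j * (comb M (D l) g j - comb M (D l) g' j)"
          by (subst sum.remove[of _ j]) (use c in auto)
        finally have V: "V l g - V l g' = z j * D l l * (g (l, j) - g' (l, j))"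
          by (simp add: cj)
        show ?thesis
        proof (rule ccontr)
          assume "g (l, j) \<noteq> g' (l, j)"
          then have "\<bar>D l l * (g (l, j) - g' (l, j))\<bar> \<ge> 1"
            using D(1)[OF True] by (smt (verit) mult_eq_0_iff)
          then have "\<bar>z j\<bar> * 1 \<le> \<bar>z j\<bar> * \<bar>D l l * (g (l, j) - g' (l, j))\<bar>"
            by (intro mult_left_mono) auto
          then have "\<bar>z j\<bar> \<le> \<bar>V l g - V l g'\<bar>"
            unfolding V by (simp add: abs_mult mult.assoc)
          then have "1 \<le> \<bar>real_of_int (V l g - V l g')\<bar> / \<bar>z j\<bar>"
            using zpos by (subst le_divide_eq_1_pos) (auto simp flip: of_int_abs)
          also have "\<dots> = \<bar>real_of_int (V l g) / \<bar>z j\<bar> - real_of_int (V l g') / \<bar>z j\<bar>\<bar>"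
            using zpos by (simp add: diff_divide_distrib[symmetric])
          finally show False
            using bins[OF True] by linarith
        qed
      qed
    qed
    show "g = g'"
    proof (rule extensionalityI[OF ext])
      fix x :: "nat \<times> 'c" assume "x \<in> {..<M} \<times> UNIV"
      then show "g x = g' x"
        using onJ[of x] col[of "fst x"] by (cases "snd x = j") (auto simp: J_def)
    qed
  qed
  have img: "?f ` X \<subseteq> PiE J (\<lambda>_. {0..<q}) \<times> PiE I (\<lambda>_. {\<lfloor>-w\<rfloor>..\<lfloor>w\<rfloor>})"
  proof
    fix y assume "y \<in> ?f ` X"
    then obtain g where g: "g \<in> X" and y: "y = ?f g" by auto
    have "?bin l g \<in> {\<lfloor>-w\<rfloor>..\<lfloor>w\<rfloor>}" if "l \<in> I" for l
    proof -
      have "\<bar>real_of_int (V l g)\<bar> < W" using g that by (auto simp: X_def)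
      then have "real_of_int (V l g) / \<bar>z j\<bar> \<le> w" "-w \<le> real_of_int (V l g) / \<bar>z j\<bar>"
        unfolding w_def minus_divide_left using zpos by (intro divide_right_mono; linarith)+
      then show ?thesis by (auto intro: floor_mono)
    qed
    moreover have "g x \<in> {0..<q}" if "x \<in> J" for x
      using g that by (auto simp: X_def gens_def J_def PiE_def Pi_def)
    ultimately show "y \<in> PiE J (\<lambda>_. {0..<q}) \<times> PiE I (\<lambda>_. {\<lfloor>-w\<rfloor>..\<lfloor>w\<rfloor>})"
      unfolding y by auto
  qed
  have cardJ: "card J = M * CARD('c) - card I"
    unfolding J_def using I finI
    by (subst card_Diff_subset) (auto simp: card_cartesian_product)
  have "card X \<le> card (PiE J (\<lambda>_. {0..<q}) \<times> PiE I (\<lambda>_. {\<lfloor>-w\<rfloor>..\<lfloor>w\<rfloor>}))"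
    using card_mono[OF _ img] card_image[OF inj] finI
    by (simp add: finite_PiE J_def)
  also have "\<dots> = nat q ^ (M * CARD('c) - card I) * nat (\<lfloor>w\<rfloor> - \<lfloor>-w\<rfloor> + 1) ^ card I"
    using finI by (simp add: card_cartesian_product card_PiE cardJ[symmetric] J_def)
  finally have "real (card X) \<le> real (nat q ^ (M * CARD('c) - card I) * nat (\<lfloor>w\<rfloor> - \<lfloor>-w\<rfloor> + 1) ^ card I)"
    by linarith
  also have "\<dots> = real_of_int q ^ (M * CARD('c) - card I) * real (nat (\<lfloor>w\<rfloor> - \<lfloor>-w\<rfloor> + 1)) ^ card I"
    using q by simp
  also have "\<dots> \<le> real_of_int q ^ (M * CARD('c) - card I) * (2 * w + 2) ^ card I"
  proof (intro mult_left_mono power_mono)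
    have w0: "w \<ge> 0" using W by (simp add: w_def)
    then have "\<lfloor>-w\<rfloor> \<le> \<lfloor>w\<rfloor>" by (intro floor_mono) simp
    then show "real (nat (\<lfloor>w\<rfloor> - \<lfloor>-w\<rfloor> + 1)) \<le> 2 * w + 2"
      using w0 by (simp add: of_nat_nat) linarith
  qed (use q in auto)
  finally show ?thesis
    unfolding X_def V_def w_def by simp
qed

lemma card_UN_bound:
  assumes "finite X" "\<And>x. x \<in> X \<Longrightarrow> real (card (f x)) \<le> B"
  shows "real (card (\<Union>x\<in>X. f x)) \<le> real (card X) * B"
proof -
  have "real (card (\<Union>x\<in>X. f x)) \<le> (\<Sum>x\<in>X. real (card (f x)))"
    using card_UN_le[OF assms(1), of f] by (metis of_nat_le_iff of_nat_sum)
  also have "\<dots> \<le> real (card X) * B"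
    using sum_bounded_above[of X "\<lambda>x. real (card (f x))" B] assms(2) by simp
  finally show ?thesis .
qed

text \<open>
  The vector \<open>z\<close> runs over a net of directions, scaled to integers of size at most \<open>Q\<close>, and \<open>D\<close> over systems
  of \<open>p\<close> differences in triangular position that all lie in the plank orthogonal to \<open>z\<close>.
\<close>

definition bad_gens :: "nat \<Rightarrow> int \<Rightarrow> nat \<Rightarrow> int \<Rightarrow> int \<Rightarrow> real \<Rightarrow> (nat \<times> 'c::finite \<Rightarrow> int) set" where
  "bad_gens M q p G Q W = {g \<in> gens M q. \<exists>z j I D. (\<forall>\<kappa>. \<bar>z \<kappa>\<bar> \<le> Q) \<and> Q \<le> 2 * int CARD('c) * \<bar>z j\<bar> \<and>
     I \<subseteq> {..<M} \<and> card I = p \<and>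
     (\<forall>l\<in>I. D l \<in> PiE {..<M} (\<lambda>_. {-G..G}) \<and> D l l \<noteq> 0 \<and> (\<forall>i. l < i \<longrightarrow> i < M \<longrightarrow> D l i = 0) \<and>
        \<bar>real_of_int (\<Sum>\<kappa>\<in>UNIV. z \<kappa> * comb M (D l) g \<kappa>)\<bar> < W)}"

text \<open>
  A union bound over the net, the pivot coordinate \<open>j\<close>, the index set and the differences.
\<close>

lemma card_bad_gens:
  fixes W :: real
  assumes q: "q > 0" and Q: "Q > 0" and G: "G \<ge> 0" and W: "W \<ge> 0"
  shows "real (card (bad_gens M q p G Q W :: (nat \<times> 'c::finite \<Rightarrow> int) set)) \<le>
    (2 * Q + 1) ^ CARD('c) * (CARD('c) * (2 ^ M * ((2 * G + 1) ^ (M * p) *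
      (real_of_int q ^ (M * CARD('c) - p) * (4 * CARD('c) * W / Q + 2) ^ p))))"
proof -
  let ?n = "CARD('c)"
  define Z where "Z = PiE (UNIV :: 'c set) (\<lambda>_. {-Q..Q})"
  define JJ where "JJ z = {j::'c. Q \<le> 2 * int ?n * \<bar>z j\<bar>}" for z :: "'c \<Rightarrow> int"
  define II where "II = {I. I \<subseteq> {..<M} \<and> card I = p}"
  define DD where "DD I = {D \<in> PiE I (\<lambda>_. PiE {..<M} (\<lambda>_. {-G..G})).
     \<forall>l\<in>I. D l l \<noteq> 0 \<and> (\<forall>i. l < i \<longrightarrow> i < M \<longrightarrow> D l i = 0)}" for I
  define BB where "BB z I D = {g \<in> gens M q. \<forall>l\<in>I. \<bar>real_of_int (\<Sum>\<kappa>\<in>UNIV. z \<kappa> * comb M (D l) g \<kappa>)\<bar> < W}"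
    for z :: "'c \<Rightarrow> int" and I and D :: "nat \<Rightarrow> nat \<Rightarrow> int"
  let ?B = "real_of_int q ^ (M * ?n - p) * (4 * ?n * W / Q + 2) ^ p"
  have B0: "?B \<ge> 0" using q W Q by simp
  have fin: "finite Z" "finite II" "finite (DD I)" if "finite I" for I
    unfolding Z_def II_def DD_def using that by (auto intro!: finite_PiE)
  have finJ: "finite (JJ z)" for z by simp
  have sub: "bad_gens M q p G Q W \<subseteq> (\<Union>z\<in>Z. \<Union>j\<in>JJ z. \<Union>I\<in>II. \<Union>D\<in>DD I. BB z I D)"
  proof
    fix g :: "nat \<times> 'c \<Rightarrow> int" assume "g \<in> bad_gens M q p G Q W"
    then obtain z j I D where g: "g \<in> gens M q" and z: "\<forall>\<kappa>. \<bar>z \<kappa>\<bar> \<le> Q" and j: "Q \<le> 2 * int ?n * \<bar>z j\<bar>"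
      and I: "I \<subseteq> {..<M}" "card I = p"
      and D: "\<forall>l\<in>I. D l \<in> PiE {..<M} (\<lambda>_. {-G..G}) \<and> D l l \<noteq> 0 \<and> (\<forall>i. l < i \<longrightarrow> i < M \<longrightarrow> D l i = 0) \<and>
        \<bar>real_of_int (\<Sum>\<kappa>\<in>UNIV. z \<kappa> * comb M (D l) g \<kappa>)\<bar> < W"
      unfolding bad_gens_def by blast
    have "z \<in> Z" using z by (auto simp: Z_def abs_le_iff minus_le_iff)
    moreover have "j \<in> JJ z" using j by (simp add: JJ_def)
    moreover have "I \<in> II" using I by (simp add: II_def)
    moreover have "restrict D I \<in> DD I"
      using D by (auto simp: DD_def)
    moreover have "g \<in> BB z I (restrict D I)"
      using g D by (auto simp: BB_def)
    ultimately show "g \<in> (\<Union>z\<in>Z. \<Union>j\<in>JJ z. \<Union>I\<in>II. \<Union>D\<in>DD I. BB z I D)" by blast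
  qed
  have bound1: "real (card (BB z I D)) \<le> ?B" if "z \<in> Z" "j \<in> JJ z" "I \<in> II" "D \<in> DD I" for z j I D
  proof -
    have zj: "z j \<noteq> 0" using that(2) Q by (auto simp: JJ_def)
    have I: "I \<subseteq> {..<M}" "card I = p" using that by (auto simp: II_def)
    have "real (card (BB z I D)) \<le> real_of_int q ^ (M * ?n - card I) * (2 * W / \<bar>z j\<bar> + 2) ^ card I"
      unfolding BB_def using card_plank_gens[of I M z j W q D] I zj W q that by (auto simp: DD_def)
    also have "\<dots> \<le> ?B"
    proof -
      have "real_of_int Q \<le> real_of_int (2 * int ?n * \<bar>z j\<bar>)"
        using that(2) unfolding JJ_def of_int_le_iff by simp
      then have "Q \<le> 2 * ?n * real_of_int \<bar>z j\<bar>" by simp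
      then have "2 * W * Q \<le> 2 * W * (2 * ?n * real_of_int \<bar>z j\<bar>)"
        using W by (intro mult_left_mono) auto
      then have "2 * W / real_of_int \<bar>z j\<bar> \<le> 4 * ?n * W / Q"
        using zj Q by (simp add: field_simps)
      then show ?thesis
        unfolding I(2) using W q by (intro mult_left_mono power_mono) auto
    qed
    finally show ?thesis .
  qed
  have cDD: "real (card (DD I)) \<le> (2 * G + 1) ^ (M * p)" if "I \<in> II" for I
  proof -
    have I: "I \<subseteq> {..<M}" "card I = p" "finite I" using that by (auto simp: II_def finite_subset)
    have "card (DD I) \<le> card (PiE I (\<lambda>_. PiE {..<M} (\<lambda>_. {-G..G})))"
      unfolding DD_def using I(3) by (intro card_mono finite_PiE) auto
    also have "\<dots> = nat (2 * G + 1) ^ (M * p)"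
      using I by (simp add: card_PiE power_mult add.commute)
    finally have "real (card (DD I)) \<le> real (nat (2 * G + 1) ^ (M * p))" by linarith
    then show ?thesis using G by simp
  qed
  have fI: "finite I" if "I \<in> II" for I using that by (auto simp: II_def finite_subset)
  have bound2: "real (card (\<Union>D\<in>DD I. BB z I D)) \<le> (2 * G + 1) ^ (M * p) * ?B"
    if "z \<in> Z" "j \<in> JJ z" "I \<in> II" for z j I
  proof -
    have "real (card (\<Union>D\<in>DD I. BB z I D)) \<le> real (card (DD I)) * ?B"
      by (rule card_UN_bound[OF fin(3)[OF fI[OF that(3)]] bound1[OF that]])
    also have "\<dots> \<le> (2 * G + 1) ^ (M * p) * ?B"
      using cDD[OF that(3)] B0 by (intro mult_right_mono)
    finally show ?thesis .
  qed
  have cII: "real (card II) \<le> 2 ^ M"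
  proof -
    have "card II \<le> card (Pow {..<M})" unfolding II_def by (intro card_mono) auto
    then show ?thesis by (simp add: card_Pow)
  qed
  have G0: "0 \<le> (2 * G + 1) ^ (M * p) * ?B" using G B0 by simp
  have bound3: "real (card (\<Union>I\<in>II. \<Union>D\<in>DD I. BB z I D)) \<le> 2 ^ M * ((2 * G + 1) ^ (M * p) * ?B)"
    if "z \<in> Z" "j \<in> JJ z" for z j
    by (rule order_trans[OF card_UN_bound[OF fin(2)[OF finite.emptyI] bound2[OF that]] mult_right_mono[OF cII G0]])
  have cJJ: "real (card (JJ z)) \<le> ?n" for z
    by (simp add: card_mono)
  have G1: "0 \<le> 2 ^ M * ((2 * G + 1) ^ (M * p) * ?B)" using G0 by simp
  have bound4: "real (card (\<Union>j\<in>JJ z. \<Union>I\<in>II. \<Union>D\<in>DD I. BB z I D)) \<le> ?n * (2 ^ M * ((2 * G + 1) ^ (M * p) * ?B))"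
    if "z \<in> Z" for z
    by (rule order_trans[OF card_UN_bound[OF finJ bound3[OF that]] mult_right_mono[OF cJJ G1]])
  have cZ: "real (card Z) = (2 * Q + 1) ^ ?n"
    unfolding Z_def using Q by (simp add: card_PiE add.commute)
  have finU: "finite (\<Union>z\<in>Z. \<Union>j\<in>JJ z. \<Union>I\<in>II. \<Union>D\<in>DD I. BB z I D)"
    by (rule finite_subset[OF _ finite_gens[of M q]]) (auto simp: BB_def)
  have "real (card (bad_gens M q p G Q W :: (nat \<times> 'c \<Rightarrow> int) set))
      \<le> real (card (\<Union>z\<in>Z. \<Union>j\<in>JJ z. \<Union>I\<in>II. \<Union>D\<in>DD I. BB z I D))"
    using card_mono[OF finU sub] by simp
  also have "\<dots> \<le> real (card Z) * (?n * (2 ^ M * ((2 * G + 1) ^ (M * p) * ?B)))"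
    by (rule card_UN_bound[OF fin(1)[of "{}"] bound4]) auto
  finally show ?thesis unfolding cZ by simp
qed

text \<open>
  If the plank contained more points, \<open>branching_indices\<close> would give \<open>p\<close> differences in triangular
  position in the plank of twice the width. Their integer parts \<open>e\<close> cancel. Rounding \<open>Q u\<close> to an integer vector moves
  all relevant values by at most \<open>\<tau> Q q\<close>, so \<open>g\<close> would be bad.
\<close>

lemma plank_count:
  fixes g :: "nat \<times> 'c::finite \<Rightarrow> int" and u :: "'c \<Rightarrow> real"
  assumes g: "g \<in> gens M q" "g \<notin> bad_gens M q p (2 * H) Q (3 * \<tau> * Q * q)"
    and q: "q > 0" and H: "H \<ge> 0" and \<tau>: "\<tau> > 0"
    and Q: "Q \<ge> 2 * int CARD('c)" "real CARD('c) * M * (2 * H) \<le> \<tau> * Q"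
    and u: "\<And>\<kappa>. \<bar>u \<kappa>\<bar> \<le> 1" "\<bar>u j\<bar> \<ge> 1 / CARD('c)"
  shows "card {(a, e). a \<in> PiE {..<M} (\<lambda>_. {-H..H}) \<and> e \<in> PiE UNIV (\<lambda>_. {-H..H}) \<and>
      \<bar>\<Sum>\<kappa>\<in>UNIV. u \<kappa> * (real_of_int (comb M a g \<kappa>) / q + real_of_int (e \<kappa>))\<bar> < \<tau>}
    \<le> nat (2 * H + 1) ^ (CARD('c) + p)" (is "card ?T \<le> _")
proof (rule ccontr)
  let ?n = "CARD('c)"
  define T where "T = ?T"
  define E where "E = PiE (UNIV :: 'c set) (\<lambda>_. {-H..H})"
  have "finite E"
    unfolding E_def by (intro finite_PiE) auto
  moreover have "card E = nat (2 * H + 1) ^ ?n"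
    by (simp add: E_def card_PiE add.commute)
  ultimately have cE: "card E = nat (2 * H + 1) ^ ?n" "finite E" by simp_all
  assume "\<not> ?thesis"
  then have big: "card T > card E * nat (2 * H + 1) ^ p"
    by (simp add: T_def cE power_add)
  have sub: "T \<subseteq> PiE {..<M} (\<lambda>_. {-H..H}) \<times> E" by (auto simp: T_def E_def)
  obtain I where I: "I \<subseteq> {..<M}" "card I = p"
    and br: "\<And>l. l \<in> I \<Longrightarrow> \<exists>a a' e. (a, e) \<in> T \<and> (a', e) \<in> T \<and> a l \<noteq> a' l \<and> (\<forall>i. l < i \<longrightarrow> a i = a' i)"
    using branching_indices[OF sub cE(2) H big] by blast
  from br obtain a a' e where br: "\<And>l. l \<in> I \<Longrightarrow> (a l, e l) \<in> T" "\<And>l. l \<in> I \<Longrightarrow> (a' l, e l) \<in> T"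
    "\<And>l. l \<in> I \<Longrightarrow> a l l \<noteq> a' l l" "\<And>l i. l \<in> I \<Longrightarrow> l < i \<Longrightarrow> a l i = a' l i"
    by metis
  define D where "D l = restrict (\<lambda>i. a l i - a' l i) {..<M}" for l
  define z where "z \<kappa> = \<lfloor>Q * u \<kappa>\<rfloor>" for \<kappa>
  have Q0: "Q > 0" using Q(1) zero_less_card_finite[where 'a='c] by linarith
  have z: "\<bar>real_of_int (z \<kappa>) - Q * u \<kappa>\<bar> \<le> 1" for \<kappa>
    unfolding z_def by linarith
  have "\<bar>z \<kappa>\<bar> \<le> Q" for \<kappa>
  proof -
    have "\<bar>Q * u \<kappa>\<bar> \<le> real_of_int Q * 1" unfolding abs_mult using u(1)[of \<kappa>] Q0 by (intro mult_mono) auto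
    then show ?thesis unfolding z_def by linarith
  qed
  moreover have "Q \<le> 2 * int ?n * \<bar>z j\<bar>"
  proof -
    have "Q * (1 / ?n) \<le> Q * \<bar>u j\<bar>" using u(2) Q0 by (intro mult_left_mono) auto
    then have 1: "Q / ?n \<le> \<bar>Q * u j\<bar>" using Q0 by (simp add: abs_mult)
    have 2: "\<bar>real_of_int (z j)\<bar> \<ge> \<bar>Q * u j\<bar> - 1" using z[of j] by linarith
    have n0: "real ?n > 0" by simp
    have "Q - ?n = ?n * (Q / ?n - 1)" by (simp add: field_simps)
    also have "\<dots> \<le> ?n * \<bar>real_of_int (z j)\<bar>"
      using 1 2 by (intro mult_left_mono) auto
    finally have "real_of_int (Q - int ?n) \<le> real_of_int (int ?n * \<bar>z j\<bar>)" by simp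
    then have "Q - int ?n \<le> int ?n * \<bar>z j\<bar>" by (simp only: of_int_le_iff)
    then show ?thesis using Q(1) by linarith
  qed
  moreover have "\<forall>l\<in>I. D l \<in> PiE {..<M} (\<lambda>_. {-(2*H)..2*H}) \<and> D l l \<noteq> 0 \<and> (\<forall>i. l < i \<longrightarrow> i < M \<longrightarrow> D l i = 0) \<and>
        \<bar>real_of_int (\<Sum>\<kappa>\<in>UNIV. z \<kappa> * comb M (D l) g \<kappa>)\<bar> < 3 * \<tau> * Q * q"
  proof (intro ballI conjI)
    fix l assume l: "l \<in> I"
    have aa: "a l i \<in> {-H..H}" "a' l i \<in> {-H..H}" if "i < M" for i
      using br(1,2)[OF l] that by (auto simp: T_def PiE_def Pi_def)
    show DP: "D l \<in> PiE {..<M} (\<lambda>_. {-(2*H)..2*H})"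
    proof -
      have "a l i - a' l i \<in> {-(2*H)..2*H}" if "i < M" for i
        using aa[OF that] by auto
      then show ?thesis unfolding D_def by (subst restrict_PiE_iff) blast
    qed
    show "D l l \<noteq> 0" "\<forall>i. l < i \<longrightarrow> i < M \<longrightarrow> D l i = 0"
      using br(3,4)[OF l] l I by (auto simp: D_def)
    have cD: "comb M (D l) g \<kappa> = comb M (a l) g \<kappa> - comb M (a' l) g \<kappa>" for \<kappa>
      by (simp add: comb_def D_def sum_subtractf algebra_simps)
    let ?U = "\<Sum>\<kappa>\<in>UNIV. u \<kappa> * real_of_int (comb M (D l) g \<kappa>)"
    have "?U / q = (\<Sum>\<kappa>\<in>UNIV. u \<kappa> * (real_of_int (comb M (a l) g \<kappa>) / q + real_of_int (e l \<kappa>)))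
        - (\<Sum>\<kappa>\<in>UNIV. u \<kappa> * (real_of_int (comb M (a' l) g \<kappa>) / q + real_of_int (e l \<kappa>)))"
      by (simp add: cD sum_subtractf[symmetric] sum_divide_distrib algebra_simps diff_divide_distrib)
    moreover have "\<bar>\<Sum>\<kappa>\<in>UNIV. u \<kappa> * (real_of_int (comb M (a l) g \<kappa>) / q + real_of_int (e l \<kappa>))\<bar> < \<tau>"
      "\<bar>\<Sum>\<kappa>\<in>UNIV. u \<kappa> * (real_of_int (comb M (a' l) g \<kappa>) / q + real_of_int (e l \<kappa>))\<bar> < \<tau>"
      using br(1,2)[OF l] by (auto simp: T_def)
    ultimately have "\<bar>?U / q\<bar> < 2 * \<tau>" by linarith
    then have U: "\<bar>?U\<bar> < 2 * \<tau> * q" using q by (simp add: divide_less_eq)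
    have cb: "\<bar>real_of_int (comb M (D l) g \<kappa>)\<bar> \<le> M * (2 * H) * q" for \<kappa>
    proof -
      have "\<bar>comb M (D l) g \<kappa>\<bar> \<le> (\<Sum>i<M. \<bar>D l i * g (i, \<kappa>)\<bar>)"
        unfolding comb_def by (rule sum_abs)
      also have "\<dots> \<le> (\<Sum>i<M. (2 * H) * q)"
      proof (intro sum_mono)
        fix i assume i: "i \<in> {..<M}"
        have "\<bar>D l i\<bar> \<le> 2 * H" using aa[of i] i by (auto simp: D_def)
        moreover have "\<bar>g (i, \<kappa>)\<bar> \<le> q" 
          using PiE_mem[OF g(1)[unfolded gens_def], of "(i, \<kappa>)"] i by simp
        ultimately show "\<bar>D l i * g (i, \<kappa>)\<bar> \<le> (2 * H) * q"
          unfolding abs_mult by (intro mult_mono) auto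
      qed
      finally have "\<bar>comb M (D l) g \<kappa>\<bar> \<le> int M * (2 * H) * q" by simp
      then have "real_of_int \<bar>comb M (D l) g \<kappa>\<bar> \<le> real_of_int (int M * (2 * H) * q)"
        by (simp only: of_int_le_iff)
      then show ?thesis by simp
    qed
    have "real_of_int (\<Sum>\<kappa>\<in>UNIV. z \<kappa> * comb M (D l) g \<kappa>)
        = Q * ?U + (\<Sum>\<kappa>\<in>UNIV. (real_of_int (z \<kappa>) - Q * u \<kappa>) * real_of_int (comb M (D l) g \<kappa>))"
      by (simp add: sum_distrib_left sum.distrib[symmetric] algebra_simps)
    also have "\<bar>\<dots>\<bar> \<le> \<bar>Q * ?U\<bar> + \<bar>\<Sum>\<kappa>\<in>UNIV. (real_of_int (z \<kappa>) - Q * u \<kappa>) * real_of_int (comb M (D l) g \<kappa>)\<bar>"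
      by (rule abs_triangle_ineq)
    also have "\<bar>\<Sum>\<kappa>\<in>UNIV. (real_of_int (z \<kappa>) - Q * u \<kappa>) * real_of_int (comb M (D l) g \<kappa>)\<bar>
        \<le> (\<Sum>\<kappa>\<in>(UNIV::'c set). 1 * (real M * (2 * real_of_int H) * real_of_int q))"
      by (rule order_trans[OF sum_abs], intro sum_mono)
        (unfold abs_mult, intro mult_mono z, use cb q H in auto)
    also have "\<dots> = (real ?n * M * (2 * H)) * q" by simp
    also have "\<dots> \<le> (\<tau> * Q) * q" using Q(2) q by (intro mult_right_mono) auto
    also have "\<bar>Q * ?U\<bar> < Q * (2 * \<tau> * q)"
      unfolding abs_mult using U Q0 by simp
    finally show "\<bar>real_of_int (\<Sum>\<kappa>\<in>UNIV. z \<kappa> * comb M (D l) g \<kappa>)\<bar> < 3 * \<tau> * Q * q"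
      by (simp add: algebra_simps)
  qed
  ultimately have "g \<in> bad_gens M q p (2 * H) Q (3 * \<tau> * Q * q)"
    unfolding bad_gens_def using g(1) I by blast
  with g(2) show False by contradiction
qed

section \<open>Random generators: most target sets are hit\<close>

definition residues :: "int \<Rightarrow> ('c::finite \<Rightarrow> int) set" where
  "residues q = PiE UNIV (\<lambda>_. {0..<q})"

definition comb_mod :: "nat \<Rightarrow> int \<Rightarrow> (nat \<Rightarrow> int) \<Rightarrow> (nat \<times> 'c \<Rightarrow> int) \<Rightarrow> 'c \<Rightarrow> int" where
  "comb_mod M q a g = (\<lambda>\<kappa>. comb M a g \<kappa> mod q)"

lemma residues_iff: "r \<in> residues q \<longleftrightarrow> (\<forall>\<kappa>. 0 \<le> r \<kappa> \<and> r \<kappa> < q)"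
  by (auto simp: residues_def PiE_def Pi_def extensional_def)

lemma card_residues: "card (residues q :: ('c::finite \<Rightarrow> int) set) = nat q ^ CARD('c)"
  by (simp add: residues_def card_PiE)

lemma finite_residues: "finite (residues q)"
  unfolding residues_def by (intro finite_PiE) auto

lemma comb_mod_residues: "q > 0 \<Longrightarrow> comb_mod M q a g \<in> residues q"
  by (simp add: residues_iff comb_mod_def)

lemma solve_mod_prime:
  fixes b c q :: int
  assumes q: "prime q" and b: "\<not> q dvd b"
  shows "\<exists>t. [b * t = c] (mod q)"
proof -
  have "coprime b q"
    using prime_imp_coprime[OF q b] by (simp add: coprime_commute)
  then obtain u v where "u * b + v * q = 1"
    using bezout_int[of b q] by (auto simp: coprime_iff_gcd_eq_1)
  then have "b * (u * c) - c = q * (- v * c)" by algebra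
  then have "[b * (u * c) = c] (mod q)"
    by (simp add: cong_iff_dvd_diff)
  then show ?thesis by blast
qed

text \<open>
  Both first coefficients equal \<open>1\<close>, so the \<open>2 \<times> 2\<close> determinant formed by the indices \<open>0\<close> and \<open>i\<close> is
  \<open>a' i - a i\<close>, a unit modulo the prime \<open>q\<close>.
\<close>

lemma comb_mod_pair_surj:
  fixes x y :: "'c::finite \<Rightarrow> int"
  assumes q: "prime q" and a: "a 0 = 1" "a' 0 = 1" "i < M" "\<not> q dvd a i - a' i"
    and xy: "x \<in> residues q" "y \<in> residues q"
  shows "\<exists>h. comb_mod M q a h = x \<and> comb_mod M q a' h = y"
proof -
  have i0: "i \<noteq> 0" using a by (intro notI) simp
  have "\<exists>t. \<forall>\<kappa>. [(a i - a' i) * t \<kappa> = x \<kappa> - y \<kappa>] (mod q)"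
    using solve_mod_prime[OF q a(4)] by (intro choice allI)
  then obtain t where t: "\<And>\<kappa>. [(a i - a' i) * t \<kappa> = x \<kappa> - y \<kappa>] (mod q)" by blast
  define h where "h = (\<lambda>(l, \<kappa>). if l = i then t \<kappa> else if l = 0 then x \<kappa> - a i * t \<kappa> else 0)"
  have c: "comb M b h \<kappa> = x \<kappa> - a i * t \<kappa> + b i * t \<kappa>" if "b 0 = 1" for b \<kappa>
  proof -
    have "comb M b h \<kappa> = (\<Sum>l<M. if l = i then b i * t \<kappa> else if l = 0 then x \<kappa> - a i * t \<kappa> else 0)"
      unfolding comb_def h_def using that by (intro sum.cong refl) auto
    also have "\<dots> = (\<Sum>l\<in>{0, i}. if l = i then b i * t \<kappa> else if l = 0 then x \<kappa> - a i * t \<kappa> else 0)"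
      using a(3) by (intro sum.mono_neutral_right) auto
    finally show ?thesis using i0 by simp
  qed
  have "comb_mod M q a h \<kappa> = x \<kappa>" for \<kappa>
    using xy(1) by (simp add: comb_mod_def c[of a, OF a(1)] residues_iff)
  moreover have "comb_mod M q a' h \<kappa> = y \<kappa>" for \<kappa>
  proof -
    have "[x \<kappa> - (a i - a' i) * t \<kappa> = x \<kappa> - (x \<kappa> - y \<kappa>)] (mod q)"
      by (intro cong_diff t cong_refl)
    then have "(x \<kappa> - a i * t \<kappa> + a' i * t \<kappa>) mod q = y \<kappa> mod q"
      by (simp add: cong_def algebra_simps)
    then show ?thesis using xy(2) by (simp add: comb_mod_def c[of a', OF a(2)] residues_iff)
  qed
  ultimately show ?thesis by blast
qed

definition pair_fibre where
  "pair_fibre M q a a' x y = {g \<in> gens M q. comb_mod M q a g = x \<and> comb_mod M q a' g = y}"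

lemma comb_mod_shift:
  "comb_mod M q a (\<lambda>z. if z \<in> {..<M} \<times> UNIV then (g z + h z) mod q else undefined) \<kappa>
    = (comb_mod M q a g \<kappa> + comb_mod M q a h \<kappa>) mod q"
proof -
  have "comb M a (\<lambda>z. if z \<in> {..<M} \<times> UNIV then (g z + h z) mod q else undefined) \<kappa> mod q
     = (\<Sum>i<M. a i * ((g (i, \<kappa>) + h (i, \<kappa>)) mod q)) mod q"
    unfolding comb_def by simp
  also have "\<dots> = (\<Sum>i<M. a i * (g (i, \<kappa>) + h (i, \<kappa>))) mod q"
    by (subst mod_sum_eq[symmetric], subst mod_mult_right_eq, subst mod_sum_eq) simp
  also have "\<dots> = (comb M a g \<kappa> + comb M a h \<kappa>) mod q"
    by (simp add: comb_def sum.distrib algebra_simps)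
  finally show ?thesis
    by (simp add: comb_mod_def mod_add_eq)
qed

lemma card_pair_fibre_le:
  fixes x y x' y' :: "'c::finite \<Rightarrow> int"
  assumes q: "prime q" and a: "a 0 = 1" "a' 0 = 1" "i < M" "\<not> q dvd a i - a' i"
    and xy: "x \<in> residues q" "y \<in> residues q" "x' \<in> residues q" "y' \<in> residues q"
  shows "card (pair_fibre M q a a' x y) \<le> card (pair_fibre M q a a' x' y')"
proof -
  have q0: "q > 0" using q by (rule prime_gt_0_int)
  have "(\<lambda>\<kappa>::'c. (x' \<kappa> - x \<kappa>) mod q) \<in> residues q" "(\<lambda>\<kappa>::'c. (y' \<kappa> - y \<kappa>) mod q) \<in> residues q"
    using q0 by (auto simp: residues_iff)
  from comb_mod_pair_surj[where a = a and a' = a' and i = i, OF q a this]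
  obtain h where h: "comb_mod M q a h = (\<lambda>\<kappa>. (x' \<kappa> - x \<kappa>) mod q)"
      "comb_mod M q a' h = (\<lambda>\<kappa>. (y' \<kappa> - y \<kappa>) mod q)" by blast
  define s where "s g = (\<lambda>z. if z \<in> {..<M} \<times> (UNIV::'c set) then (g z + h z) mod q else undefined)" for g
  have inj: "inj_on s (pair_fibre M q a a' x y)"
  proof (rule inj_onI)
    fix g g' assume gg: "g \<in> pair_fibre M q a a' x y" "g' \<in> pair_fibre M q a a' x y" and eq: "s g = s g'"
    have G: "g \<in> gens M q" "g' \<in> gens M q" using gg by (auto simp: pair_fibre_def)
    then have E: "g \<in> extensional ({..<M} \<times> UNIV)" "g' \<in> extensional ({..<M} \<times> UNIV)"
      by (auto simp: gens_def PiE_def)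
    show "g = g'"
    proof (rule extensionalityI[OF E])
      fix z :: "nat \<times> 'c" assume z: "z \<in> {..<M} \<times> UNIV"
      have r: "g z \<in> {0..<q}" "g' z \<in> {0..<q}"
        using G z unfolding gens_def by (auto intro: PiE_mem)
      have "[g z + h z = g' z + h z] (mod q)"
        using fun_cong[OF eq, of z] z unfolding s_def by (simp add: cong_def)
      then have "[g z = g' z] (mod q)" by (simp add: cong_add_rcancel)
      then show "g z = g' z" using r by (simp add: cong_def)
    qed
  qed
  have "s g \<in> pair_fibre M q a a' x' y'" if "g \<in> pair_fibre M q a a' x y" for g
  proof -
    have g: "comb_mod M q a g = x" "comb_mod M q a' g = y" using that by (auto simp: pair_fibre_def)
    have "comb_mod M q a (s g) = x'" "comb_mod M q a' (s g) = y'"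
      using xy unfolding s_def by (auto simp: comb_mod_shift g h mod_add_right_eq residues_iff)
    moreover have "s g \<in> gens M q"
      unfolding gens_def by (intro PiE_I) (use q0 in \<open>auto simp: s_def\<close>)
    ultimately show ?thesis by (simp add: pair_fibre_def)
  qed
  then have "s ` pair_fibre M q a a' x y \<subseteq> pair_fibre M q a a' x' y'" by blast
  then have "card (s ` pair_fibre M q a a' x y) \<le> card (pair_fibre M q a a' x' y')"
    by (intro card_mono finite_subset[OF _ finite_gens[of M q]]) (auto simp: pair_fibre_def)
  then show ?thesis by (simp add: card_image[OF inj])
qed

text \<open>
  Translations of the generators permute the fibres of the pair of residue maps, which is onto; hence all
  fibres have the same size. This is the pairwise independence behind the second moment.
\<close>

lemma card_pair_equidistributed:
  fixes T T' :: "('c::finite \<Rightarrow> int) set"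
  assumes q: "prime q" and a: "a 0 = 1" "a' 0 = 1" "i < M" "\<not> q dvd a i - a' i"
    and T: "T \<subseteq> residues q" "T' \<subseteq> residues q"
  shows "card {g \<in> gens M q. comb_mod M q a g \<in> T \<and> comb_mod M q a' g \<in> T'} * nat q ^ (2 * CARD('c))
    = card T * card T' * card (gens M q :: (nat \<times> 'c \<Rightarrow> int) set)"
proof -
  have q0: "q > 0" using q by (rule prime_gt_0_int)
  define F where "F = card (pair_fibre M q a a' (\<lambda>_::'c. 0) (\<lambda>_. 0))"
  have z: "(\<lambda>_::'c. 0) \<in> residues q" using q0 by (simp add: residues_iff)
  have F: "card (pair_fibre M q a a' x y) = F" if "x \<in> residues q" "y \<in> residues q" for x y :: "'c \<Rightarrow> int"
    unfolding F_def
    by (intro antisym card_pair_fibre_le[where a = a and a' = a' and i = i, OF q a] that z)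
  have fin: "finite (pair_fibre M q a a' x y)" for x y :: "'c \<Rightarrow> int"
    by (rule finite_subset[OF _ finite_gens[of M q]]) (auto simp: pair_fibre_def)
  have gen: "card {g \<in> gens M q. comb_mod M q a g \<in> T \<and> comb_mod M q a' g \<in> T'} = card T * card T' * F"
    if T: "T \<subseteq> residues q" "T' \<subseteq> residues q" for T T' :: "('c \<Rightarrow> int) set"
  proof -
    have finT: "finite T" "finite T'" using T finite_residues finite_subset by blast+
    have "{g \<in> gens M q. comb_mod M q a g \<in> T \<and> comb_mod M q a' g \<in> T'}
      = (\<Union>z\<in>T \<times> T'. pair_fibre M q a a' (fst z) (snd z))"
      by (auto simp: pair_fibre_def)
    also have "card \<dots> = (\<Sum>z\<in>T \<times> T'. card (pair_fibre M q a a' (fst z) (snd z)))"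
      using finT fin by (intro card_UN_disjoint) (auto simp: pair_fibre_def)
    also have "\<dots> = (\<Sum>z\<in>T \<times> T'. F)"
      using T by (intro sum.cong refl F) auto
    finally show ?thesis by (simp add: card_cartesian_product)
  qed
  have "{g \<in> gens M q. comb_mod M q a g \<in> residues q \<and> comb_mod M q a' g \<in> residues q} = (gens M q :: (nat \<times> 'c \<Rightarrow> int) set)"
    using comb_mod_residues[OF q0] by auto
  then have "card (gens M q :: (nat \<times> 'c \<Rightarrow> int) set) = nat q ^ (2 * CARD('c)) * F"
    using gen[OF order_refl order_refl]
    by (simp add: card_residues mult_2 power_add)
  then show ?thesis by (simp add: gen[OF T])
qed

text \<open>
  Fixing the first coefficient makes any two distinct coefficient vectors linearly independent.
\<close>

definition lead_one :: "nat \<Rightarrow> int \<Rightarrow> (nat \<Rightarrow> int) set" where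
  "lead_one M A = PiE {..<M} (\<lambda>i. if i = 0 then {1} else {1..A})"

lemma card_lead_one:
  assumes "M > 0" shows "card (lead_one M A) = nat A ^ (M - 1)"
proof -
  have "card (lead_one M A) = (\<Prod>i<M. card (if i = 0 then {1::int} else {1..A}))"
    unfolding lead_one_def by (simp add: card_PiE)
  also have "\<dots> = (\<Prod>i\<in>{..<M} - {0}. nat A)"
    using assms by (subst prod.remove[of _ 0]) (auto intro!: prod.cong)
  finally show ?thesis using assms by simp
qed

lemma finite_lead_one: "finite (lead_one M A)"
  unfolding lead_one_def by (intro finite_PiE) auto

lemma lead_one_independent:
  assumes a: "a \<in> lead_one M A" "a' \<in> lead_one M A" "a \<noteq> a'" and q: "A \<le> q"
  obtains i where "i < M" "\<not> q dvd a i - a' i"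
proof -
  have "\<exists>i\<in>{..<M}. a i \<noteq> a' i"
    using a by (metis PiE_ext lead_one_def)
  then obtain i where i: "i < M" "a i \<noteq> a' i" by auto
  have i0: "i \<noteq> 0"
  proof
    assume "i = 0"
    then have "a i = 1" "a' i = 1"
      using a(1,2) i(1) PiE_mem[of _ "{..<M}" "\<lambda>i. if i = 0 then {1} else {1..A}" 0]
      unfolding lead_one_def by auto
    then show False using i by simp
  qed
  have "a i \<in> {1..A}" "a' i \<in> {1..A}"
    using a(1,2) i(1) i0 PiE_mem[of _ "{..<M}" "\<lambda>i. if i = 0 then {1} else {1..A}" i]
    unfolding lead_one_def by auto
  then have "\<bar>a i - a' i\<bar> < q" using q by auto
  then have "\<not> q dvd a i - a' i"
    using i(2) zdvd_not_zless[of "\<bar>a i - a' i\<bar>" q] by auto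
  then show thesis using that i by blast
qed

lemma lead_one_0: "a \<in> lead_one M A \<Longrightarrow> M > 0 \<Longrightarrow> a 0 = 1"
  using PiE_mem[of a "{..<M}" "\<lambda>i. if i = 0 then {1} else {1..A}" 0] by (auto simp: lead_one_def)

text \<open>
  Chebyshev's inequality: the number of coefficient vectors whose residue lies in \<open>T\<close> has mean
  \<open>\<mu> = card (lead_one M A) card T / q\<^sup>n\<close> and, by pairwise independence, variance at most \<open>\<mu>\<close>, so
  it vanishes with probability at most \<open>1 / \<mu>\<close>.
\<close>

lemma card_missing_gens:
  fixes T :: "('c::finite \<Rightarrow> int) set"
  assumes q: "prime q" "A \<le> q" and M: "M \<ge> 2" and A: "A \<ge> 2" and T: "T \<subseteq> residues q"
  shows "card {g \<in> gens M q. \<forall>a\<in>lead_one M A. comb_mod M q a g \<notin> T} * (card (lead_one M A) * card T)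
    \<le> card (gens M q :: (nat \<times> 'c \<Rightarrow> int) set) * nat q ^ CARD('c)"
proof -
  have q0: "q > 0" using q(1) by (rule prime_gt_0_int)
  let ?\<Omega> = "gens M q :: (nat \<times> 'c \<Rightarrow> int) set"
  let ?L = "lead_one M A"
  define N where "N = real (card ?\<Omega>)"
  define Y where "Y = real_of_int q ^ CARD('c)"
  define K where "K = real (card ?L)"
  define t where "t = real (card T)"
  define X where "X g = real (card {a \<in> ?L. comb_mod M q a g \<in> T})" for g
  define ind where "ind a g = (if comb_mod M q a g \<in> T then 1 else 0 :: real)" for a and g :: "nat \<times> 'c \<Rightarrow> int"
  have Y0: "Y > 0" using q0 by (simp add: Y_def)
  have finT: "finite T" using T finite_residues finite_subset by blast
  have K1: "K \<ge> 1"
  proof -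
    have "card ?L \<ge> 1" using card_lead_one[of M A] M A by simp
    then show ?thesis unfolding K_def by linarith
  qed
  have X: "X g = (\<Sum>a\<in>?L. ind a g)" for g
    unfolding X_def ind_def by (simp add: finite_lead_one sum.If_cases Int_def)
  have pair: "(\<Sum>g\<in>?\<Omega>. ind a g * (if comb_mod M q a' g \<in> T' then 1 else 0)) * Y\<^sup>2 = t * card T' * N"
    if L: "a \<in> ?L" "a' \<in> ?L" "a \<noteq> a'" and T': "T' \<subseteq> residues q" for a a' T'
  proof -
    obtain i where i: "i < M" "\<not> q dvd a i - a' i"
      using lead_one_independent[OF L q(2)] .
    have "(\<Sum>g\<in>?\<Omega>. ind a g * (if comb_mod M q a' g \<in> T' then 1 else 0))
      = (\<Sum>g\<in>?\<Omega>. if comb_mod M q a g \<in> T \<and> comb_mod M q a' g \<in> T' then 1 else 0)"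
      by (intro sum.cong) (auto simp: ind_def)
    also have "\<dots> = real (card {g \<in> ?\<Omega>. comb_mod M q a g \<in> T \<and> comb_mod M q a' g \<in> T'})"
      by (simp add: finite_gens sum.If_cases Int_def)
    finally have 1: "(\<Sum>g\<in>?\<Omega>. ind a g * (if comb_mod M q a' g \<in> T' then 1 else 0))
      = real (card {g \<in> ?\<Omega>. comb_mod M q a g \<in> T \<and> comb_mod M q a' g \<in> T'})" .
    have "card {g \<in> ?\<Omega>. comb_mod M q a g \<in> T \<and> comb_mod M q a' g \<in> T'} * nat q ^ (2 * CARD('c))
        = card T * card T' * card ?\<Omega>"
      using lead_one_0 L M i by (intro card_pair_equidistributed[where i = i] q T T') auto
    then have "real (card {g \<in> ?\<Omega>. comb_mod M q a g \<in> T \<and> comb_mod M q a' g \<in> T'} * nat q ^ (2 * CARD('c)))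
        = real (card T * card T' * card ?\<Omega>)" by (simp only:)
    then show ?thesis
      unfolding 1 Y_def t_def N_def using q0 by (simp add: power_mult[symmetric] mult.commute)
  qed
  have pairT: "(\<Sum>g\<in>?\<Omega>. ind a g * ind a' g) = (t / Y)\<^sup>2 * N" if "a \<in> ?L" "a' \<in> ?L" "a \<noteq> a'" for a a'
  proof -
    have "(\<Sum>g\<in>?\<Omega>. ind a g * ind a' g) * Y\<^sup>2 = t * t * N"
      using pair[OF that T] unfolding ind_def[of a'] t_def by simp
    then show ?thesis using Y0 by (simp add: field_simps power2_eq_square)
  qed
  have single: "(\<Sum>g\<in>?\<Omega>. ind a g) = t / Y * N" if a: "a \<in> ?L" for a
  proof -
    \<comment> \<open>A single residue is counted as a pair whose second component is unrestricted.\<close>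
    define a' where "a' = a(1 := if a 1 = 1 then 2 else 1)"
    have "a 1 \<in> {1..A}"
      using PiE_mem[of a "{..<M}" "\<lambda>i. if i = 0 then {1} else {1..A}" 1] a M by (auto simp: lead_one_def)
    then have a': "a' \<in> ?L" "a \<noteq> a'"
      using a A M lead_one_0[OF a] by (auto simp: lead_one_def a'_def PiE_def Pi_def extensional_def fun_eq_iff)
    have "(\<Sum>g\<in>?\<Omega>. ind a g) * Y\<^sup>2 = t * Y * N"
      using pair[OF a a' order_refl] q0
      by (simp add: card_residues Y_def comb_mod_residues[OF q0])
    then show ?thesis using Y0 by (simp add: field_simps power2_eq_square)
  qed
  define \<mu> where "\<mu> = K * t / Y"
  have EX: "(\<Sum>g\<in>?\<Omega>. X g) = \<mu> * N"
    unfolding X by (subst sum.swap) (simp add: single \<mu>_def K_def)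
  have EX2: "(\<Sum>g\<in>?\<Omega>. (X g)\<^sup>2) = K * (K - 1) * (t / Y)\<^sup>2 * N + \<mu> * N"
  proof -
    have "(\<Sum>g\<in>?\<Omega>. (X g)\<^sup>2) = (\<Sum>g\<in>?\<Omega>. \<Sum>a\<in>?L. \<Sum>a'\<in>?L. ind a g * ind a' g)"
      unfolding X power2_eq_square by (simp add: sum_product)
    also have "\<dots> = (\<Sum>a\<in>?L. \<Sum>a'\<in>?L. \<Sum>g\<in>?\<Omega>. ind a g * ind a' g)"
      by (subst sum.swap, intro sum.cong refl, subst sum.swap) simp
    also have "\<dots> = (\<Sum>a\<in>?L. (K - 1) * ((t / Y)\<^sup>2 * N) + t / Y * N)"
    proof (intro sum.cong refl)
      fix a assume a: "a \<in> ?L"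
      have "(\<Sum>a'\<in>?L. \<Sum>g\<in>?\<Omega>. ind a g * ind a' g)
        = (\<Sum>g\<in>?\<Omega>. ind a g * ind a g) + (\<Sum>a'\<in>?L - {a}. \<Sum>g\<in>?\<Omega>. ind a g * ind a' g)"
        by (rule sum.remove[OF finite_lead_one a])
      also have "(\<Sum>g\<in>?\<Omega>. ind a g * ind a g) = t / Y * N"
        unfolding single[OF a, symmetric] by (intro sum.cong) (auto simp: ind_def)
      also have "(\<Sum>a'\<in>?L - {a}. \<Sum>g\<in>?\<Omega>. ind a g * ind a' g) = (\<Sum>a'\<in>?L - {a}. (t / Y)\<^sup>2 * N)"
        using a by (intro sum.cong refl pairT) auto
      also have "\<dots> = (K - 1) * ((t / Y)\<^sup>2 * N)"
        using a K1 by (simp add: K_def card_Diff_singleton finite_lead_one of_nat_diff)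
      finally show "(\<Sum>a'\<in>?L. \<Sum>g\<in>?\<Omega>. ind a g * ind a' g) = (K - 1) * ((t / Y)\<^sup>2 * N) + t / Y * N"
        by simp
    qed
    finally show ?thesis by (simp add: K_def[symmetric] \<mu>_def algebra_simps)
  qed
  define Z where "Z = {g \<in> ?\<Omega>. \<forall>a\<in>?L. comb_mod M q a g \<notin> T}"
  have "X g = 0" if "g \<in> Z" for g
    unfolding X using that by (auto simp: Z_def ind_def intro!: sum.neutral)
  then have "real (card Z) * \<mu>\<^sup>2 = (\<Sum>g\<in>Z. (X g - \<mu>)\<^sup>2)"
    by simp
  also have "\<dots> \<le> (\<Sum>g\<in>?\<Omega>. (X g - \<mu>)\<^sup>2)"
    by (intro sum_mono2 finite_gens) (auto simp: Z_def)
  also have "\<dots> = (\<Sum>g\<in>?\<Omega>. (X g)\<^sup>2) - 2 * \<mu> * (\<Sum>g\<in>?\<Omega>. X g) + N * \<mu>\<^sup>2"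
    by (simp add: power2_diff sum.distrib sum_subtractf sum_distrib_left N_def algebra_simps)
  also have "\<dots> = \<mu> * N - K * (t / Y)\<^sup>2 * N"
  proof -
    have alg: "K * (K - 1) * r\<^sup>2 * N + K * r * N - 2 * (K * r) * (K * r * N) + N * (K * r)\<^sup>2
      = K * r * N - K * r\<^sup>2 * N" for r
      by algebra
    have "\<mu> = K * (t / Y)" by (simp add: \<mu>_def)
    then show ?thesis unfolding EX EX2 by (simp only: alg)
  qed
  also have "\<dots> \<le> \<mu> * N"
    using K1 by (simp add: N_def)
  finally have main: "real (card Z) * \<mu>\<^sup>2 \<le> \<mu> * N" .
  have \<mu>0: "\<mu> \<ge> 0" using K1 Y0 by (simp add: \<mu>_def t_def)
  have "real (card Z) * \<mu> \<le> N"
  proof (cases "\<mu> = 0")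
    case False
    then show ?thesis using main \<mu>0 by (simp add: power2_eq_square mult.assoc[symmetric] mult.commute)
  qed (simp add: N_def)
  then have "real (card Z) * (K * t) \<le> N * Y"
    using Y0 by (simp add: \<mu>_def field_simps)
  then have "real (card Z * (card ?L * card T)) \<le> real (card ?\<Omega> * nat q ^ CARD('c))"
    unfolding K_def t_def N_def Y_def using q0 by simp
  then show ?thesis unfolding Z_def of_nat_le_iff by simp
qed

text \<open>
  On average at most an eighth of the sets \<open>T z\<close> are missed. If every generator system outside \<open>B\<close>
  missed more than half of them, the average would exceed a quarter.
\<close>

lemma good_gens_exist:
  fixes T :: "'z \<Rightarrow> ('c::finite \<Rightarrow> int) set"
  assumes q: "prime q" "A \<le> q" and M: "M \<ge> 2" and A: "A \<ge> 2"
    and Z: "finite Z" "\<And>z. z \<in> Z \<Longrightarrow> T z \<subseteq> residues q"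
    and T: "\<And>z. z \<in> Z \<Longrightarrow> 8 * nat q ^ CARD('c) \<le> card (lead_one M A) * card (T z)"
    and B: "2 * card B \<le> card (gens M q :: (nat \<times> 'c \<Rightarrow> int) set)" "B \<subseteq> gens M q"
  obtains g where "g \<in> gens M q" "g \<notin> B"
    "card Z \<le> 2 * card {z \<in> Z. \<exists>a\<in>lead_one M A. comb_mod M q a g \<in> T z}"
proof -
  have q0: "q > 0" using q(1) by (rule prime_gt_0_int)
  let ?\<Omega> = "gens M q :: (nat \<times> 'c \<Rightarrow> int) set"
  have \<Omega>0: "card ?\<Omega> > 0" using q0 by (simp add: card_gens)
  define U where "U g = card {z \<in> Z. \<forall>a\<in>lead_one M A. comb_mod M q a g \<notin> T z}" for g
  have one: "8 * card {g \<in> ?\<Omega>. \<forall>a\<in>lead_one M A. comb_mod M q a g \<notin> T z} \<le> card ?\<Omega>" if z: "z \<in> Z" for z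
  proof -
    let ?c = "card {g \<in> ?\<Omega>. \<forall>a\<in>lead_one M A. comb_mod M q a g \<notin> T z}"
    have "8 * ?c * nat q ^ CARD('c) \<le> ?c * (card (lead_one M A) * card (T z))"
      using mult_le_mono2[OF T[OF z], of ?c] by (simp add: ac_simps)
    also have "\<dots> \<le> card ?\<Omega> * nat q ^ CARD('c)"
      by (rule card_missing_gens[OF q M A Z(2)[OF z]])
    finally show ?thesis using q0 by simp
  qed
  have "8 * (\<Sum>g\<in>?\<Omega>. U g) = (\<Sum>z\<in>Z. 8 * card {g \<in> ?\<Omega>. \<forall>a\<in>lead_one M A. comb_mod M q a g \<notin> T z})"
  proof -
    have "(\<Sum>g\<in>?\<Omega>. U g) = (\<Sum>g\<in>?\<Omega>. \<Sum>z\<in>Z. if \<forall>a\<in>lead_one M A. comb_mod M q a g \<notin> T z then 1 else 0)"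
      unfolding U_def using Z(1) by (simp add: sum.If_cases Int_def)
    also have "\<dots> = (\<Sum>z\<in>Z. \<Sum>g\<in>?\<Omega>. if \<forall>a\<in>lead_one M A. comb_mod M q a g \<notin> T z then 1 else 0)"
      by (rule sum.swap)
    finally show ?thesis by (simp add: finite_gens sum.If_cases Int_def sum_distrib_left)
  qed
  also have "\<dots> \<le> (\<Sum>z\<in>Z. card ?\<Omega>)" by (intro sum_mono one)
  finally have avg: "8 * (\<Sum>g\<in>?\<Omega>. U g) \<le> card Z * card ?\<Omega>" by simp
  have "\<exists>g\<in>?\<Omega> - B. 2 * U g \<le> card Z"
  proof (rule ccontr)
    assume "\<not> ?thesis"
    then have "2 * U g \<ge> card Z + 1" if "g \<in> ?\<Omega> - B" for g using that by force
    then have "(\<Sum>g\<in>?\<Omega> - B. card Z + 1) \<le> (\<Sum>g\<in>?\<Omega> - B. 2 * U g)" by (intro sum_mono) auto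
    also have "\<dots> \<le> (\<Sum>g\<in>?\<Omega>. 2 * U g)" by (intro sum_mono2 finite_gens) auto
    finally have "4 * (card (?\<Omega> - B) * (card Z + 1)) \<le> 8 * (\<Sum>g\<in>?\<Omega>. U g)"
      by (simp add: sum_distrib_left[symmetric])
    also note avg
    finally have 1: "4 * card (?\<Omega> - B) * (card Z + 1) \<le> card Z * card ?\<Omega>" by simp
    have "card ?\<Omega> \<le> 2 * card (?\<Omega> - B)"
      using B card_Diff_subset[of B ?\<Omega>] finite_subset[OF B(2) finite_gens] by simp
    then have "2 * card ?\<Omega> * (card Z + 1) \<le> 4 * card (?\<Omega> - B) * (card Z + 1)"
      by (intro mult_right_mono) auto
    with 1 have "2 * card ?\<Omega> * (card Z + 1) \<le> card Z * card ?\<Omega>" by linarith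
    with \<Omega>0 show False by (simp add: algebra_simps)
  qed
  then obtain g where g: "g \<in> ?\<Omega>" "g \<notin> B" "2 * U g \<le> card Z" by blast
  have "card Z = card {z \<in> Z. \<exists>a\<in>lead_one M A. comb_mod M q a g \<in> T z} + U g"
    unfolding U_def using Z(1)
    by (subst card_Un_disjoint[symmetric]) (auto intro!: arg_cong[where f = card])
  then show thesis using g by (intro that[of g]) auto
qed

section \<open>Fourier transforms of Gaussians and of balls\<close>

text \<open>
  The standard additive character of the real line.
\<close>

definition chi :: "real \<Rightarrow> complex" where "chi t = cis (2 * pi * t)"

lemma chi_exp: "exp (2 * of_real pi * \<i> * of_real t) = chi t"
  by (simp add: chi_def cis_conv_exp mult.commute mult.left_commute)

lemma chi_add: "chi (s + t) = chi s * chi t"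
  by (simp add: chi_def cis_mult distrib_left)

lemma norm_chi [simp]: "norm (chi t) = 1"
  by (simp add: chi_def)

lemma chi_minus: "chi (- t) = cnj (chi t)"
  by (simp add: chi_def cis_cnj)

lemma continuous_chi: "continuous_on UNIV chi"
  unfolding chi_def[abs_def] cis_conv_exp by (intro continuous_intros)

lemma measurable_chi [measurable]: "chi \<in> borel_measurable borel"
  by (rule borel_measurable_continuous_onI[OF continuous_chi])

text \<open>
  Reduced by an affine substitution to the characteristic function of the standard normal law.
\<close>

lemma gaussian_fourier:
  fixes R t0 \<mu> :: real
  assumes R: "R > 0"
  shows "integrable lborel (\<lambda>t. chi (\<mu> * t) * of_real (exp (- ((t - t0) / R)\<^sup>2 / 2)))"
    and "norm (LINT t|lborel. chi (\<mu> * t) * of_real (exp (- ((t - t0) / R)\<^sup>2 / 2)))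
      = sqrt (2 * pi) * R * exp (- (2 * pi * \<mu> * R)\<^sup>2 / 2)"
proof -
  let ?f = "\<lambda>t. chi (\<mu> * t) * of_real (exp (- ((t - t0) / R)\<^sup>2 / 2))"
  define c where "c = 2 * pi * \<mu> * R"
  interpret N: prob_space std_normal_distribution
    by (rule prob_space_normal_density) simp
  have int: "integrable std_normal_distribution (\<lambda>s. iexp (c * s))"
    by (rule N.integrable_const_bound[of _ 1]) auto
  have char: "(LINT s|std_normal_distribution. iexp (c * s)) = of_real (exp (- c\<^sup>2 / 2))"
    using fun_cong[OF char_std_normal_distribution, of c] by (simp add: char_def)
  have int': "integrable lborel (\<lambda>s. std_normal_density s *\<^sub>R iexp (c * s))"
    using int by (subst (asm) integrable_density) auto
  have char': "(LINT s|lborel. std_normal_density s *\<^sub>R iexp (c * s)) = of_real (exp (- c\<^sup>2 / 2))"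
    using char by (subst (asm) integral_density) auto
  have eq: "?f (t0 + R * s) = (chi (\<mu> * t0) * sqrt (2 * pi)) * (std_normal_density s *\<^sub>R iexp (c * s))" for s
  proof -
    have "chi (\<mu> * (t0 + R * s)) = chi (\<mu> * t0) * iexp (c * s)"
      by (simp add: distrib_left chi_add) (simp add: chi_def c_def cis_conv_exp mult_ac)
    moreover have "complex_of_real (sqrt (2 * pi)) * complex_of_real (std_normal_density s) = of_real (exp (- s\<^sup>2 / 2))"
      unfolding of_real_mult[symmetric] by (simp add: std_normal_density_def real_sqrt_mult)
    ultimately show ?thesis
      using R by (simp add: scaleR_conv_of_real mult_ac)
  qed
  have i: "integrable lborel (\<lambda>s. ?f (t0 + R * s))"
    unfolding eq by (intro integrable_mult_right int')
  then show "integrable lborel ?f"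
    using lborel_integrable_real_affine_iff[of R ?f t0] R by simp
  have "(LINT t|lborel. ?f t) = \<bar>R\<bar> *\<^sub>R (LINT s|lborel. ?f (t0 + R * s))"
    by (rule lborel_integral_real_affine) (use R in simp)
  also have "(LINT s|lborel. ?f (t0 + R * s)) = (chi (\<mu> * t0) * sqrt (2 * pi)) * of_real (exp (- c\<^sup>2 / 2))"
    unfolding eq by (subst integral_mult_right_zero) (simp only: char')
  finally show "norm (LINT t|lborel. ?f t) = sqrt (2 * pi) * R * exp (- (2 * pi * \<mu> * R)\<^sup>2 / 2)"
    using R by (simp add: norm_mult c_def real_sqrt_mult del: norm_of_real) (simp add: mult_ac)
qed

lemma lborel_reflect: "distr lborel borel (\<lambda>x. y - x) = (lborel :: 'a::euclidean_space measure)"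
proof -
  have "(-1::real) \<noteq> 0" by simp
  from lborel_affine[OF this, of y] show ?thesis by (simp add: density_1)
qed

text \<open>
  The autocorrelation serves as a cut-off: it is supported in a ball, and its Fourier
  transform is the square of the modulus of that of the indicator, hence nonnegative.
\<close>

definition autocorr :: "'a::euclidean_space set \<Rightarrow> 'a \<Rightarrow> real" where
  "autocorr B x = (LINT y|lborel. indicator B y * indicator B (y - x))"

definition ind_fourier :: "'a::euclidean_space set \<Rightarrow> 'a \<Rightarrow> complex" where
  "ind_fourier B \<zeta> = (LINT y|lborel. indicator B y * chi (y \<bullet> \<zeta>))"

lemma autocorr_measurable [measurable]:
  assumes [measurable]: "B \<in> sets borel"
  shows "autocorr B \<in> borel_measurable borel"
  unfolding autocorr_def[abs_def] by measurable

lemma autocorr_bounds: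
  fixes B :: "'a::euclidean_space set"
  assumes B[measurable]: "B \<in> sets borel" and fin: "emeasure lborel B < \<infinity>"
  shows "0 \<le> autocorr B x" "autocorr B x \<le> measure lborel B"
proof -
  show "0 \<le> autocorr B x" unfolding autocorr_def by (intro integral_nonneg_AE) auto
  have i: "integrable lborel (indicator B :: 'a \<Rightarrow> real)"
    using fin by simp
  have "autocorr B x \<le> (LINT y|lborel. indicator B y)"
    unfolding autocorr_def
    by (intro integral_mono integrable_real_mult_indicator[of "{y. y - x \<in> B}" lborel "indicator B", simplified] i)
      (auto simp: indicator_def intro!: Bochner_Integration.integrable_bound[OF i])
  then show "autocorr B x \<le> measure lborel B" by simp
qed

lemma autocorr_fourier:
  fixes B :: "'a::euclidean_space set"
  assumes B[measurable]: "B \<in> sets borel" and fin: "emeasure lborel B < \<infinity>"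
  shows "integrable lborel (\<lambda>x. complex_of_real (autocorr B x) * chi (x \<bullet> \<zeta>))"
    and "(LINT x|lborel. complex_of_real (autocorr B x) * chi (x \<bullet> \<zeta>)) = of_real ((norm (ind_fourier B \<zeta>))\<^sup>2)"
proof -
  let ?b = "\<lambda>y. indicator B y :: complex"
  define F where "F x y = (?b y * ?b (y - x)) * chi (x \<bullet> \<zeta>)" for x y :: 'a
  have Fm: "case_prod F \<in> borel_measurable (lborel \<Otimes>\<^sub>M lborel)"
    unfolding F_def by measurable
  have shift: "(\<integral>\<^sup>+x. indicator B (y - x) \<partial>lborel) = emeasure lborel B" for y
  proof -
    have "(\<integral>\<^sup>+x. indicator B (y - x) \<partial>lborel) = (\<integral>\<^sup>+x. indicator B x \<partial>distr lborel borel (\<lambda>x. y - x))"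
      by (subst nn_integral_distr) auto
    then show ?thesis by (simp add: lborel_reflect)
  qed
  have Fi: "integrable (lborel \<Otimes>\<^sub>M lborel) (case_prod F)"
  proof (rule integrableI_bounded[OF Fm])
    have "(\<integral>\<^sup>+z. ennreal (norm (case_prod F z)) \<partial>(lborel \<Otimes>\<^sub>M lborel))
        = (\<integral>\<^sup>+y. \<integral>\<^sup>+x. ennreal (norm (F x y)) \<partial>lborel \<partial>lborel)"
      using Fm by (subst lborel_pair.nn_integral_snd[symmetric]) auto
    also have "\<dots> = (\<integral>\<^sup>+y. indicator B y * (\<integral>\<^sup>+x. indicator B (y - x) \<partial>lborel) \<partial>lborel)"
      by (subst nn_integral_cmult[symmetric])
        (auto simp: F_def norm_mult indicator_def intro!: nn_integral_cong)
    also have "\<dots> = emeasure lborel B * emeasure lborel B"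
      by (simp add: shift nn_integral_multc)
    also have "\<dots> < \<infinity>" using fin by (simp add: ennreal_mult_less_top)
    finally show "(\<integral>\<^sup>+z. ennreal (norm (case_prod F z)) \<partial>(lborel \<Otimes>\<^sub>M lborel)) < \<infinity>" .
  qed
  have eq: "(LINT y|lborel. F x y) = complex_of_real (autocorr B x) * chi (x \<bullet> \<zeta>)" for x
  proof -
    have "(LINT y|lborel. F x y) = (LINT y|lborel. ?b y * ?b (y - x)) * chi (x \<bullet> \<zeta>)"
      unfolding F_def by simp
    also have "(LINT y|lborel. ?b y * ?b (y - x)) = (LINT y|lborel. complex_of_real (indicator B y * indicator B (y - x)))"
      by (intro Bochner_Integration.integral_cong) (auto simp: indicator_def)
    finally show ?thesis unfolding autocorr_def integral_complex_of_real .
  qed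
  show "integrable lborel (\<lambda>x. complex_of_real (autocorr B x) * chi (x \<bullet> \<zeta>))"
    using lborel_pair.integrable_fst[OF Fi] unfolding eq .
  have "(LINT x|lborel. complex_of_real (autocorr B x) * chi (x \<bullet> \<zeta>)) = (LINT x|lborel. LINT y|lborel. F x y)"
    by (simp add: eq)
  also have "\<dots> = (LINT y|lborel. LINT x|lborel. F x y)"
    by (rule lborel_pair.Fubini_integral[OF Fi, symmetric])
  also have "\<dots> = (LINT y|lborel. (?b y * chi (y \<bullet> \<zeta>)) * cnj (ind_fourier B \<zeta>))"
  proof (intro Bochner_Integration.integral_cong refl)
    fix y :: 'a
    have e: "chi ((y - x) \<bullet> \<zeta>) = chi (y \<bullet> \<zeta>) * cnj (chi (x \<bullet> \<zeta>))" for x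
      using chi_add[of "y \<bullet> \<zeta>" "- (x \<bullet> \<zeta>)"] by (simp add: inner_diff_left chi_minus)
    have "(LINT x|lborel. F x y) = ?b y * (LINT x|lborel. ?b (y - x) * chi (x \<bullet> \<zeta>))"
      unfolding F_def by (simp add: mult.assoc)
    also have "(LINT x|lborel. ?b (y - x) * chi (x \<bullet> \<zeta>)) = (LINT x|distr lborel borel (\<lambda>x. y - x). ?b x * chi ((y - x) \<bullet> \<zeta>))"
      by (subst integral_distr) auto
    also have "\<dots> = (LINT x|lborel. chi (y \<bullet> \<zeta>) * cnj (?b x * chi (x \<bullet> \<zeta>)))"
      unfolding lborel_reflect
      by (intro Bochner_Integration.integral_cong refl)
        (auto simp: e indicator_def)
    also have "\<dots> = chi (y \<bullet> \<zeta>) * cnj (ind_fourier B \<zeta>)"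
      unfolding ind_fourier_def integral_mult_right_zero Bochner_Integration.integral_cnj ..
    finally show "(LINT x|lborel. F x y) = (?b y * chi (y \<bullet> \<zeta>)) * cnj (ind_fourier B \<zeta>)"
      by (simp add: mult.assoc)
  qed
  also have "\<dots> = ind_fourier B \<zeta> * cnj (ind_fourier B \<zeta>)"
    unfolding ind_fourier_def by simp
  also have "\<dots> = of_real ((norm (ind_fourier B \<zeta>))\<^sup>2)"
    by (rule complex_norm_square[symmetric])
  finally show "(LINT x|lborel. complex_of_real (autocorr B x) * chi (x \<bullet> \<zeta>)) = of_real ((norm (ind_fourier B \<zeta>))\<^sup>2)" .
qed

lemma autocorr_ball_support:
  assumes "x \<notin> ball 0 R" shows "autocorr (ball 0 (R / 2)) x = 0"
proof -
  have "indicator (ball 0 (R/2)) y * indicator (ball 0 (R/2)) (y - x) = (0::real)" for y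
  proof (rule ccontr)
    assume "\<not> ?thesis"
    then have "norm y < R / 2" "norm (y - x) < R / 2" by (auto simp: indicator_def split: if_splits)
    then have "norm x < R" using norm_triangle_ineq4[of y "y - x"] by simp
    then show False using assms by simp
  qed
  then show ?thesis unfolding autocorr_def by (simp only: integral_zero)
qed

text \<open>
  On the ball of radius \<open>R / 2\<close> the phase is at most \<open>\<pi> / 3\<close>, where the cosine is at least \<open>1 / 2\<close>.
\<close>

lemma ind_fourier_ball_lower:
  fixes \<zeta> :: "'a::euclidean_space"
  assumes R: "R > 0" and \<zeta>: "norm \<zeta> \<le> 1 / (3 * R)"
  shows "measure lborel (ball (0::'a) (R / 2)) / 2 \<le> norm (ind_fourier (ball 0 (R / 2)) \<zeta>)"
proof -
  let ?B = "ball (0::'a) (R / 2)"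
  have fin: "emeasure lborel ?B < \<infinity>" by (rule emeasure_lborel_ball_finite)
  have ir: "integrable lborel (indicator ?B :: 'a \<Rightarrow> real)" using fin by simp
  have ic: "integrable lborel (\<lambda>y. indicator ?B y * chi (y \<bullet> \<zeta>))"
    by (rule Bochner_Integration.integrable_bound[OF ir]) (auto simp: norm_mult indicator_def)
  have "measure lborel ?B / 2 = (LINT y|lborel. indicator ?B y / 2)" by simp
  also have "\<dots> \<le> (LINT y|lborel. Re (indicator ?B y * chi (y \<bullet> \<zeta>)))"
  proof (intro integral_mono)
    show "integrable lborel (\<lambda>y. indicator ?B y / 2 :: real)" using ir by simp
    show "integrable lborel (\<lambda>y. Re (indicator ?B y * chi (y \<bullet> \<zeta>)))"
      by (rule integrable_bounded_linear[OF bounded_linear_Re ic])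
    fix y :: 'a
    show "indicator ?B y / 2 \<le> Re (indicator ?B y * chi (y \<bullet> \<zeta>))"
    proof (cases "y \<in> ?B")
      case True
      have "\<bar>y \<bullet> \<zeta>\<bar> \<le> norm y * norm \<zeta>" by (rule Cauchy_Schwarz_ineq2)
      also have "\<dots> \<le> R / 2 * (1 / (3 * R))" using True \<zeta> R by (intro mult_mono) auto
      also have "\<dots> = 1 / 6" using R by simp
      finally have "\<bar>2 * pi * (y \<bullet> \<zeta>)\<bar> \<le> pi / 3" by (simp add: abs_mult)
      then have "cos (pi / 3) \<le> cos \<bar>2 * pi * (y \<bullet> \<zeta>)\<bar>"
        by (intro cos_monotone_0_pi_le) auto
      then show ?thesis using True by (simp add: chi_def cos_60)
    qed simp
  qed
  also have "\<dots> = Re (ind_fourier ?B \<zeta>)"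
    unfolding ind_fourier_def by (rule integral_bounded_linear[OF bounded_linear_Re ic])
  also have "\<dots> \<le> norm (ind_fourier ?B \<zeta>)" by (rule complex_Re_le_cmod)
  finally show ?thesis .
qed

text \<open>
  The ball contains a cube of side \<open>R / (2 DIM('a))\<close>.
\<close>

lemma measure_ball_lower:
  assumes "R > 0"
  shows "(R / (2 * DIM('a))) ^ DIM('a) \<le> measure lborel (ball (0::'a::euclidean_space) (R / 2))"
proof -
  define s where "s = R / (4 * real DIM('a))"
  have s: "s > 0" using assms by (simp add: s_def)
  have sub: "cbox (- s *\<^sub>R One) (s *\<^sub>R One) \<subseteq> ball (0::'a) (R / 2)"
  proof
    fix x :: 'a assume x: "x \<in> cbox (- s *\<^sub>R One) (s *\<^sub>R One)"
    have "norm x \<le> (\<Sum>b\<in>Basis. \<bar>x \<bullet> b\<bar>)" by (rule norm_le_l1)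
    also have "\<dots> \<le> (\<Sum>b\<in>(Basis::'a set). s)"
      using x by (intro sum_mono) (auto simp: mem_box abs_le_iff)
    also have "\<dots> = R / 4" by (simp add: s_def)
    finally show "x \<in> ball 0 (R / 2)" using assms by simp
  qed
  have "(R / (2 * DIM('a))) ^ DIM('a) = measure lborel (cbox (- s *\<^sub>R One) (s *\<^sub>R (One::'a)))"
  proof -
    have "measure lborel (cbox (- s *\<^sub>R One) (s *\<^sub>R (One::'a))) = (\<Prod>b\<in>(Basis::'a set). 2 * s)"
    proof -
      have "\<forall>b\<in>Basis. - s *\<^sub>R One \<bullet> b \<le> s *\<^sub>R One \<bullet> (b::'a)" using s by auto
      then have "measure lborel (cbox (- s *\<^sub>R One) (s *\<^sub>R (One::'a)))
          = (\<Prod>b\<in>(Basis::'a set). (s *\<^sub>R One - (- s *\<^sub>R One)) \<bullet> b)"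
        unfolding measure_lborel_cbox_eq by (rule if_P)
      also have "\<dots> = (\<Prod>b\<in>(Basis::'a set). 2 * s)"
        by (intro prod.cong refl) (simp add: inner_diff_left inner_add_left)
      finally show ?thesis .
    qed
    then show ?thesis by (simp add: s_def)
  qed
  also have "\<dots> \<le> measure lborel (ball (0::'a) (R / 2))"
    by (rule measure_mono_fmeasurable[OF sub]) (use emeasure_lborel_ball_finite[of "0::'a" "R / 2"] in \<open>auto intro!: fmeasurableI\<close>)
  finally show ?thesis .
qed

section \<open>The weight and its X-ray transform\<close>

definition box_weight :: "('i \<Rightarrow> 'a::euclidean_space) \<Rightarrow> 'i set \<Rightarrow> real \<Rightarrow> 'a \<Rightarrow> real" where
  "box_weight P X R x = autocorr (ball 0 (R / 2)) x * (cmod (\<Sum>a\<in>X. chi (x \<bullet> P a)))\<^sup>2"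

lemma expsum_sq:
  "complex_of_real ((cmod (\<Sum>a\<in>X. chi (x \<bullet> P a)))\<^sup>2) = (\<Sum>a\<in>X. \<Sum>a'\<in>X. chi (x \<bullet> (P a - P a')))"
proof -
  have "complex_of_real ((cmod (\<Sum>a\<in>X. chi (x \<bullet> P a)))\<^sup>2)
      = (\<Sum>a\<in>X. chi (x \<bullet> P a)) * cnj (\<Sum>a\<in>X. chi (x \<bullet> P a))"
    by (rule complex_norm_square)
  also have "\<dots> = (\<Sum>a\<in>X. \<Sum>a'\<in>X. chi (x \<bullet> P a) * cnj (chi (x \<bullet> P a')))"
    by (simp add: cnj_sum sum_product)
  also have "\<dots> = (\<Sum>a\<in>X. \<Sum>a'\<in>X. chi (x \<bullet> (P a - P a')))"
    using chi_add[of "x \<bullet> P _" "- (x \<bullet> P _)"]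
    by (intro sum.cong refl) (simp add: inner_diff_right chi_minus[symmetric] chi_add[symmetric])
  finally show ?thesis .
qed

lemma box_weight_measurable [measurable]: "box_weight P X R \<in> borel_measurable borel"
  unfolding box_weight_def[abs_def] by measurable

lemma box_weight_nonneg: "0 \<le> box_weight P X R x"
  unfolding box_weight_def
  by (intro mult_nonneg_nonneg autocorr_bounds(1) emeasure_lborel_ball_finite) auto

lemma box_weight_support: "x \<notin> ball 0 R \<Longrightarrow> box_weight P X R x = 0"
  unfolding box_weight_def using autocorr_ball_support[of x R] by simp

text \<open>
  Expanding the square turns the transform into a sum of nonnegative terms, one for each pair.
\<close>

lemma box_weight_fourier:
  fixes P :: "'i \<Rightarrow> 'a::euclidean_space"
  shows "integrable lborel (\<lambda>x. complex_of_real (box_weight P X R x) * chi (x \<bullet> y))"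
    and "(LINT x|lborel. complex_of_real (box_weight P X R x) * chi (x \<bullet> y))
      = of_real (\<Sum>a\<in>X. \<Sum>a'\<in>X. (cmod (ind_fourier (ball 0 (R / 2)) (P a - P a' + y)))\<^sup>2)"
proof -
  let ?B = "ball (0::'a) (R / 2)"
  have eq: "complex_of_real (box_weight P X R x) * chi (x \<bullet> y)
      = (\<Sum>a\<in>X. \<Sum>a'\<in>X. complex_of_real (autocorr ?B x) * chi (x \<bullet> (P a - P a' + y)))" for x
    unfolding box_weight_def of_real_mult expsum_sq
    by (simp add: sum_distrib_left sum_distrib_right inner_add_right chi_add mult.assoc)
  have B: "?B \<in> sets borel" "emeasure lborel ?B < \<infinity>" by (auto intro: emeasure_lborel_ball_finite[unfolded infinity_ennreal_def])
  note F = autocorr_fourier[OF B]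
  show "integrable lborel (\<lambda>x. complex_of_real (box_weight P X R x) * chi (x \<bullet> y))"
    unfolding eq by (intro Bochner_Integration.integrable_sum F(1))
  show "(LINT x|lborel. complex_of_real (box_weight P X R x) * chi (x \<bullet> y))
      = of_real (\<Sum>a\<in>X. \<Sum>a'\<in>X. (cmod (ind_fourier ?B (P a - P a' + y)))\<^sup>2)"
    unfolding eq by (simp add: Bochner_Integration.integral_sum F Bochner_Integration.integrable_sum)
qed

lemma box_weight_integrable: "integrable lborel (box_weight (P :: 'i \<Rightarrow> 'a::euclidean_space) X R)"
proof -
  have "integrable lborel (\<lambda>x. complex_of_real (box_weight P X R x))"
    using box_weight_fourier(1)[of P X R 0] by (simp add: chi_def)
  then show ?thesis by (simp only: complex_of_real_integrable_eq)
qed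

text \<open>
  On the part of the line inside the ball, the cut-off is at most the volume of the smaller ball, and
  \<open>1 \<le> exp (1/2) exp (- s\<^sup>2 / 2)\<close> for \<open>s\<close> the distance to the foot of the perpendicular from
  the origin in units of \<open>R\<close>. The exponential sum squared is nonnegative, so it may be integrated against the Gaussian over the entire line.
\<close>

lemma box_weight_line:
  fixes P :: "'i \<Rightarrow> 'a::euclidean_space" and u x :: 'a
  assumes X: "finite X" and R: "R > 0" and u: "norm u = 1"
  shows "(\<integral>\<^sup>+t. ennreal (box_weight P X R (x + t *\<^sub>R u)) \<partial>lborel)
    \<le> ennreal (measure lborel (ball (0::'a) (R / 2)) * exp (1 / 2) * sqrt (2 * pi) * R
        * (\<Sum>a\<in>X. \<Sum>a'\<in>X. exp (- (2 * pi * ((P a - P a') \<bullet> u) * R)\<^sup>2 / 2)))"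
proof -
  let ?B = "ball (0::'a) (R / 2)"
  define \<beta> where "\<beta> = measure lborel ?B"
  define t0 where "t0 = - (x \<bullet> u)"
  define g where "g t = exp (- ((t - t0) / R)\<^sup>2 / 2)" for t
  let ?D = "\<lambda>y. (cmod (\<Sum>a\<in>X. chi (y \<bullet> P a)))\<^sup>2"
  define N where "N = (\<Sum>a\<in>X. \<Sum>a'\<in>X. exp (- (2 * pi * ((P a - P a') \<bullet> u) * R)\<^sup>2 / 2))"
  have B: "?B \<in> sets borel" "emeasure lborel ?B < \<infinity>" by (auto intro: emeasure_lborel_ball_finite[unfolded infinity_ennreal_def])
  have \<beta>0: "\<beta> \<ge> 0" by (simp add: \<beta>_def)
  have "box_weight P X R (x + t *\<^sub>R u) \<le> \<beta> * exp (1/2) * (?D (x + t *\<^sub>R u) * g t)" for t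
  proof (cases "x + t *\<^sub>R u \<in> ball 0 R")
    case False
    then show ?thesis using box_weight_support[OF False, of P X] \<beta>0 by (simp add: g_def)
  next
    case True
    have "\<bar>t - t0\<bar> = \<bar>(x + t *\<^sub>R u) \<bullet> u\<bar>"
      using u by (simp add: t0_def inner_add_left power2_norm_eq_inner[symmetric] norm_eq_1)
    also have "\<dots> \<le> norm (x + t *\<^sub>R u) * norm u" by (rule Cauchy_Schwarz_ineq2)
    also have "\<dots> \<le> R" using True u by simp
    finally have "\<bar>(t - t0) / R\<bar> \<le> 1" using R by (simp add: abs_divide)
    then have "((t - t0) / R)\<^sup>2 \<le> 1" by (simp add: abs_square_le_1)
    then have g1: "1 \<le> exp (1/2) * g t" unfolding g_def exp_add[symmetric] by simp
    have "box_weight P X R (x + t *\<^sub>R u) \<le> \<beta> * ?D (x + t *\<^sub>R u)"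
      unfolding box_weight_def \<beta>_def by (intro mult_right_mono autocorr_bounds(2)[OF B]) simp
    also have "\<dots> \<le> \<beta> * ?D (x + t *\<^sub>R u) * (exp (1/2) * g t)"
      using mult_left_mono[OF g1, of "\<beta> * ?D (x + t *\<^sub>R u)"] \<beta>0 by simp
    finally show ?thesis by (simp add: mult_ac)
  qed
  then have "(\<integral>\<^sup>+t. ennreal (box_weight P X R (x + t *\<^sub>R u)) \<partial>lborel)
      \<le> (\<integral>\<^sup>+t. ennreal (\<beta> * exp (1/2)) * ennreal (?D (x + t *\<^sub>R u) * g t) \<partial>lborel)"
    using \<beta>0 by (intro nn_integral_mono) (simp add: ennreal_mult[symmetric] g_def)
  also have "\<dots> = ennreal (\<beta> * exp (1/2)) * (\<integral>\<^sup>+t. ennreal (?D (x + t *\<^sub>R u) * g t) \<partial>lborel)"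
    unfolding g_def by (intro nn_integral_cmult) measurable
  also have "(\<integral>\<^sup>+t. ennreal (?D (x + t *\<^sub>R u) * g t) \<partial>lborel) \<le> ennreal (sqrt (2 * pi) * R * N)"
  proof -
    let ?G = "\<lambda>a a' t. chi (x \<bullet> (P a - P a')) * (chi (((P a - P a') \<bullet> u) * t) * of_real (g t))"
    have eq: "complex_of_real (?D (x + t *\<^sub>R u) * g t) = (\<Sum>a\<in>X. \<Sum>a'\<in>X. ?G a a' t)" for t
      unfolding of_real_mult expsum_sq
      by (simp add: sum_distrib_right inner_add_left chi_add inner_commute[of u] mult.assoc mult.commute[of t])
    have Gi: "integrable lborel (?G a a')" for a a'
      unfolding g_def by (intro integrable_mult_right gaussian_fourier(1) R)
    have ci: "integrable lborel (\<lambda>t. complex_of_real (?D (x + t *\<^sub>R u) * g t))"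
      unfolding eq by (intro Bochner_Integration.integrable_sum Gi)
    have i: "integrable lborel (\<lambda>t. ?D (x + t *\<^sub>R u) * g t)"
      using integrable_bounded_linear[OF bounded_linear_Re ci] by (simp only: Re_complex_of_real)
    have "(LINT t|lborel. ?D (x + t *\<^sub>R u) * g t) = cmod (LINT t|lborel. complex_of_real (?D (x + t *\<^sub>R u) * g t))"
      unfolding integral_complex_of_real norm_of_real
      by (intro abs_of_nonneg[symmetric] integral_nonneg_AE) (simp add: g_def)
    also have "\<dots> = cmod (\<Sum>a\<in>X. \<Sum>a'\<in>X. integral\<^sup>L lborel (?G a a'))"
      unfolding eq by (simp add: Bochner_Integration.integral_sum Bochner_Integration.integrable_sum Gi)
    also have "\<dots> \<le> (\<Sum>a\<in>X. \<Sum>a'\<in>X. cmod (integral\<^sup>L lborel (?G a a')))"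
      by (rule order_trans[OF norm_sum]) (intro sum_mono norm_sum)
    also have "\<dots> = (\<Sum>a\<in>X. \<Sum>a'\<in>X. sqrt (2 * pi) * R * exp (- (2 * pi * ((P a - P a') \<bullet> u) * R)\<^sup>2 / 2))"
      unfolding g_def integral_mult_right_zero norm_mult norm_chi gaussian_fourier(2)[OF R] by simp
    also have "\<dots> = sqrt (2 * pi) * R * N"
      by (simp add: N_def sum_distrib_left)
    finally have "(LINT t|lborel. ?D (x + t *\<^sub>R u) * g t) \<le> sqrt (2 * pi) * R * N" .
    moreover have "(\<integral>\<^sup>+t. ennreal (?D (x + t *\<^sub>R u) * g t) \<partial>lborel) = ennreal (LINT t|lborel. ?D (x + t *\<^sub>R u) * g t)"
      by (rule nn_integral_eq_integral[OF i]) (simp add: g_def)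
    ultimately show ?thesis by (simp add: ennreal_leI)
  qed
  finally show ?thesis
    using \<beta>0 R unfolding \<beta>_def[symmetric] N_def[symmetric]
    by (simp add: ennreal_mult'[symmetric] mult_left_mono mult.assoc)
qed

text \<open>
  Pairs whose difference lies outside the plank of width \<open>\<tau>\<close> are killed by the Gaussian.
\<close>

lemma box_weight_line_plank:
  fixes P :: "'i \<Rightarrow> 'a::euclidean_space" and u x :: 'a and K \<tau> :: real
  assumes X: "finite X" and R: "R > 0" and u: "norm u = 1"
    and plank: "\<And>a. a \<in> X \<Longrightarrow> real (card {a'\<in>X. \<bar>(P a - P a') \<bullet> u\<bar> < \<tau>}) \<le> K"
    and tail: "card X * exp (- (R * \<tau>)\<^sup>2) \<le> 1" and \<tau>: "\<tau> \<ge> 0"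
  shows "(\<integral>\<^sup>+t. ennreal (box_weight P X R (x + t *\<^sub>R u)) \<partial>lborel)
    \<le> ennreal (measure lborel (ball (0::'a) (R / 2)) * (exp (1 / 2) * sqrt (2 * pi)) * R * (card X * (K + 1)))"
proof -
  have "(\<Sum>a\<in>X. \<Sum>a'\<in>X. exp (- (2 * pi * ((P a - P a') \<bullet> u) * R)\<^sup>2 / 2)) \<le> (\<Sum>a\<in>X. K + 1)"
  proof (intro sum_mono)
    fix a assume a: "a \<in> X"
    have "(\<Sum>a'\<in>X. exp (- (2 * pi * ((P a - P a') \<bullet> u) * R)\<^sup>2 / 2))
      \<le> (\<Sum>a'\<in>X. (if \<bar>(P a - P a') \<bullet> u\<bar> < \<tau> then 1 else 0) + exp (- (R * \<tau>)\<^sup>2))"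
    proof (intro sum_mono)
      fix a' assume "a' \<in> X"
      let ?\<mu> = "(P a - P a') \<bullet> u"
      show "exp (- (2 * pi * ?\<mu> * R)\<^sup>2 / 2) \<le> (if \<bar>?\<mu>\<bar> < \<tau> then 1 else 0) + exp (- (R * \<tau>)\<^sup>2)"
      proof (cases "\<bar>?\<mu>\<bar> < \<tau>")
        case True
        then show ?thesis by (simp add: add_increasing2)
      next
        case False
        have "(R * \<tau>)\<^sup>2 \<le> (R * \<bar>?\<mu>\<bar>)\<^sup>2" using False R \<tau> by (intro power_mono mult_left_mono) auto
        also have "\<dots> \<le> 2 * pi\<^sup>2 * (R * \<bar>?\<mu>\<bar>)\<^sup>2"
        proof -
          have "1 \<le> pi" using pi_gt3 by linarith
          then have "1 \<le> 2 * pi\<^sup>2" using one_le_power[of pi 2] by linarith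
          then show ?thesis using mult_right_mono[of 1 "2 * pi\<^sup>2" "(R * \<bar>?\<mu>\<bar>)\<^sup>2"] by simp
        qed
        also have "\<dots> = (2 * pi * ?\<mu> * R)\<^sup>2 / 2" by (simp add: power_mult_distrib)
        finally show ?thesis using False by simp
      qed
    qed
    also have "\<dots> = card {a'\<in>X. \<bar>(P a - P a') \<bullet> u\<bar> < \<tau>} + card X * exp (- (R * \<tau>)\<^sup>2)"
      using X by (simp add: sum.distrib sum.If_cases Int_def)
    also have "\<dots> \<le> K + 1" using plank[OF a] tail by linarith
    finally show "(\<Sum>a'\<in>X. exp (- (2 * pi * ((P a - P a') \<bullet> u) * R)\<^sup>2 / 2)) \<le> K + 1" .
  qed
  then have S: "(\<Sum>a\<in>X. \<Sum>a'\<in>X. exp (- (2 * pi * ((P a - P a') \<bullet> u) * R)\<^sup>2 / 2)) \<le> card X * (K + 1)"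
    by simp
  show ?thesis
    by (rule order_trans[OF box_weight_line[OF X R u]], rule ennreal_leI)
      (use S R in \<open>simp add: mult.assoc mult_left_mono\<close>)
qed

lemma Xray_measurable:
  fixes w :: "'a::euclidean_space \<Rightarrow> real"
  assumes [measurable]: "w \<in> borel_measurable borel"
  shows "Xray w \<in> borel_measurable lborel"
proof -
  have "(\<lambda>z. \<integral>\<^sup>+ t. ennreal (w (fst z + t *\<^sub>R sgn (snd z))) \<partial>lborel) \<in> borel_measurable ((borel :: 'a measure) \<Otimes>\<^sub>M (borel :: 'a measure))"
    unfolding sgn_div_norm by measurable
  then show ?thesis by (simp add: Xray_def case_prod_beta borel_prod)
qed

text \<open>
  Pairs \<open>(x, v)\<close> with \<open>v = 0\<close> form a null set; for all others \<open>sgn v\<close> is a unit vector.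
\<close>

lemma Xray_norm_le:
  fixes w :: "'a::euclidean_space \<Rightarrow> real"
  assumes w: "w \<in> borel_measurable borel"
    and le: "\<And>x u. norm u = 1 \<Longrightarrow> (\<integral>\<^sup>+t. ennreal (w (x + t *\<^sub>R u)) \<partial>lborel) \<le> C"
  shows "Xray_norm w \<le> C"
  unfolding Xray_norm_def
proof (rule esssup_I[OF Xray_measurable[OF w]])
  have "AE z in (lborel :: 'a measure) \<Otimes>\<^sub>M (lborel :: 'a measure). snd z \<noteq> 0"
  proof (rule lborel_pair.AE_pair_measure)
    show "{z \<in> space ((lborel :: 'a measure) \<Otimes>\<^sub>M (lborel :: 'a measure)). snd z \<noteq> 0}
        \<in> sets (lborel \<Otimes>\<^sub>M lborel)"
      by measurable
  qed (auto intro: AE_lborel_singleton)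
  then have "AE z in (lborel :: ('a \<times> 'a) measure). snd z \<noteq> 0"
    unfolding lborel_prod .
  then show "AE z in lborel. Xray w z \<le> C"
  proof (rule AE_mp, intro AE_I2 impI)
    fix z :: "'a \<times> 'a" assume "snd z \<noteq> 0"
    then show "Xray w z \<le> C"
      unfolding Xray_def case_prod_beta by (intro le) (simp add: norm_sgn)
  qed
qed

section \<open>The lower bound for the extension operator\<close>

lemma measure_ball_upper:
  assumes "R > 0"
  shows "emeasure lborel (ball (0::'b::euclidean_space) R) \<le> ennreal ((2 * R) ^ DIM('b))"
proof -
  have sub: "ball (0::'b) R \<subseteq> cbox (- R *\<^sub>R One) (R *\<^sub>R One)"
  proof
    fix x :: 'b assume "x \<in> ball 0 R"
    then have "\<bar>x \<bullet> b\<bar> \<le> R" if "b \<in> Basis" for b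
      using Basis_le_norm[OF that, of x] by simp
    then show "x \<in> cbox (- R *\<^sub>R One) (R *\<^sub>R One)"
      by (auto simp: mem_box abs_le_iff)  (metis minus_le_iff)
  qed
  have "\<forall>b\<in>Basis. (- R *\<^sub>R One) \<bullet> b \<le> (R *\<^sub>R One) \<bullet> (b::'b)" using assms by simp
  then have "emeasure lborel (cbox (- R *\<^sub>R One) (R *\<^sub>R (One::'b)))
      = ennreal (\<Prod>b\<in>(Basis::'b set). (R *\<^sub>R One - (- R *\<^sub>R One)) \<bullet> b)"
    unfolding emeasure_lborel_cbox_eq by (rule arg_cong[OF if_P])
  also have "(\<Prod>b\<in>(Basis::'b set). (R *\<^sub>R One - (- R *\<^sub>R One)) \<bullet> b) = (\<Prod>b\<in>(Basis::'b set). 2 * R)"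
    by (intro prod.cong refl) (simp add: inner_diff_left inner_add_left)
  finally have "emeasure lborel (cbox (- R *\<^sub>R One) (R *\<^sub>R (One::'b))) = ennreal ((2 * R) ^ DIM('b))" by simp
  then show ?thesis using emeasure_mono[OF sub, of lborel] by simp
qed

text \<open>
  Integrate over the vertical lines meeting the ball.
\<close>

lemma mass_le_lines:
  fixes w :: "'b::euclidean_space \<times> real \<Rightarrow> real"
  assumes [measurable]: "w \<in> borel_measurable borel" and R: "R > 0"
    and supp: "\<And>x. x \<notin> ball 0 R \<Longrightarrow> w x = 0"
    and le: "\<And>x u. norm u = 1 \<Longrightarrow> (\<integral>\<^sup>+t. ennreal (w (x + t *\<^sub>R u)) \<partial>lborel) \<le> C"
  shows "(\<integral>\<^sup>+x. ennreal (w x) \<partial>lborel) \<le> C * ennreal ((2 * R) ^ DIM('b))"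
proof -
  have wm: "w \<in> borel_measurable (lborel \<Otimes>\<^sub>M lborel)"
    by (simp add: lborel_prod)
  have "(\<integral>\<^sup>+x. ennreal (w x) \<partial>lborel) = (\<integral>\<^sup>+\<xi>. \<integral>\<^sup>+t. ennreal (w (\<xi>, t)) \<partial>lborel \<partial>lborel)"
    unfolding lborel_prod[symmetric] using wm by (subst lborel.nn_integral_fst) auto
  also have "\<dots> \<le> (\<integral>\<^sup>+\<xi>. C * indicator (ball (0::'b) R) \<xi> \<partial>lborel)"
  proof (intro nn_integral_mono)
    fix \<xi> :: 'b
    show "(\<integral>\<^sup>+t. ennreal (w (\<xi>, t)) \<partial>lborel) \<le> C * indicator (ball 0 R) \<xi>"
    proof (cases "\<xi> \<in> ball 0 R")
      case True
      then show ?thesis using le[of "(0, 1)" "(\<xi>, 0)"] by (simp add: norm_prod_def)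
    next
      case False
      have "w (\<xi>, t) = 0" for t
      proof (rule supp)
        show "(\<xi>, t) \<notin> ball 0 R" using False norm_fst_le[of \<xi> t] by simp
      qed
      then show ?thesis by simp
    qed
  qed
  also have "\<dots> = C * emeasure lborel (ball (0::'b) R)" by (rule nn_integral_cmult_indicator) simp
  also have "\<dots> \<le> C * ennreal ((2 * R) ^ DIM('b))"
    by (intro mult_left_mono measure_ball_upper R) simp
  finally show ?thesis .
qed

text \<open>
  The duality step. By the hypothesis \<open>near\<close>, each point of \<open>Y\<close> is close to at least
  \<open>\<kappa> card X\<close> of the peaks \<open>P a' - P a\<close>, which makes the transform of the weight large on \<open>Y\<close>. The last hypothesis collects all constants: \<open>V R\<^sup>d\<close> is the
  number of caps up to a constant, and the losses are \<open>\<kappa>\<^sup>2\<close> and \<open>(K + 1)\<^sup>2\<close>.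
\<close>

lemma weighted_extension_lower_bound:
  fixes \<sigma> :: "('b::euclidean_space \<times> real) measure" and P :: "'i \<Rightarrow> 'b \<times> real"
    and K \<tau> R \<Gamma> \<kappa> V :: real
  assumes \<sigma>: "finite_measure \<sigma>" "sets \<sigma> = sets borel" and Y: "Y \<in> sets borel"
    and X: "finite X" "X \<noteq> {}" and R: "R \<ge> 1" and \<tau>: "\<tau> \<ge> 0" and K: "K \<ge> 0" and \<kappa>: "\<kappa> > 0" and \<Gamma>: "\<Gamma> \<ge> 0"
    and plank: "\<And>u a. norm u = 1 \<Longrightarrow> a \<in> X \<Longrightarrow> real (card {a'\<in>X. \<bar>(P a - P a') \<bullet> u\<bar> < \<tau>}) \<le> K"
    and tail: "card X * exp (- (R * \<tau>)\<^sup>2) \<le> 1"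
    and near: "AE y in \<sigma>. y \<in> Y \<longrightarrow>
      \<kappa> * card X \<le> card {(a, a') \<in> X \<times> X. norm (P a - P a' + y) \<le> 1 / (3 * R)}"
    and V: "V > 0" "V \<le> measure \<sigma> Y"
    and final: "\<Gamma> * (16 * (exp (1 / 2) * sqrt (2 * pi))\<^sup>2 * (K + 1)\<^sup>2 * 2 ^ DIM('b) * (2 * real DIM('b \<times> real)) ^ (2 * DIM('b \<times> real)))
       \<le> V * \<kappa>\<^sup>2 * R ^ DIM('b)"
  shows "\<exists>w. weight_on_ball R w \<and> \<not> (AE x in lborel. w x = 0) \<and> Xray_norm w < \<infinity> \<and>
    ennreal \<Gamma> * Xray_norm w * L2_norm_sq \<sigma> (indicator Y)
      \<le> L2_norm_sq (density lborel (\<lambda>x. ennreal (w x)))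
          (\<lambda>x. LINT y|\<sigma>. exp (2 * of_real pi * \<i> * of_real (x \<bullet> y)) * indicator Y y)"
proof -
  interpret \<sigma>: finite_measure \<sigma> by fact
  interpret PS: pair_sigma_finite "lborel :: ('b \<times> real) measure" \<sigma> ..
  note [measurable_cong] = \<sigma>(2)
  note [measurable] = Y
  have R0: "R > 0" using R by simp
  let ?n = "DIM('b \<times> real)"
  let ?B = "ball (0 :: 'b \<times> real) (R / 2)"
  define \<beta> where "\<beta> = measure lborel ?B"
  define w where "w = box_weight P X R"
  define N where "N = real (card X)"
  define S where "S = measure \<sigma> Y"
  define C0 where "C0 = exp (1 / 2) * sqrt (2 * pi)"
  define l where "l = \<beta> * C0 * R * (N * (K + 1))"
  define E where "E x = (LINT y|\<sigma>. chi (x \<bullet> y) * indicator Y y)" for x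
  have S0: "S > 0" using V by (simp add: S_def)
  have N0: "N > 0" using X by (simp add: N_def card_gt_0_iff)
  have \<beta>: "(R / (2 * ?n)) ^ ?n \<le> \<beta>" unfolding \<beta>_def by (rule measure_ball_lower[OF R0])
  have \<beta>0: "\<beta> > 0" by (rule less_le_trans[OF _ \<beta>]) (use R0 in simp)
  have C0: "C0 > 0" by (simp add: C0_def)
  have l0: "l > 0" using \<beta>0 C0 R0 N0 K by (simp add: l_def)
  have wm [measurable]: "w \<in> borel_measurable borel" unfolding w_def by measurable
  have w0: "0 \<le> w x" for x unfolding w_def by (rule box_weight_nonneg)
  have line: "(\<integral>\<^sup>+t. ennreal (w (x + t *\<^sub>R u)) \<partial>lborel) \<le> ennreal l" if "norm u = 1" for x u
    unfolding w_def l_def \<beta>_def C0_def N_def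
    by (rule box_weight_line_plank[OF X(1) R0 that plank[OF that] tail \<tau>])
  have Xle: "Xray_norm w \<le> ennreal l" by (rule Xray_norm_le[OF wm line])
  have mass: "(\<integral>\<^sup>+x. ennreal (w x) \<partial>lborel) \<le> ennreal l * ennreal ((2 * R) ^ DIM('b))"
    by (rule mass_le_lines[OF wm R0 _ line]) (auto simp: w_def box_weight_support)
  have wi: "integrable lborel w" unfolding w_def by (rule box_weight_integrable)
  define W where "W = (LINT x|lborel. w x)"
  have Wl: "W \<le> l * (2 * R) ^ DIM('b)"
  proof -
    have "ennreal W = (\<integral>\<^sup>+x. ennreal (w x) \<partial>lborel)"
      unfolding W_def by (rule nn_integral_eq_integral[symmetric, OF wi]) (simp add: w0)
    also have "\<dots> \<le> ennreal (l * (2 * R) ^ DIM('b))"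
      using mass l0 R0 by (simp add: ennreal_mult)
    finally show ?thesis using l0 R0 by (simp add: ennreal_le_iff)
  qed
  define wh where "wh y = (\<Sum>a\<in>X. \<Sum>a'\<in>X. (cmod (ind_fourier ?B (P a - P a' + y)))\<^sup>2)" for y
  have wh: "(LINT x|lborel. complex_of_real (w x) * chi (x \<bullet> y)) = of_real (wh y)" for y
    unfolding w_def wh_def by (rule box_weight_fourier(2))
  have wh0: "0 \<le> wh y" for y unfolding wh_def by (intro sum_nonneg) simp
  have wh_low: "AE y in \<sigma>. y \<in> Y \<longrightarrow> \<kappa> * N * (\<beta> / 2)\<^sup>2 \<le> wh y"
    using near
  proof (rule AE_mp, intro AE_I2 impI)
    fix y assume nr: "y \<in> Y \<longrightarrow> \<kappa> * card X \<le> card {(a, a') \<in> X \<times> X. norm (P a - P a' + y) \<le> 1 / (3 * R)}"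
      and y: "y \<in> Y"
    let ?Z = "{(a, a') \<in> X \<times> X. norm (P a - P a' + y) \<le> 1 / (3 * R)}"
    have finZ: "finite ?Z" by (rule finite_subset[of _ "X \<times> X"]) (use X in auto)
    have "\<kappa> * N * (\<beta> / 2)\<^sup>2 \<le> real (card ?Z) * (\<beta> / 2)\<^sup>2"
      using nr y by (intro mult_right_mono) (auto simp: N_def)
    also have "\<dots> = (\<Sum>z\<in>?Z. (\<beta> / 2)\<^sup>2)" by simp
    also have "\<dots> \<le> (\<Sum>z\<in>?Z. (cmod (ind_fourier ?B (P (fst z) - P (snd z) + y)))\<^sup>2)"
    proof (intro sum_mono power_mono)
      fix z assume "z \<in> ?Z"
      then have "norm (P (fst z) - P (snd z) + y) \<le> 1 / (3 * R)" by auto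
      from ind_fourier_ball_lower[OF R0 this]
      show "\<beta> / 2 \<le> cmod (ind_fourier ?B (P (fst z) - P (snd z) + y))" by (simp add: \<beta>_def)
    qed (use \<beta>0 in simp)
    also have "\<dots> \<le> (\<Sum>z\<in>X \<times> X. (cmod (ind_fourier ?B (P (fst z) - P (snd z) + y)))\<^sup>2)"
      using X by (intro sum_mono2) auto
    also have "\<dots> = wh y" unfolding wh_def by (simp add: sum.cartesian_product case_prod_beta)
    finally show "\<kappa> * N * (\<beta> / 2)\<^sup>2 \<le> wh y" .
  qed
  let ?F = "\<lambda>x y. complex_of_real (w x) * (chi (x \<bullet> y) * indicator Y y)"
  have Fm: "case_prod ?F \<in> borel_measurable (lborel \<Otimes>\<^sub>M \<sigma>)" by measurable
  have Fi: "integrable (lborel \<Otimes>\<^sub>M \<sigma>) (case_prod ?F)"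
  proof (rule integrableI_bounded[OF Fm])
    have "(\<integral>\<^sup>+z. ennreal (norm (case_prod ?F z)) \<partial>(lborel \<Otimes>\<^sub>M \<sigma>))
      = (\<integral>\<^sup>+x. \<integral>\<^sup>+y. ennreal (norm (?F x y)) \<partial>\<sigma> \<partial>lborel)"
      using Fm by (subst \<sigma>.nn_integral_fst[symmetric]) auto
    also have "\<dots> \<le> (\<integral>\<^sup>+x. \<integral>\<^sup>+y. ennreal (w x) \<partial>\<sigma> \<partial>lborel)"
      by (intro nn_integral_mono ennreal_leI) (auto simp: norm_mult w0 indicator_def)
    also have "\<dots> = (\<integral>\<^sup>+x. ennreal (w x) \<partial>lborel) * emeasure \<sigma> (space \<sigma>)"
      by (simp add: nn_integral_multc)
    also have "\<dots> \<le> (ennreal l * ennreal ((2 * R) ^ DIM('b))) * emeasure \<sigma> (space \<sigma>)"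
      by (intro mult_right_mono mass) simp
    also have "\<dots> < \<infinity>"
      using less_top[THEN iffD1, OF \<sigma>.emeasure_finite[of "space \<sigma>"]] by (simp add: ennreal_mult_less_top)
    finally show "(\<integral>\<^sup>+z. ennreal (norm (case_prod ?F z)) \<partial>(lborel \<Otimes>\<^sub>M \<sigma>)) < \<infinity>" .
  qed
  define I where "I = (LINT y|\<sigma>. wh y * indicator Y y)"
  have FE: "(LINT y|\<sigma>. ?F x y) = complex_of_real (w x) * E x" for x
    unfolding E_def by simp
  have Fw: "(LINT x|lborel. ?F x y) = complex_of_real (wh y * indicator Y y)" for y
  proof -
    have "(LINT x|lborel. ?F x y) = (LINT x|lborel. complex_of_real (w x) * chi (x \<bullet> y)) * indicator Y y"
      by (simp add: mult.assoc[symmetric])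
    then show ?thesis unfolding wh by (simp add: indicator_def)
  qed
  have "(LINT x|lborel. complex_of_real (w x) * E x) = (LINT y|\<sigma>. LINT x|lborel. ?F x y)"
    unfolding FE[symmetric] by (rule PS.Fubini_integral[OF Fi, symmetric])
  then have IE: "(LINT x|lborel. complex_of_real (w x) * E x) = complex_of_real I"
    unfolding Fw I_def integral_complex_of_real .
  have whi: "integrable \<sigma> (\<lambda>y. wh y * indicator Y y)"
    using PS.integrable_snd[OF Fi] unfolding Fw complex_of_real_integrable_eq .
  have I_low: "\<kappa> * N * (\<beta> / 2)\<^sup>2 * S \<le> I"
  proof -
    have "\<kappa> * N * (\<beta> / 2)\<^sup>2 * S = (LINT y|\<sigma>. \<kappa> * N * (\<beta> / 2)\<^sup>2 * indicator Y y)"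
      by (simp add: S_def \<sigma>(2))
    also have "\<dots> \<le> I"
      unfolding I_def
    proof (rule integral_mono_AE[OF _ whi])
      show "integrable \<sigma> (\<lambda>y. \<kappa> * N * (\<beta> / 2)\<^sup>2 * indicator Y y)"
        by (intro integrable_mult_right \<sigma>.integrable_const_bound[of _ 1]) (auto simp: indicator_def)
      show "AE y in \<sigma>. \<kappa> * N * (\<beta> / 2)\<^sup>2 * indicator Y y \<le> wh y * indicator Y y"
        using wh_low by (rule AE_mp) (auto simp: indicator_def)
    qed
    finally show ?thesis .
  qed
  have I0: "I > 0" by (rule less_le_trans[OF _ I_low]) (use \<kappa> N0 \<beta>0 S0 in simp)
  have Em [measurable]: "E \<in> borel_measurable borel"
    unfolding E_def[abs_def] by measurable
  have Eb: "cmod (E x) \<le> S" for x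
  proof -
    have "cmod (E x) \<le> (LINT y|\<sigma>. indicator Y y)"
    proof -
      have "cmod (E x) \<le> (LINT y|\<sigma>. cmod (chi (x \<bullet> y) * indicator Y y))"
        unfolding E_def by (rule integral_norm_bound)
      also have "\<dots> = (LINT y|\<sigma>. indicator Y y)"
        by (intro Bochner_Integration.integral_cong refl) (simp add: norm_mult indicator_def)
      finally show ?thesis .
    qed
    then show ?thesis by (simp add: S_def \<sigma>(2))
  qed
  have wE1: "integrable lborel (\<lambda>x. w x * cmod (E x))"
  proof (rule Bochner_Integration.integrable_bound[of _ "\<lambda>x. w x * S"])
    show "AE x in lborel. norm (w x * cmod (E x)) \<le> norm (w x * S)"
      using Eb w0 S0 by (intro AE_I2) (simp add: abs_mult mult_left_mono)
  qed (use wi in auto)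
  have wE2: "integrable lborel (\<lambda>x. w x * (cmod (E x))\<^sup>2)"
  proof (rule Bochner_Integration.integrable_bound[of _ "\<lambda>x. w x * S\<^sup>2"])
    show "AE x in lborel. norm (w x * (cmod (E x))\<^sup>2) \<le> norm (w x * S\<^sup>2)"
      using Eb w0 S0 by (intro AE_I2) (simp add: abs_mult mult_left_mono power_mono)
  qed (use wi in auto)
  define J where "J = (LINT x|lborel. w x * (cmod (E x))\<^sup>2)"
  have W0: "W > 0"
  proof (rule ccontr)
    assume "\<not> W > 0"
    then have "W = 0" using w0 by (simp add: W_def integral_nonneg_AE order_antisym not_less)
    then have "AE x in lborel. w x = 0"
      using integral_nonneg_eq_0_iff_AE[OF wi] w0 by (simp add: W_def)
    then have "AE x in lborel. complex_of_real (w x) * E x = 0" by (rule AE_mp) auto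
    then have "(LINT x|lborel. complex_of_real (w x) * E x) = 0"
      by (rule integral_eq_zero_AE)
    then show False using IE I0 by simp
  qed
  have CS: "I\<^sup>2 \<le> J * W"
  proof -
    \<comment> \<open>Cauchy-Schwarz by the weighted inequality \<open>2 c |E| \<le> |E|\<^sup>2 + c\<^sup>2\<close> with the optimal \<open>c\<close>.\<close>
    define c where "c = I / W"
    have c0: "c > 0" using I0 W0 by (simp add: c_def)
    have "I = cmod (LINT x|lborel. complex_of_real (w x) * E x)" unfolding IE using I0 by simp
    also have "\<dots> \<le> (LINT x|lborel. cmod (complex_of_real (w x) * E x))" by (rule integral_norm_bound)
    also have "\<dots> = (LINT x|lborel. w x * cmod (E x))" by (simp add: norm_mult w0)
    also have "\<dots> \<le> (LINT x|lborel. (1 / (2 * c)) * (w x * (cmod (E x))\<^sup>2) + (c / 2) * w x)"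
    proof (rule integral_mono[OF wE1])
      fix x
      have "0 \<le> (cmod (E x) - c)\<^sup>2" by simp
      then have "2 * c * cmod (E x) \<le> (cmod (E x))\<^sup>2 + c\<^sup>2" by (simp add: power2_diff mult_ac)
      then have "cmod (E x) \<le> ((cmod (E x))\<^sup>2 + c\<^sup>2) / (2 * c)" using c0 by (simp add: pos_le_divide_eq mult_ac)
      from mult_left_mono[OF this w0[of x]]
      have "w x * cmod (E x) \<le> w x * (((cmod (E x))\<^sup>2 + c\<^sup>2) / (2 * c))" .
      also have "\<dots> = (1 / (2 * c)) * (w x * (cmod (E x))\<^sup>2) + (c / 2) * w x"
        using c0 by (simp add: field_simps power2_eq_square)
      finally show "w x * cmod (E x) \<le> (1 / (2 * c)) * (w x * (cmod (E x))\<^sup>2) + (c / 2) * w x" .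
    qed (intro Bochner_Integration.integrable_add integrable_mult_right wE2 wi)
    also have "\<dots> = (1 / (2 * c)) * J + (c / 2) * W"
      unfolding J_def W_def using wE2 wi by simp
    also have "(1 / (2 * c)) * J = J * W / (2 * I)" using I0 W0 by (simp add: c_def)
    also have "(c / 2) * W = I / 2" using W0 by (simp add: c_def)
    finally have "I \<le> J * W / (2 * I) + I / 2" .
    then show ?thesis using I0 by (simp add: field_simps power2_eq_square)
  qed
  have nonzero: "\<not> (AE x in lborel. w x = 0)"
  proof
    assume "AE x in lborel. w x = 0"
    then have "W = 0" unfolding W_def by (rule integral_eq_zero_AE)
    then show False using W0 by simp
  qed
  have numeric: "\<Gamma> * l * S \<le> J"
  proof -
    have "\<Gamma> * (16 * C0\<^sup>2 * (K + 1)\<^sup>2 * 2 ^ DIM('b)) * (R\<^sup>2 * R ^ DIM('b)) \<le> V * \<kappa>\<^sup>2 * \<beta>\<^sup>2"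
    proof -
      have p: "(2 * real ?n) ^ (2 * ?n) > 0" by simp
      have "\<Gamma> * (16 * C0\<^sup>2 * (K + 1)\<^sup>2 * 2 ^ DIM('b)) * (R\<^sup>2 * R ^ DIM('b)) * (2 * real ?n) ^ (2 * ?n)
        = (\<Gamma> * (16 * C0\<^sup>2 * (K + 1)\<^sup>2 * 2 ^ DIM('b) * (2 * real ?n) ^ (2 * ?n))) * (R\<^sup>2 * R ^ DIM('b))"
        by (simp only: mult_ac)
      also have "\<dots> \<le> (V * \<kappa>\<^sup>2 * R ^ DIM('b)) * (R\<^sup>2 * R ^ DIM('b))"
        by (rule mult_right_mono[OF final[folded C0_def]]) (use R0 in simp)
      also have "\<dots> = V * \<kappa>\<^sup>2 * R ^ (2 * ?n)"
        by (simp add: power_add power_mult power_mult_distrib power2_eq_square mult_ac)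
      finally have "\<Gamma> * (16 * C0\<^sup>2 * (K + 1)\<^sup>2 * 2 ^ DIM('b)) * (R\<^sup>2 * R ^ DIM('b))
          \<le> V * \<kappa>\<^sup>2 * R ^ (2 * ?n) / (2 * real ?n) ^ (2 * ?n)"
        using p by (simp only: pos_le_divide_eq)
      also have "\<dots> = V * \<kappa>\<^sup>2 * ((R / (2 * ?n)) ^ ?n)\<^sup>2"
      proof -
        have "((R / c) ^ m)\<^sup>2 = R ^ (2 * m) / c ^ (2 * m)" for c :: real and m :: nat
          by (simp add: power_divide power_mult[symmetric] mult.commute)
        then show ?thesis by (simp only: times_divide_eq_right of_nat_mult of_nat_numeral)
      qed
      also have "\<dots> \<le> V * \<kappa>\<^sup>2 * \<beta>\<^sup>2"
        using \<beta> V R0 by (intro mult_left_mono power_mono) auto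
      finally show ?thesis .
    qed
    from mult_right_mono[OF this, of "\<beta>\<^sup>2 * N\<^sup>2"]
    have "\<Gamma> * l\<^sup>2 * (2 * R) ^ DIM('b) * 16 \<le> V * \<kappa>\<^sup>2 * \<beta>\<^sup>2 * (\<beta>\<^sup>2 * N\<^sup>2)"
      by (simp add: l_def power_mult_distrib mult_ac)
    also have "\<dots> \<le> S * \<kappa>\<^sup>2 * \<beta>\<^sup>2 * (\<beta>\<^sup>2 * N\<^sup>2)"
      using V by (intro mult_right_mono) (auto simp: S_def)
    finally have A: "\<Gamma> * l\<^sup>2 * (2 * R) ^ DIM('b) \<le> S * (\<kappa> * N * (\<beta> / 2)\<^sup>2)\<^sup>2"
      by (simp add: power2_eq_square mult_ac)
    have "(\<Gamma> * l * S) * (l * (2 * R) ^ DIM('b)) = (\<Gamma> * l\<^sup>2 * (2 * R) ^ DIM('b)) * S"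
      by (simp add: power2_eq_square mult_ac)
    also have "\<dots> \<le> S * (\<kappa> * N * (\<beta> / 2)\<^sup>2)\<^sup>2 * S"
      using A S0 by (intro mult_right_mono) auto
    also have "\<dots> = (\<kappa> * N * (\<beta> / 2)\<^sup>2 * S)\<^sup>2" by (simp add: power2_eq_square mult_ac)
    also have "\<dots> \<le> I\<^sup>2" using I_low \<kappa> N0 S0 by (intro power_mono) auto
    also have "\<dots> \<le> J * W" by (rule CS)
    also have "\<dots> \<le> J * (l * (2 * R) ^ DIM('b))"
      using Wl w0 by (intro mult_left_mono) (auto simp: J_def intro!: integral_nonneg_AE)
    finally show ?thesis
      by (rule mult_right_le_imp_le) (use l0 R0 in simp)
  qed
  have "L2_norm_sq \<sigma> (indicator Y) = ennreal S"
  proof -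
    have "L2_norm_sq \<sigma> (indicator Y) = (\<integral>\<^sup>+y. indicator Y y \<partial>\<sigma>)"
      unfolding L2_norm_sq_def by (intro nn_integral_cong) (simp add: indicator_def)
    then show ?thesis by (simp add: \<sigma>(2) S_def \<sigma>.emeasure_eq_measure)
  qed
  moreover have "L2_norm_sq (density lborel (\<lambda>x. ennreal (w x)))
          (\<lambda>x. LINT y|\<sigma>. exp (2 * of_real pi * \<i> * of_real (x \<bullet> y)) * indicator Y y) = ennreal J"
  proof -
    have "L2_norm_sq (density lborel (\<lambda>x. ennreal (w x))) E = (\<integral>\<^sup>+x. ennreal (w x) * ennreal ((cmod (E x))\<^sup>2) \<partial>lborel)"
      unfolding L2_norm_sq_def by (subst nn_integral_density) auto
    also have "\<dots> = (\<integral>\<^sup>+x. ennreal (w x * (cmod (E x))\<^sup>2) \<partial>lborel)"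
      by (simp add: ennreal_mult w0)
    also have "\<dots> = ennreal J"
      unfolding J_def by (rule nn_integral_eq_integral[OF wE2]) (simp add: w0)
    finally show ?thesis unfolding chi_exp E_def[abs_def] .
  qed
  moreover have "ennreal \<Gamma> * Xray_norm w * ennreal S \<le> ennreal J"
  proof -
    have "ennreal \<Gamma> * Xray_norm w * ennreal S \<le> ennreal \<Gamma> * ennreal l * ennreal S"
      by (intro mult_right_mono mult_left_mono Xle) auto
    also have "\<dots> = ennreal (\<Gamma> * l * S)"
      using \<Gamma> l0 S0 by (simp add: ennreal_mult)
    also have "\<dots> \<le> ennreal J" using numeric by (rule ennreal_leI)
    finally show ?thesis .
  qed
  ultimately show ?thesis
    using nonzero order_le_less_trans[OF Xle ennreal_less_top] w0
    by (intro exI[of _ w]) (auto simp: weight_on_ball_def wm box_weight_support w_def)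
qed

section \<open>Generalised arithmetic progressions in space and the surface measure\<close>

text \<open>
  The integer generators \<open>snd x\<close> make it possible to reach the cube, and a bounded vertical range above it,
  from arbitrary residues modulo \<open>1\<close>.
\<close>

definition gen_point :: "nat \<Rightarrow> int \<Rightarrow> (nat \<times> 'd option \<Rightarrow> int) \<Rightarrow> (nat \<Rightarrow> int) \<times> ('d option \<Rightarrow> int) \<Rightarrow> (real^'d::finite) \<times> real" where
  "gen_point M q g x =
     (\<chi> i. comb M (fst x) g (Some i) / q + real_of_int (snd x (Some i)),
      comb M (fst x) g None / q + real_of_int (snd x None))"

definition gen_box :: "nat \<Rightarrow> int \<Rightarrow> ((nat \<Rightarrow> int) \<times> ('c \<Rightarrow> int)) set" where
  "gen_box M H = PiE {..<M} (\<lambda>_. {-H..H}) \<times> PiE UNIV (\<lambda>_. {-H..H})"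

lemma finite_gen_box: "finite (gen_box M H :: ((nat \<Rightarrow> int) \<times> ('c::finite \<Rightarrow> int)) set)"
  unfolding gen_box_def by (intro finite_cartesian_product finite_PiE) auto

lemma card_gen_box: "card (gen_box M H :: ((nat \<Rightarrow> int) \<times> ('c::finite \<Rightarrow> int)) set) = nat (2 * H + 1) ^ (M + CARD('c))"
  by (simp add: gen_box_def card_cartesian_product card_PiE power_add add.commute)

lemma gen_boxD:
  assumes "x \<in> gen_box M H"
  shows "i < M \<Longrightarrow> \<bar>fst x i\<bar> \<le> H" "\<bar>snd x \<kappa>\<bar> \<le> H" "fst x \<in> extensional {..<M}"
proof -
  have x: "fst x \<in> PiE {..<M} (\<lambda>_. {-H..H})" "snd x \<in> PiE UNIV (\<lambda>_. {-H..H})"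
    using assms by (auto simp: gen_box_def)
  show "i < M \<Longrightarrow> \<bar>fst x i\<bar> \<le> H" using PiE_mem[OF x(1), of i] by auto
  show "\<bar>snd x \<kappa>\<bar> \<le> H" using PiE_mem[OF x(2), of \<kappa>] by auto
  show "fst x \<in> extensional {..<M}" using x(1) by (simp add: PiE_def)
qed

lemma gen_boxI:
  assumes "\<And>i. i < M \<Longrightarrow> \<bar>a i\<bar> \<le> H" "\<And>\<kappa>. \<bar>e \<kappa>\<bar> \<le> H"
  shows "(restrict a {..<M}, e) \<in> gen_box M H"
proof -
  have "a i \<in> {-H..H}" if "i < M" for i using assms(1)[OF that] by (auto simp: abs_le_iff)
  moreover have "e \<kappa> \<in> {-H..H}" for \<kappa> using assms(2)[of \<kappa>] by (auto simp: abs_le_iff)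
  ultimately show ?thesis by (auto simp: gen_box_def)
qed

lemma comb_restrict_diff: "comb M (restrict (\<lambda>i. a i - b i) {..<M}) g \<kappa> = comb M a g \<kappa> - comb M b g \<kappa>"
  by (simp add: comb_def sum_subtractf algebra_simps)

lemma comb_restrict_add: "comb M (restrict (\<lambda>i. a i + b i) {..<M}) g \<kappa> = comb M a g \<kappa> + comb M b g \<kappa>"
  by (simp add: comb_def sum.distrib algebra_simps)

definition coord :: "(real^'d::finite) \<times> real \<Rightarrow> 'd option \<Rightarrow> real" where
  "coord u \<kappa> = (case \<kappa> of None \<Rightarrow> snd u | Some i \<Rightarrow> fst u $ i)"

lemma sum_option: "(\<Sum>\<kappa>\<in>UNIV. f \<kappa>) = f None + (\<Sum>i\<in>UNIV. f (Some i))" for f :: "'d::finite option \<Rightarrow> 'a::comm_monoid_add"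
  unfolding UNIV_option_conv by (subst sum.insert) (auto simp: sum.reindex)

lemma inner_coord: "x \<bullet> u = (\<Sum>\<kappa>\<in>UNIV. coord u \<kappa> * coord x \<kappa>)"
  unfolding sum_option by (cases x, cases u) (simp add: coord_def inner_vec_def mult.commute)

lemma coord_gen_point:
  fixes x :: "(nat \<Rightarrow> int) \<times> ('d::finite option \<Rightarrow> int)"
  shows "coord (gen_point M q g x) \<kappa> = comb M (fst x) g \<kappa> / q + real_of_int (snd x \<kappa>)"
  by (simp add: coord_def gen_point_def split: option.split)

lemma coord_diff: "coord (x - y) \<kappa> = coord x \<kappa> - coord y \<kappa>"
  by (simp add: coord_def split: option.split)

lemma coord_eqI: "(\<And>\<kappa>. coord x \<kappa> = coord y \<kappa>) \<Longrightarrow> x = y"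
proof -
  assume *: "\<And>\<kappa>. coord x \<kappa> = coord y \<kappa>"
  have "fst x $ i = fst y $ i" for i using *[of "Some i"] by (simp add: coord_def)
  moreover have "snd x = snd y" using *[of None] by (simp add: coord_def)
  ultimately show "x = y" by (simp add: prod_eq_iff vec_eq_iff)
qed

lemma unit_coord:
  fixes u :: "(real^'d::finite) \<times> real"
  assumes "norm u = 1"
  shows "\<bar>coord u \<kappa>\<bar> \<le> 1" "\<exists>j. \<bar>coord u j\<bar> \<ge> 1 / CARD('d option)"
proof -
  have s: "(\<Sum>\<kappa>\<in>UNIV. (coord u \<kappa>)\<^sup>2) = 1"
    using inner_coord[of u u] assms by (simp add: power2_eq_square norm_eq_1)
  have "(coord u \<kappa>)\<^sup>2 \<le> (\<Sum>\<kappa>\<in>UNIV. (coord u \<kappa>)\<^sup>2)" for \<kappa>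
    by (rule member_le_sum) auto
  then have le: "\<bar>coord u \<kappa>\<bar> \<le> 1" for \<kappa>
    unfolding s by (simp add: abs_square_le_1)
  then show "\<bar>coord u \<kappa>\<bar> \<le> 1" .
  show "\<exists>j. \<bar>coord u j\<bar> \<ge> 1 / CARD('d option)"
  proof (rule ccontr)
    assume "\<not> ?thesis"
    then have lt: "\<bar>coord u \<kappa>\<bar> < 1 / CARD('d option)" for \<kappa> by (simp add: not_le)
    have "1 = (\<Sum>\<kappa>\<in>UNIV. (coord u \<kappa>)\<^sup>2)" using s by simp
    also have "\<dots> \<le> (\<Sum>\<kappa>\<in>UNIV. \<bar>coord u \<kappa>\<bar>)"
    proof (intro sum_mono)
      fix \<kappa>
      have "\<bar>coord u \<kappa>\<bar> * \<bar>coord u \<kappa>\<bar> \<le> \<bar>coord u \<kappa>\<bar> * 1"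
        using le[of \<kappa>] by (intro mult_left_mono) auto
      then show "(coord u \<kappa>)\<^sup>2 \<le> \<bar>coord u \<kappa>\<bar>" by (simp add: power2_eq_square)
    qed
    also have "\<dots> < (\<Sum>\<kappa>\<in>(UNIV :: 'd option set). 1 / CARD('d option))"
      by (intro sum_strict_mono lt) auto
    also have "\<dots> = 1" by simp
    finally show False by simp
  qed
qed

text \<open>
  For fixed \<open>x\<close>, the differences \<open>x - x'\<close> are distinct points of a box twice as large.
\<close>

lemma card_gen_box_plank:
  fixes g :: "nat \<times> 'd::finite option \<Rightarrow> int" and u :: "(real^'d) \<times> real" and \<tau> :: real
  assumes g: "g \<in> gens M q" "g \<notin> bad_gens M q p (8 * L) Q (3 * \<tau> * Q * q)"
    and q: "q > 0" and L: "L \<ge> 0" and \<tau>: "\<tau> > 0"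
    and Q: "Q \<ge> 2 * int CARD('d option)" "real CARD('d option) * M * (8 * L) \<le> \<tau> * Q"
    and u: "norm u = 1" and x: "x \<in> gen_box M (2 * L)"
  shows "card {x' \<in> gen_box M (2 * L). \<bar>(gen_point M q g x - gen_point M q g x') \<bullet> u\<bar> < \<tau>}
    \<le> nat (8 * L + 1) ^ (CARD('d option) + p)"
proof -
  obtain j where j: "\<bar>coord u j\<bar> \<ge> 1 / CARD('d option)" using unit_coord(2)[OF u] by blast
  let ?T = "{(a, e). a \<in> PiE {..<M} (\<lambda>_. {-(4*L)..4*L}) \<and> e \<in> PiE UNIV (\<lambda>_. {-(4*L)..4*L}) \<and>
      \<bar>\<Sum>\<kappa>\<in>UNIV. coord u \<kappa> * (real_of_int (comb M a g \<kappa>) / q + real_of_int (e \<kappa>))\<bar> < \<tau>}"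
  have T: "card ?T \<le> nat (2 * (4 * L) + 1) ^ (CARD('d option) + p)"
    by (rule plank_count[where H = "4 * L" and Q = Q and j = j])
      (use g q L \<tau> Q unit_coord(1)[OF u] j in auto)
  let ?S = "{x' \<in> gen_box M (2 * L). \<bar>(gen_point M q g x - gen_point M q g x') \<bullet> u\<bar> < \<tau>}"
  define f where "f x' = (restrict (\<lambda>i. fst x i - fst x' i) {..<M}, \<lambda>\<kappa>. snd x \<kappa> - snd x' \<kappa>)" for x' :: "(nat \<Rightarrow> int) \<times> ('d option \<Rightarrow> int)"
  have inj: "inj_on f ?S"
  proof (rule inj_onI)
    fix y y' assume y: "y \<in> ?S" "y' \<in> ?S" and eq: "f y = f y'"
    have 1: "fst y \<in> extensional {..<M}" "fst y' \<in> extensional {..<M}" 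
      using y gen_boxD(3)[of y M "2 * L"] gen_boxD(3)[of y' M "2 * L"] by auto
    have "fst y i = fst y' i" if "i < M" for i
    proof -
      have "fst (f y) i = fst (f y') i" using eq by simp
      then show ?thesis using that by (simp add: f_def)
    qed
    then have "fst y = fst y'" using extensionalityI[OF 1] by auto
    moreover have "snd y \<kappa> = snd y' \<kappa>" for \<kappa>
    proof -
      have "snd (f y) \<kappa> = snd (f y') \<kappa>" using eq by simp
      then show ?thesis by (simp add: f_def)
    qed
    ultimately show "y = y'" by (simp add: prod_eq_iff fun_eq_iff)
  qed
  have finT: "finite ?T"
    by (rule finite_subset[OF _ finite_gen_box[of M "4 * L"]]) (auto simp: gen_box_def)
  have "f ` ?S \<subseteq> ?T"
  proof
    fix y assume "y \<in> f ` ?S"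
    then obtain x' where x': "x' \<in> gen_box M (2 * L)" "\<bar>(gen_point M q g x - gen_point M q g x') \<bullet> u\<bar> < \<tau>"
      and y: "y = f x'" by blast
    have "f x' \<in> gen_box M (4 * L)"
      unfolding f_def
    proof (rule gen_boxI)
      show "\<bar>fst x i - fst x' i\<bar> \<le> 4 * L" if "i < M" for i
        using gen_boxD(1)[OF x that] gen_boxD(1)[OF x'(1) that] by linarith
      show "\<bar>snd x \<kappa> - snd x' \<kappa>\<bar> \<le> 4 * L" for \<kappa>
        using gen_boxD(2)[OF x, of \<kappa>] gen_boxD(2)[OF x'(1), of \<kappa>] by linarith
    qed
    moreover have "(\<Sum>\<kappa>\<in>UNIV. coord u \<kappa> * (real_of_int (comb M (fst (f x')) g \<kappa>) / q + real_of_int (snd (f x') \<kappa>)))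
      = (gen_point M q g x - gen_point M q g x') \<bullet> u"
      unfolding inner_coord coord_diff coord_gen_point f_def
      by (simp add: comb_restrict_diff diff_divide_distrib algebra_simps)
    ultimately show "y \<in> ?T"
      using x'(2) unfolding y gen_box_def by (cases "f x'") auto
  qed
  then have "card (f ` ?S) \<le> card ?T" by (rule card_mono[OF finT])
  then show ?thesis using T by (simp add: card_image[OF inj])
qed

text \<open>
  Every \<open>x\<close> in the smaller box gives the pair \<open>(x, x + x0)\<close> of the larger one.
\<close>

lemma pairs_near_gen_point:
  fixes g :: "nat \<times> 'd::finite option \<Rightarrow> int" and y :: "(real^'d) \<times> real"
  assumes x0: "x0 \<in> gen_box M L" and y: "norm (y - gen_point M q g x0) \<le> \<epsilon>" and L: "L \<ge> 0"
  shows "nat (2 * L + 1) ^ (M + CARD('d option)) \<le>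
    card {(x, x') \<in> gen_box M (2 * L) \<times> gen_box M (2 * L). norm (gen_point M q g x - gen_point M q g x' + y) \<le> \<epsilon>}"
proof -
  let ?S = "{(x, x') \<in> gen_box M (2 * L) \<times> gen_box M (2 * L). norm (gen_point M q g x - gen_point M q g x' + y) \<le> \<epsilon>}"
  define f where "f x = (x, restrict (\<lambda>i. fst x i + fst x0 i) {..<M}, \<lambda>\<kappa>. snd x \<kappa> + snd x0 \<kappa>)"
    for x :: "(nat \<Rightarrow> int) \<times> ('d option \<Rightarrow> int)"
  have inj: "inj_on f (gen_box M L)" by (auto simp: inj_on_def f_def)
  have fin: "finite ?S"
    by (rule finite_subset[of _ "gen_box M (2 * L) \<times> gen_box M (2 * L)"]) (auto simp: finite_gen_box)
  have "f ` gen_box M L \<subseteq> ?S"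
  proof
    fix z assume "z \<in> f ` gen_box M L"
    then obtain x where x: "x \<in> gen_box M L" and z: "z = f x" by blast
    have "(restrict (fst x) {..<M}, snd x) \<in> gen_box M (2 * L)"
    proof (rule gen_boxI)
      show "\<bar>fst x i\<bar> \<le> 2 * L" if "i < M" for i using gen_boxD(1)[OF x that] L by linarith
      show "\<bar>snd x \<kappa>\<bar> \<le> 2 * L" for \<kappa> using gen_boxD(2)[OF x, of \<kappa>] L by linarith
    qed
    then have 1: "x \<in> gen_box M (2 * L)"
      using gen_boxD(3)[OF x] by (simp add: extensional_restrict)
    have 2: "snd (f x) \<in> gen_box M (2 * L)"
      unfolding f_def snd_conv
    proof (rule gen_boxI)
      show "\<bar>fst x i + fst x0 i\<bar> \<le> 2 * L" if "i < M" for i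
        using gen_boxD(1)[OF x that] gen_boxD(1)[OF x0 that] by linarith
      show "\<bar>snd x \<kappa> + snd x0 \<kappa>\<bar> \<le> 2 * L" for \<kappa>
        using gen_boxD(2)[OF x, of \<kappa>] gen_boxD(2)[OF x0, of \<kappa>] by linarith
    qed
    have eq: "gen_point M q g x - gen_point M q g (snd (f x)) = - gen_point M q g x0"
    proof (rule coord_eqI)
      fix \<kappa>
      have "coord (- gen_point M q g x0) \<kappa> = - coord (gen_point M q g x0) \<kappa>"
        by (simp add: coord_def split: option.split)
      then show "coord (gen_point M q g x - gen_point M q g (snd (f x))) \<kappa> = coord (- gen_point M q g x0) \<kappa>"
        unfolding coord_diff coord_gen_point f_def
        by (simp add: comb_restrict_add add_divide_distrib)
    qed
    have "norm (gen_point M q g x - gen_point M q g (snd (f x)) + y) \<le> \<epsilon>"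
      unfolding eq using y by simp
    with 1 2 show "z \<in> ?S" unfolding z by (simp add: f_def)
  qed
  then have "card (f ` gen_box M L) \<le> card ?S" by (rule card_mono[OF fin])
  then show ?thesis by (simp add: card_image[OF inj] card_gen_box)
qed

text \<open>
  Residues of the points of the grid \<open>\<int>\<^sup>n / q\<close> that lie over the middle part of the cell \<open>z\<close> and within
  \<open>s\<close> of the graph. Only the last coordinate is really reduced modulo \<open>1\<close>.
\<close>

definition cell_targets :: "(real^'d::finite \<Rightarrow> real) \<Rightarrow> nat \<Rightarrow> real \<Rightarrow> int \<Rightarrow> ('d \<Rightarrow> nat) \<Rightarrow> ('d option \<Rightarrow> int) set" where
  "cell_targets \<psi> m s q z = {r \<in> residues q.
     (\<forall>i. (z i + 1 / 4) / m \<le> r (Some i) / q \<and> r (Some i) / q \<le> (z i + 3 / 4) / m) \<and>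
     (\<exists>Y. Y mod q = r None \<and> \<bar>real_of_int Y / q - \<psi> (\<chi> i. r (Some i) / q)\<bar> \<le> s)}"

text \<open>
  Choose the horizontal coordinates freely in the middle half of the cell, and one of about
  \<open>s q\<close> consecutive integers just above the graph for the last one; as \<open>s \<le> 1\<close> these have distinct residues.
\<close>

lemma card_cell_targets:
  fixes \<psi> :: "real^'d::finite \<Rightarrow> real"
  assumes q: "q \<ge> 4 * int m" "s * q \<ge> 2" and m: "m > 0" and s: "s \<le> 1" and z: "\<And>i. z i < m"
  shows "(real_of_int q / (4 * real m)) ^ CARD('d) * (s * q / 2) \<le> card (cell_targets \<psi> m s q z)"
proof -
  have q0: "q > 0" using q(1) m by linarith
  define lo where "lo i = \<lceil>q * ((z i + 1 / 4) / m)\<rceil>" for i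
  define hi where "hi i = \<lfloor>q * ((z i + 3 / 4) / m)\<rfloor>" for i
  define h where "h = \<lfloor>s * q\<rfloor>"
  define S where "S = PiE (UNIV :: 'd set) (\<lambda>i. {lo i..hi i}) \<times> {0..<h}"
  define \<xi> where "\<xi> r = (\<chi> i. real_of_int (r i) / q)" for r :: "'d \<Rightarrow> int"
  define f where "f = (\<lambda>(r, j). \<lambda>\<kappa>. case \<kappa> of None \<Rightarrow> (\<lceil>q * \<psi> (\<xi> r)\<rceil> + j) mod q | Some i \<Rightarrow> r i)"
  have hq: "h \<le> q"
  proof -
    have "s * q \<le> 1 * real_of_int q" using s q0 by (intro mult_right_mono) auto
    then show ?thesis unfolding h_def by linarith
  qed
  have len: "real_of_int q / (4 * real m) \<le> real_of_int (hi i - lo i + 1)" for i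
  proof -
    have "real_of_int (4 * int m) \<le> real_of_int q" using q(1) by (simp only: of_int_le_iff)
    then have "1 \<le> real_of_int q / (4 * real m)" using m by (simp add: le_divide_eq)
    moreover have "real_of_int q * ((z i + 3 / 4) / m) - q * ((z i + 1 / 4) / m) = 2 * (q / (4 * real m))"
      using m by (simp add: field_simps)
    ultimately show ?thesis unfolding hi_def lo_def by linarith
  qed
  have cS: "(real_of_int q / (4 * real m)) ^ CARD('d) * (s * q / 2) \<le> card S"
  proof -
    have e1: "real (card S) = (\<Prod>i\<in>(UNIV :: 'd set). real (nat (hi i - lo i + 1))) * real (nat h)"
      unfolding S_def by (simp add: card_cartesian_product card_PiE add.commute algebra_simps)
    have e2: "(real_of_int q / (4 * real m)) ^ CARD('d) \<le> (\<Prod>i\<in>(UNIV :: 'd set). real (nat (hi i - lo i + 1)))"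
    proof -
      have "(\<Prod>i\<in>(UNIV :: 'd set). real_of_int q / (4 * real m)) \<le> (\<Prod>i\<in>(UNIV :: 'd set). real (nat (hi i - lo i + 1)))"
      proof (intro prod_mono conjI)
        fix i :: 'd
        have "real_of_int (hi i - lo i + 1) \<le> real_of_int (int (nat (hi i - lo i + 1)))"
          unfolding of_int_le_iff by simp
        then show "real_of_int q / (4 * real m) \<le> real (nat (hi i - lo i + 1))"
          using len[of i] by simp
      qed (use q0 in simp)
      then show ?thesis by simp
    qed
    have e3: "s * q / 2 \<le> real (nat h)" using q(2) unfolding h_def by linarith
    show ?thesis unfolding e1
      by (rule mult_mono[OF e2 e3]) (use q0 q(2) in \<open>auto intro: prod_nonneg\<close>)
  qed
  have inj: "inj_on f S"
  proof (rule inj_onI, clarify)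
    fix r j r' j' assume S: "(r, j) \<in> S" "(r', j') \<in> S" and eq: "f (r, j) = f (r', j')"
    have "r i = r' i" for i using fun_cong[OF eq, of "Some i"] by (simp add: f_def)
    then have r: "r = r'" by blast
    have "[\<lceil>q * \<psi> (\<xi> r)\<rceil> + j = \<lceil>q * \<psi> (\<xi> r)\<rceil> + j'] (mod q)"
      using fun_cong[OF eq, of None] unfolding r by (simp add: f_def cong_def)
    then have "[j = j'] (mod q)" by (simp add: cong_add_lcancel)
    moreover have "0 \<le> j" "j < q" "0 \<le> j'" "j' < q" using S hq by (auto simp: S_def)
    ultimately show "r = r' \<and> j = j'" using r by (simp add: cong_def)
  qed
  have "f ` S \<subseteq> cell_targets \<psi> m s q z"
  proof (rule image_subsetI, clarify)
    fix r j assume S: "(r, j) \<in> S"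
    have r: "lo i \<le> r i" "r i \<le> hi i" for i
      using S PiE_mem[of r UNIV "\<lambda>i. {lo i..hi i}" i] by (auto simp: S_def)
    have j: "0 \<le> j" "j < h" using S by (auto simp: S_def)
    have b: "(z i + 1 / 4) / m \<le> r i / q" "r i / q \<le> (z i + 3 / 4) / m" for i
    proof -
      have "real_of_int q * ((z i + 1 / 4) / m) \<le> r i" using r(1)[of i] unfolding lo_def by linarith
      then show "(z i + 1 / 4) / m \<le> r i / q" using q0 by (simp add: pos_le_divide_eq mult.commute)
      have "r i \<le> real_of_int q * ((z i + 3 / 4) / m)" using r(2)[of i] unfolding hi_def by linarith
      then show "r i / q \<le> (z i + 3 / 4) / m" using q0 by (simp add: pos_divide_le_eq mult.commute)
    qed
    have res: "0 \<le> r i \<and> r i < q" for i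
    proof -
      have "0 \<le> (real (z i) + 1 / 4) / m" by simp
      then have "0 \<le> r i / real_of_int q" using b(1)[of i] by linarith
      then have 1: "0 \<le> r i" using q0 by (simp add: zero_le_divide_iff)
      have "real (z i) + 3 / 4 < real m" using z[of i] by linarith
      then have "(real (z i) + 3 / 4) / m < 1" using m by simp
      then have "r i / real_of_int q < 1" using b(2)[of i] by linarith
      then show ?thesis using 1 q0 by simp
    qed
    have "f (r, j) \<in> residues q"
      using res q0 by (auto simp: residues_iff f_def split: option.split)
    moreover have "\<bar>real_of_int (\<lceil>q * \<psi> (\<xi> r)\<rceil> + j) / q - \<psi> (\<xi> r)\<bar> \<le> s"
    proof -
      have "\<bar>real_of_int (\<lceil>q * \<psi> (\<xi> r)\<rceil> + j) - q * \<psi> (\<xi> r)\<bar> \<le> s * q"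
        using j unfolding h_def by linarith
      moreover have "real_of_int (\<lceil>q * \<psi> (\<xi> r)\<rceil> + j) / q - \<psi> (\<xi> r)
          = (real_of_int (\<lceil>q * \<psi> (\<xi> r)\<rceil> + j) - q * \<psi> (\<xi> r)) / q"
        using q0 by (simp add: field_simps)
      ultimately show ?thesis using q0 by (simp add: abs_divide pos_divide_le_eq)
    qed
    ultimately show "f (r, j) \<in> cell_targets \<psi> m s q z"
      using b unfolding cell_targets_def by (auto simp: f_def \<xi>_def intro!: exI[of _ "\<lceil>q * \<psi> (\<xi> r)\<rceil> + j"])
  qed
  then have "card (f ` S) \<le> card (cell_targets \<psi> m s q z)"
    by (intro card_mono finite_subset[OF _ finite_residues[of q]]) (auto simp: cell_targets_def)
  then have "card S \<le> card (cell_targets \<psi> m s q z)" by (simp add: card_image[OF inj])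
  then have "real (card S) \<le> real (card (cell_targets \<psi> m s q z))" by simp
  then show ?thesis using cS by simp
qed

text \<open>
  The last claim uses that the density of the surface measure is at least \<open>1\<close>.
\<close>

lemma surface_measure_facts:
  fixes \<psi> :: "real^'d::finite \<Rightarrow> real"
  assumes \<psi>: "\<psi> \<in> Ck_cube k" "k \<ge> 1"
  shows "finite_measure (surface_measure \<psi>)" "sets (surface_measure \<psi>) = sets borel"
    "AE y in surface_measure \<psi>. fst y \<in> unit_cube \<and> snd y = \<psi> (fst y)"
    "C \<in> sets borel \<Longrightarrow> C \<subseteq> unit_cube \<Longrightarrow> measure lborel C \<le> measure (surface_measure \<psi>) (C \<times> UNIV)"
proof -
  let ?L = "restrict_space lborel unit_cube :: (real^'d) measure"
  define J where "J \<xi> = sqrt (1 + (\<Sum>i\<in>UNIV. (partial_deriv i \<psi> \<xi>)\<^sup>2))" for \<xi>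
  let ?D = "density ?L (\<lambda>\<xi>. ennreal (J \<xi>))"
  have sm: "surface_measure \<psi> = distr ?D borel (\<lambda>\<xi>. (\<xi>, \<psi> \<xi>))"
    unfolding surface_measure_def J_def ..
  have cont\<psi>: "continuous_on unit_cube \<psi>" using Ck_cont[OF \<psi>(1), of "[]"] by simp
  have contJ: "continuous_on unit_cube J"
    unfolding J_def using Ck_cont[OF \<psi>(1), of "[_]"] \<psi>(2) by (intro continuous_intros) auto
  have eqL: "borel_measurable ?L = borel_measurable (restrict_space borel unit_cube)"
    by (intro measurable_cong_sets sets_restrict_space_cong) auto
  have Jm: "J \<in> borel_measurable ?L"
    unfolding eqL by (rule borel_measurable_continuous_on_restrict[OF contJ])
  have Jm': "(\<lambda>\<xi>. ennreal (J \<xi>)) \<in> borel_measurable ?L"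
    using Jm by measurable
  have gm: "(\<lambda>\<xi>. (\<xi>, \<psi> \<xi>)) \<in> borel_measurable ?L"
    unfolding eqL by (intro borel_measurable_continuous_on_restrict continuous_intros cont\<psi>)
  have "measurable ?D (borel :: ((real^'d) \<times> real) measure) = borel_measurable ?L"
    by (rule measurable_cong_sets) (rule sets_density, rule refl)
  with gm have gmD: "(\<lambda>\<xi>. (\<xi>, \<psi> \<xi>)) \<in> measurable ?D borel" by (simp only:)
  have J1: "1 \<le> J \<xi>" for \<xi> unfolding J_def by (simp add: sum_nonneg)
  show sets: "sets (surface_measure \<psi>) = sets borel" by (simp add: sm)
  obtain B where B: "\<And>\<xi>. \<xi> \<in> unit_cube \<Longrightarrow> J \<xi> \<le> B"
  proof -
    have "compact (J ` unit_cube)" by (intro compact_continuous_image contJ) auto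
    then have "bdd_above (J ` unit_cube)" by (intro bounded_imp_bdd_above compact_imp_bounded)
    then show thesis using that unfolding bdd_above_def by blast
  qed
  have emD: "emeasure ?D (space ?D) < \<infinity>"
  proof -
    have "emeasure ?D (space ?D) = (\<integral>\<^sup>+\<xi>. ennreal (J \<xi>) * indicator (space ?L) \<xi> \<partial>?L)"
      unfolding space_density by (rule emeasure_density[OF Jm' sets.top])
    also have "\<dots> \<le> (\<integral>\<^sup>+\<xi>. ennreal B \<partial>?L)"
      using B by (intro nn_integral_mono) (auto simp: space_restrict_space indicator_def intro!: ennreal_leI)
    also have "\<dots> = ennreal B * emeasure lborel (unit_cube :: (real^'d) set)"
      by (simp add: space_restrict_space emeasure_restrict_space)
    also have "\<dots> < \<infinity>"
      using emeasure_lborel_cbox_finite[of "0::real^'d" 1] by (simp add: ennreal_mult_less_top)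
    finally show ?thesis .
  qed
  then have "finite_measure ?D" by (intro finite_measureI) auto
  then show fin: "finite_measure (surface_measure \<psi>)"
    unfolding sm by (rule finite_measure.finite_measure_distr[OF _ gmD])
  have clg: "closed {y :: (real^'d) \<times> real. fst y \<in> unit_cube \<and> snd y = \<psi> (fst y)}"
  proof -
    have "compact ((\<lambda>\<xi>. (\<xi>, \<psi> \<xi>)) ` unit_cube)"
      by (intro compact_continuous_image continuous_intros cont\<psi>) auto
    moreover have "(\<lambda>\<xi>. (\<xi>, \<psi> \<xi>)) ` unit_cube = {y. fst y \<in> unit_cube \<and> snd y = \<psi> (fst y)}"
      by (auto simp: image_iff)
    ultimately show ?thesis by (simp add: compact_imp_closed)
  qed
  show "AE y in surface_measure \<psi>. fst y \<in> unit_cube \<and> snd y = \<psi> (fst y)"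
    unfolding sm
  proof (subst AE_distr_iff[OF gmD])
    show "{x \<in> space borel. fst x \<in> unit_cube \<and> snd x = \<psi> (fst x)} \<in> sets borel"
      using borel_closed[OF clg] by simp
    show "AE \<xi> in ?D. fst (\<xi>, \<psi> \<xi>) \<in> unit_cube \<and> snd (\<xi>, \<psi> \<xi>) = \<psi> (fst (\<xi>, \<psi> \<xi>))"
      by (rule AE_I2) (simp add: space_restrict_space)
  qed
  assume C: "C \<in> sets borel" "C \<subseteq> unit_cube"
  interpret S: finite_measure "surface_measure \<psi>" by (rule fin)
  have CU: "C \<times> (UNIV :: real set) \<in> sets borel"
  proof -
    have "C \<times> (UNIV :: real set) \<in> sets (borel \<Otimes>\<^sub>M borel)"
      by (rule pair_measureI[OF C(1)]) simp
    then show ?thesis unfolding borel_prod .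
  qed
  have CL: "C \<in> sets ?L" using C by (simp add: sets_restrict_space_iff)
  have "emeasure lborel C = (\<integral>\<^sup>+\<xi>. indicator C \<xi> \<partial>?L)"
    using C CL by (simp add: emeasure_restrict_space)
  also have "\<dots> \<le> (\<integral>\<^sup>+\<xi>. ennreal (J \<xi>) * indicator C \<xi> \<partial>?L)"
    using J1 by (intro nn_integral_mono) (auto simp: indicator_def)
  also have "\<dots> = emeasure ?D C" by (rule emeasure_density[OF Jm' CL, symmetric])
  also have "\<dots> = emeasure ?D ((\<lambda>\<xi>. (\<xi>, \<psi> \<xi>)) -` (C \<times> UNIV) \<inter> space ?D)"
    using C by (intro arg_cong[where f = "emeasure ?D"]) (auto simp: space_restrict_space)
  also have "\<dots> = emeasure (surface_measure \<psi>) (C \<times> UNIV)"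
    unfolding sm by (rule emeasure_distr[OF gmD CU, symmetric])
  finally have "emeasure lborel C \<le> emeasure (surface_measure \<psi>) (C \<times> UNIV)" .
  then show "measure lborel C \<le> measure (surface_measure \<psi>) (C \<times> UNIV)"
    unfolding measure_def by (intro enn2real_mono less_top[THEN iffD1, OF S.emeasure_finite])
qed

section \<open>Choice of parameters\<close>

text \<open>
  The probability of a bad choice is, up to constants, a power of \<open>A\<close> with exponent
  \<open>(M + t + 1) n - t p\<close>: the net contributes the first summand, and each of the \<open>p\<close> differences
  contributes \<open>A\<^sup>M \<tau> = A\<^sup>-\<^sup>t\<close>. With \<open>M = t\<^sup>2\<close> and \<open>p = 4 n t\<close> it is negative.
\<close>

lemma bad_count_negligible:
  fixes n t M p :: nat
  assumes n: "n \<ge> 1" and t: "t \<ge> 3" and M: "M = t\<^sup>2" and p: "p = 4 * n * t"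
  shows "\<exists>A0\<ge>1. \<forall>A\<ge>A0. 2 * ((2 * (8 * real n * M * (M + 2) * A ^ (M + t + 1)) + 1) ^ n *
    (n * (2 ^ M * ((16 * (real M + 2) * A + 1) ^ (M * p) * (14 * n / A ^ (M + t)) ^ p)))) \<le> 1"
proof -
  define c1 where "c1 = 17 * (real M + 2)"
  define c2 where "c2 = 17 * real n * M * (M + 2)"
  define C where "C = 2 * (c2 ^ n * (n * (2 ^ M * (c1 ^ (M * p) * (14 * real n) ^ p))))"
  have M1: "M \<ge> 1" using t M by simp
  have e: "(M + t + 1) * n + M * p + 1 \<le> (M + t) * p"
  proof -
    have "(M + t + 1) * n + 1 \<le> t * p"
    proof -
      have "3 * t \<le> t * t" using t by simp
      then have "M + t + 2 \<le> 4 * (t * t)" unfolding M power2_eq_square using t by linarith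
      then have "(M + t + 2) * n \<le> 4 * (t * t) * n" by (rule mult_le_mono1)
      moreover have "t * p = 4 * (t * t) * n" by (simp add: p)
      moreover have "(M + t + 1) * n + 1 \<le> (M + t + 2) * n" using n by simp
      ultimately show ?thesis by linarith
    qed
    then show ?thesis by (simp add: add_mult_distrib)
  qed
  show ?thesis
  proof (intro exI[of _ "max 1 C"] conjI allI impI)
    fix A :: real assume "max 1 C \<le> A"
    then have A: "A \<ge> 1" "C \<le> A" by auto
    have a1: "1 \<le> A ^ (M + t + 1)" using A by (intro one_le_power)
    have c2': "1 \<le> real n * M * (M + 2)"
    proof -
      have "0 < n * M * (M + 2)" by (intro mult_pos_pos) (use n M1 in auto)
      then have "1 \<le> n * M * (M + 2)" by linarith
      then have "real 1 \<le> real (n * M * (M + 2))" unfolding of_nat_le_iff .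
      then show ?thesis by (simp only: of_nat_mult of_nat_add of_nat_1 of_nat_numeral)
    qed
    have b2: "2 * (8 * real n * M * (M + 2) * A ^ (M + t + 1)) + 1 \<le> c2 * A ^ (M + t + 1)"
    proof -
      have "1 * 1 \<le> (real n * M * (M + 2)) * A ^ (M + t + 1)"
        using a1 c2' by (intro mult_mono) auto
      then show ?thesis unfolding c2_def by (simp add: algebra_simps)
    qed
    have b1: "16 * (real M + 2) * A + 1 \<le> c1 * A"
    proof -
      have "1 * 1 \<le> (real M + 2) * A" using A by (intro mult_mono) auto
      then show ?thesis unfolding c1_def by (simp add: algebra_simps)
    qed
    have "2 * ((2 * (8 * real n * M * (M + 2) * A ^ (M + t + 1)) + 1) ^ n *
      (n * (2 ^ M * ((16 * (real M + 2) * A + 1) ^ (M * p) * (14 * n / A ^ (M + t)) ^ p))))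
      \<le> 2 * ((c2 * A ^ (M + t + 1)) ^ n * (n * (2 ^ M * ((c1 * A) ^ (M * p) * (14 * n / A ^ (M + t)) ^ p))))"
      using A a1 by (intro mult_left_mono mult_mono power_mono b1 b2) (auto simp: c1_def c2_def)
    also have "\<dots> = C * A ^ ((M + t + 1) * n + M * p) / A ^ ((M + t) * p)"
      unfolding C_def power_mult_distrib power_divide power_add[of A "(M + t + 1) * n"] power_mult[symmetric]
      by (simp add: mult_ac)
    also have "\<dots> \<le> A * A ^ ((M + t + 1) * n + M * p) / A ^ ((M + t) * p)"
      using A by (intro divide_right_mono mult_right_mono) auto
    also have "\<dots> = A ^ ((M + t + 1) * n + M * p + 1) / A ^ ((M + t) * p)" by simp
    also have "\<dots> \<le> 1"
      using power_increasing[OF e, of A] A by simp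
    finally show "2 * ((2 * (8 * real n * M * (M + 2) * A ^ (M + t + 1)) + 1) ^ n *
      (n * (2 ^ M * ((16 * (real M + 2) * A + 1) ^ (M * p) * (14 * n / A ^ (M + t)) ^ p)))) \<le> 1" .
  qed simp
qed

lemma gaussian_tail_negligible:
  fixes c :: real
  assumes "c \<ge> 0"
  shows "\<exists>A0\<ge>1. \<forall>A\<ge>A0. (4 * c * A + 1) ^ j * exp (- A\<^sup>2) \<le> 1"
proof -
  let ?D = "(4 * c + 1) ^ j"
  have "((\<lambda>x::real. ?D * (x ^ j / exp x)) \<longlongrightarrow> ?D * 0) at_top"
    by (intro tendsto_intros tendsto_power_div_exp_0)
  then have "\<forall>\<^sub>F x in at_top. ?D * (x ^ j / exp x) < 1"
    by (rule order_tendstoD(2)) simp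
  then obtain A0 where A0: "\<And>x. x \<ge> A0 \<Longrightarrow> ?D * (x ^ j / exp x) < 1"
    unfolding eventually_at_top_linorder by blast
  show ?thesis
  proof (intro exI[of _ "max 1 A0"] conjI allI impI)
    fix A assume "max 1 A0 \<le> A"
    then have A: "A \<ge> 1" "A \<ge> A0" by auto
    have "A * 1 \<le> A * A" using A by (intro mult_left_mono) auto
    then have e: "exp (- A\<^sup>2) \<le> exp (- A)" by (simp add: power2_eq_square)
    have "4 * c * A + 1 \<le> (4 * c + 1) * A" using A by (simp add: algebra_simps)
    then have "(4 * c * A + 1) ^ j * exp (- A\<^sup>2) \<le> ((4 * c + 1) * A) ^ j * exp (- A)"
      using e A assms by (intro mult_mono power_mono) auto
    also have "\<dots> = ?D * (A ^ j / exp A)" by (simp add: power_mult_distrib exp_minus divide_inverse mult.assoc)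
    also have "\<dots> \<le> 1" using A0[OF A(2)] by simp
    finally show "(4 * c * A + 1) ^ j * exp (- A\<^sup>2) \<le> 1" .
  qed simp
qed

text \<open>
  With \<open>A = Z\<^sup>d\<^sup>+\<^sup>k\<close> and \<open>R = A\<^sup>M\<^sup>+\<^sup>t\<^sup>+\<^sup>1\<close>, the claimed gain is \<open>Z\<close> to the power \<open>d (M + t + 1)\<close>, against \<open>d (M - 2)\<close>
  for the number of cells. The discrepancy and the losses from planks are powers of \<open>A\<close> with exponent
  linear in \<open>t\<close>, and \<open>R powr (- \<delta>)\<close> is a power with exponent of order \<open>\<delta> t\<^sup>2\<close>.
\<close>

lemma gain_beats_losses:
  fixes d k t M b :: nat and \<delta> C1 C6 c :: real
  assumes dk: "d \<ge> 1" and M: "M \<ge> 2" and C: "C1 \<ge> 0" "C6 > 0" and c: "c \<ge> 0"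
    and \<delta>: "real (d * (t + 3) + 2 * b + 1) \<le> \<delta> * (M + t + 1)"
  shows "\<exists>Z0\<ge>1. \<forall>Z\<ge>Z0. real ((Z ^ (d + k)) ^ (M + t + 1)) powr (d / (d + k)) * real ((Z ^ (d + k)) ^ (M + t + 1)) powr (- \<delta>) *
      (C1 * ((c * real (Z ^ (d + k)) + 1) ^ b + 1)\<^sup>2) \<le> C6 * real Z ^ (d * (M - 2))"
proof -
  define D where "D = C1 * 4 * (c + 1) ^ (2 * b)"
  define Z0 where "Z0 = nat \<lceil>D / C6\<rceil> + 1"
  show ?thesis
  proof (intro exI[of _ Z0] conjI allI impI)
    show "1 \<le> Z0" by (simp add: Z0_def)
    fix Z :: nat assume Z: "Z0 \<le> Z"
    then have Z1: "Z \<ge> 1" by (simp add: Z0_def)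
    define A where "A = real (Z ^ (d + k))"
    have "real Z \<ge> D / C6" using Z unfolding Z0_def by linarith
    have ZA: "real Z \<le> A"
    proof -
      have "Z ^ 1 \<le> Z ^ (d + k)" using Z1 dk by (intro power_increasing) auto
      then show ?thesis unfolding A_def by simp
    qed
    have A1: "A \<ge> 1" using ZA Z1 by linarith
    have DA: "D \<le> C6 * A"
    proof -
      have "D / C6 \<le> A" using \<open>real Z \<ge> D / C6\<close> ZA by linarith
      then show ?thesis using C by (simp add: divide_le_eq mult.commute)
    qed
    have R: "real ((Z ^ (d + k)) ^ (M + t + 1)) = A ^ (M + t + 1)" by (simp add: A_def)
    have R1: "(A ^ (M + t + 1)) powr (d / (d + k)) = real Z ^ (d * (M + t + 1))"
    proof -
      have "A ^ (M + t + 1) = real Z powr (real ((d + k) * (M + t + 1)))"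
        using Z1 by (subst powr_realpow) (simp, simp only: A_def of_nat_power power_mult)
      then have "(A ^ (M + t + 1)) powr (d / (d + k)) = real Z powr (real ((d + k) * (M + t + 1)) * (d / (d + k)))"
        by (simp only: powr_powr)
      also have "real ((d + k) * (M + t + 1)) * (d / (d + k)) = real (d * (M + t + 1))"
        using dk by (simp add: field_simps)
      also have "real Z powr real (d * (M + t + 1)) = real Z ^ (d * (M + t + 1))"
        using Z1 by (intro powr_realpow) simp
      finally show ?thesis .
    qed
    have R2: "(A ^ (M + t + 1)) powr (- \<delta>) \<le> 1 / A ^ (d * (t + 3) + 2 * b + 1)"
    proof -
      have "(A ^ (M + t + 1)) powr (- \<delta>) = A powr (- (\<delta> * (M + t + 1)))"
        using A1 by (simp only: powr_realpow[symmetric] powr_powr) (simp add: mult.commute)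
      also have "\<dots> \<le> A powr (- real (d * (t + 3) + 2 * b + 1))"
        using A1 \<delta> by (intro powr_mono) auto
      also have "\<dots> = 1 / A ^ (d * (t + 3) + 2 * b + 1)"
        using A1 by (simp only: powr_minus_divide powr_realpow)
      finally show ?thesis .
    qed
    have Kb: "((c * A + 1) ^ b + 1)\<^sup>2 \<le> 4 * ((c + 1) ^ (2 * b) * A ^ (2 * b))"
    proof -
      have "c * A + 1 \<le> (c + 1) * A" using A1 by (simp add: algebra_simps)
      then have "(c * A + 1) ^ b \<le> ((c + 1) * A) ^ b" using c A1 by (intro power_mono) auto
      moreover have "1 \<le> ((c + 1) * A) ^ b"
      proof (rule one_le_power)
        have "1 * 1 \<le> (c + 1) * A" using c A1 by (intro mult_mono) auto
        then show "1 \<le> (c + 1) * A" by simp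
      qed
      ultimately have "(c * A + 1) ^ b + 1 \<le> 2 * ((c + 1) * A) ^ b" by linarith
      then have "((c * A + 1) ^ b + 1)\<^sup>2 \<le> (2 * ((c + 1) * A) ^ b)\<^sup>2"
        using c A1 by (intro power_mono) auto
      also have "\<dots> = 4 * ((c + 1) ^ (2 * b) * A ^ (2 * b))"
        by (simp add: power_mult_distrib power_mult[symmetric] mult.commute)
      finally show ?thesis .
    qed
    have Zd: "real Z ^ (d * (M + t + 1)) \<le> real Z ^ (d * (M - 2)) * A ^ (d * (t + 3))"
    proof -
      have "d * (M + t + 1) = d * (M - 2) + d * (t + 3)"
        using M by (simp add: distrib_left[symmetric])
      then have "real Z ^ (d * (M + t + 1)) = real Z ^ (d * (M - 2)) * real Z ^ (d * (t + 3))"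
        by (simp add: power_add)
      also have "\<dots> \<le> real Z ^ (d * (M - 2)) * A ^ (d * (t + 3))"
        using ZA by (intro mult_left_mono power_mono) auto
      finally show ?thesis .
    qed
    have "(A ^ (M + t + 1)) powr (d / (d + k)) * (A ^ (M + t + 1)) powr (- \<delta>) * (C1 * ((c * A + 1) ^ b + 1)\<^sup>2)
      \<le> (real Z ^ (d * (M - 2)) * A ^ (d * (t + 3))) * (1 / A ^ (d * (t + 3) + 2 * b + 1)) *
          (C1 * (4 * ((c + 1) ^ (2 * b) * A ^ (2 * b))))"
      unfolding R1 using C A1 c by (intro mult_mono mult_left_mono Zd R2 Kb) auto
    also have "\<dots> = real Z ^ (d * (M - 2)) * (D / A)"
      using A1 by (simp add: D_def power_add field_simps)
    also have "\<dots> \<le> real Z ^ (d * (M - 2)) * C6"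
      using A1 DA by (intro mult_left_mono) (auto simp: divide_le_eq)
    finally show "real ((Z ^ (d + k)) ^ (M + t + 1)) powr (d / (d + k)) * real ((Z ^ (d + k)) ^ (M + t + 1)) powr (- \<delta>) *
      (C1 * ((c * real (Z ^ (d + k)) + 1) ^ b + 1)\<^sup>2) \<le> C6 * real Z ^ (d * (M - 2))"
      unfolding R A_def[symmetric] by (simp add: mult.commute)
  qed
qed

text \<open>
  A coefficient vector whose residue is a target is lifted to a point near the graph by
  adding integers, which are bounded because the coefficients and \<open>\<psi>\<close> are.
\<close>

lemma cell_target_point:
  fixes \<psi> :: "real^'d::finite \<Rightarrow> real"
  assumes g: "g \<in> gens M q" and q: "q > 0" and A: "A \<ge> 1" and M: "M > 0"
    and a: "a \<in> lead_one M A" and T: "comb_mod M q a g \<in> cell_targets \<psi> m s q z"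
    and s: "s \<le> 1" and B: "\<And>x. x \<in> unit_cube \<Longrightarrow> \<bar>\<psi> x\<bar> \<le> real_of_int B" and L: "L \<ge> int M * A + B + 1"
    and m: "m > 0" and z: "\<And>i. z i < m" and B0: "B \<ge> 0"
  shows "\<exists>x\<in>gen_box M L. (\<forall>i. (z i + 1 / 4) / m \<le> fst (gen_point M q g x) $ i \<and>
      fst (gen_point M q g x) $ i \<le> (z i + 3 / 4) / m) \<and>
    fst (gen_point M q g x) \<in> unit_cube \<and>
    \<bar>snd (gen_point M q g x) - \<psi> (fst (gen_point M q g x))\<bar> \<le> s"
proof -
  let ?r = "comb_mod M q a g"
  obtain Y where b: "\<And>i. (z i + 1 / 4) / m \<le> ?r (Some i) / q" "\<And>i. ?r (Some i) / q \<le> (z i + 3 / 4) / m"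
    and Y: "Y mod q = ?r None" "\<bar>real_of_int Y / q - \<psi> (\<chi> i. ?r (Some i) / q)\<bar> \<le> s"
    using T unfolding cell_targets_def by blast
  define e where "e \<kappa> = (case \<kappa> of Some i \<Rightarrow> - (comb M a g (Some i) div q) | None \<Rightarrow> Y div q - comb M a g None div q)" for \<kappa>
  define x where "x = (a, e)"
  have ai: "1 \<le> a i" "a i \<le> A" if "i < M" for i
    using a that PiE_mem[of a "{..<M}" "\<lambda>i. if i = 0 then {1} else {1..A}" i] A
    by (auto simp: lead_one_def split: if_splits)
  have gi: "0 \<le> g (i, \<kappa>)" "g (i, \<kappa>) \<le> q" if "i < M" for i \<kappa>
    using PiE_mem[OF g[unfolded gens_def], of "(i, \<kappa>)"] that by auto
  have c0: "0 \<le> comb M a g \<kappa>" for \<kappa>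
    unfolding comb_def using ai gi by (intro sum_nonneg mult_nonneg_nonneg) (auto intro: order_trans[of 0 1])
  have c1: "comb M a g \<kappa> \<le> int M * A * q" for \<kappa>
  proof -
    have "comb M a g \<kappa> \<le> (\<Sum>i<M. A * q)"
      unfolding comb_def using ai gi A by (intro sum_mono mult_mono) auto
    then show ?thesis by (simp add: mult.assoc)
  qed
  have cd: "0 \<le> comb M a g \<kappa> div q" "comb M a g \<kappa> div q \<le> int M * A" for \<kappa>
  proof -
    show "0 \<le> comb M a g \<kappa> div q" using c0 q by (simp add: pos_imp_zdiv_nonneg_iff)
    have "comb M a g \<kappa> div q \<le> (int M * A * q) div q" using c1 q by (rule zdiv_mono1)
    then show "comb M a g \<kappa> div q \<le> int M * A" using q by simp
  qed
  have p1: "fst (gen_point M q g x) = (\<chi> i. ?r (Some i) / q)"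
  proof -
    have "real_of_int (comb M a g \<kappa>) / q - real_of_int (comb M a g \<kappa> div q) = real_of_int (comb M a g \<kappa> mod q) / q" for \<kappa>
    proof -
      have e: "real_of_int q * real_of_int (comb M a g \<kappa> div q) + real_of_int (comb M a g \<kappa> mod q) = comb M a g \<kappa>"
        unfolding of_int_mult[symmetric] of_int_add[symmetric] by simp
      have "real_of_int (comb M a g \<kappa>) / q - real_of_int (comb M a g \<kappa> div q)
          = (real_of_int (comb M a g \<kappa>) - real_of_int q * real_of_int (comb M a g \<kappa> div q)) / q"
        using q by (simp add: diff_divide_distrib)
      also have "real_of_int (comb M a g \<kappa>) - real_of_int q * real_of_int (comb M a g \<kappa> div q) = real_of_int (comb M a g \<kappa> mod q)"
        using e by linarith
      finally show ?thesis .
    qed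
    then show ?thesis by (simp add: gen_point_def x_def e_def comb_mod_def)
  qed
  have p2: "snd (gen_point M q g x) = real_of_int Y / q"
  proof -
    have "comb M a g None = q * (comb M a g None div q) + Y mod q" using Y(1) by (simp add: comb_mod_def)
    then have "comb M a g None + q * (Y div q - comb M a g None div q) = Y"
      unfolding right_diff_distrib using mult_div_mod_eq[of q Y] by linarith
    then have "real_of_int (comb M a g None + q * (Y div q - comb M a g None div q)) = real_of_int Y" by (simp only:)
    then show ?thesis using q by (simp add: gen_point_def x_def e_def field_simps)
  qed
  have cube: "fst (gen_point M q g x) \<in> unit_cube"
  proof -
    have "0 \<le> ?r (Some i) / real_of_int q \<and> ?r (Some i) / real_of_int q \<le> 1" for i
    proof -
      have "0 \<le> (real (z i) + 1 / 4) / m" by simp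
      moreover have "(real (z i) + 3 / 4) / m \<le> 1" using z[of i] m by (simp add: divide_le_eq) 
      ultimately show ?thesis using b[of i] by linarith
    qed
    then show ?thesis unfolding p1 by (simp add: mem_box_cart)
  qed
  have "\<bar>e \<kappa>\<bar> \<le> L" for \<kappa>
  proof (cases \<kappa>)
    case (Some i)
    then show ?thesis using cd[of "Some i"] L B0 by (simp add: e_def)
  next
    case None
    have "\<bar>real_of_int Y / q\<bar> \<le> B + 1"
      using Y(2) B[OF cube] s unfolding p1 by linarith
    then have "\<bar>Y div q\<bar> \<le> B + 1"
      unfolding floor_divide_of_int_eq[symmetric, where ?'a = real] by linarith
    then show ?thesis using None cd[of None] L B0 by (simp add: e_def)
  qed
  moreover have "\<bar>a i\<bar> \<le> L" if "i < M" for i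
  proof -
    have "1 * A \<le> int M * A" using M A by (intro mult_right_mono) auto
    then show ?thesis using ai[OF that] L B0 by linarith
  qed
  ultimately have "(restrict a {..<M}, e) \<in> gen_box M L" by (intro gen_boxI) auto
  moreover have "restrict a {..<M} = a"
    using a by (auto simp: lead_one_def PiE_def extensional_restrict)
  ultimately have "x \<in> gen_box M L" by (simp add: x_def)
  then show ?thesis
    using b cube Y(2) p1 p2 by (intro bexI[of _ x]) auto
qed

section \<open>The perturbed surface\<close>

text \<open>
  The inequality with factor \<open>\<Gamma>\<close> at scale \<open>R\<close>, together with the conditions excluding degenerate
  \<open>f\<close> and \<open>w\<close>.
\<close>

definition violates :: "real \<Rightarrow> (real^'d::finite \<Rightarrow> real) \<Rightarrow> real \<Rightarrow> bool" where
  "violates \<Gamma> \<psi> R \<longleftrightarrow> (\<exists>f w. f \<in> L2_space (surface_measure \<psi>) \<and>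
     \<not> (AE y in surface_measure \<psi>. f y = 0) \<and>
     weight_on_ball R w \<and> \<not> (AE x in lborel. w x = 0) \<and> Xray_norm w < \<infinity> \<and>
     L2_norm_sq (density lborel (\<lambda>x. ennreal (w x))) (extension_op \<psi> f)
       \<ge> ennreal \<Gamma> * Xray_norm w * L2_norm_sq (surface_measure \<psi>) f)"

lemma cell_unique:
  fixes a a' :: real and z z' m :: nat
  assumes m: "m > 0" and a: "(z + 1 / 4) / m \<le> a" "a \<le> (z + 3 / 4) / m"
    and a': "(z' + 1 / 4) / m \<le> a'" "a' \<le> (z' + 3 / 4) / m" and c: "\<bar>a - a'\<bar> < 1 / (2 * real m)"
  shows "z = z'"
proof -
  have *: False if "z < z'" "(z' + 1 / 4) / m \<le> a'" "a \<le> (z + 3 / 4) / m" "\<bar>a - a'\<bar> < 1 / (2 * real m)"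
    for z z' :: nat and a a' :: real
  proof -
    have "1 / (2 * real m) \<le> (real z' + 1 / 4) / m - (real z + 3 / 4) / m"
    proof -
      have "1 / 2 \<le> (real z' + 1 / 4) - (real z + 3 / 4)" using that(1) by linarith
      then have "(1 / 2) / m \<le> ((real z' + 1 / 4) - (real z + 3 / 4)) / m"
        by (intro divide_right_mono) auto
      moreover have "1 / (2 * real m) = (1 / 2) / m" by simp
      ultimately show ?thesis by (simp only: diff_divide_distrib)
    qed
    then show False using that by linarith
  qed
  show ?thesis
    using *[of z z' a' a] *[of z' z a a'] a a' c by (cases z z' rule: linorder_cases) (auto simp: abs_minus_commute)
qed

text \<open>
  The points lie in the middle halves of distinct cells, so bumps of width a quarter of a cell around
  them do not overlap.
\<close>

lemma perturbed_surface:
  fixes \<psi> :: "real^'d::finite \<Rightarrow> real" and pt :: "('d \<Rightarrow> nat) \<Rightarrow> (real^'d) \<times> real" and m :: nat and C s :: real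
  assumes C: "\<And>(Z :: (real^'d) set) h \<rho> s. finite Z \<Longrightarrow> 0 < \<rho> \<Longrightarrow> \<rho> \<le> 1 \<Longrightarrow> 0 \<le> s \<Longrightarrow>
      (\<forall>z\<in>Z. \<bar>h z\<bar> \<le> s) \<Longrightarrow>
      (\<forall>z\<in>Z. \<forall>z'\<in>Z. \<forall>x. (\<forall>i. \<bar>x $ i - z $ i\<bar> < \<rho>) \<longrightarrow> (\<forall>i. \<bar>x $ i - z' $ i\<bar> < \<rho>) \<longrightarrow> z = z') \<Longrightarrow>
      \<exists>\<phi>\<in>Ck_cube k. Ck_dist k \<psi> \<phi> \<le> C * s / \<rho> ^ k \<and> (\<forall>z\<in>Z. z \<in> unit_cube \<longrightarrow> \<phi> z = \<psi> z + h z)"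
    and m: "m > 0" and s: "s \<ge> 0" and GZ: "finite GZ"
    and pt: "\<And>z i. z \<in> GZ \<Longrightarrow> (z i + 1 / 4) / m \<le> fst (pt z) $ i"
      "\<And>z i. z \<in> GZ \<Longrightarrow> fst (pt z) $ i \<le> (z i + 3 / 4) / m"
      "\<And>z. z \<in> GZ \<Longrightarrow> fst (pt z) \<in> unit_cube"
      "\<And>z. z \<in> GZ \<Longrightarrow> \<bar>snd (pt z) - \<psi> (fst (pt z))\<bar> \<le> s"
  shows "\<exists>\<phi>\<in>Ck_cube k. Ck_dist k \<psi> \<phi> \<le> C * s * (4 * m) ^ k \<and> (\<forall>z\<in>GZ. \<phi> (fst (pt z)) = snd (pt z))"
proof -
  define \<rho> where "\<rho> = 1 / (4 * real m)"
  have \<rho>: "0 < \<rho>" "\<rho> \<le> 1" using m by (auto simp: \<rho>_def divide_le_eq)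
  have uniq: "z = z'" if "z \<in> GZ" "z' \<in> GZ" "\<And>i. \<bar>x $ i - fst (pt z) $ i\<bar> < \<rho>" "\<And>i. \<bar>x $ i - fst (pt z') $ i\<bar> < \<rho>"
    for z z' x
  proof
    fix i
    have "\<bar>fst (pt z) $ i - fst (pt z') $ i\<bar> < 2 * \<rho>" using that(3)[of i] that(4)[of i] by linarith
    then have "\<bar>fst (pt z) $ i - fst (pt z') $ i\<bar> < 1 / (2 * real m)" by (simp add: \<rho>_def)
    then show "z i = z' i"
      by (rule cell_unique[OF m pt(1,2)[OF that(1)] pt(1,2)[OF that(2)]])
  qed
  let ?f = "\<lambda>z. fst (pt z)"
  have inj: "inj_on ?f GZ"
  proof (rule inj_onI)
    fix z z' assume z: "z \<in> GZ" "z' \<in> GZ" "fst (pt z) = fst (pt z')"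
    show "z = z'" by (rule uniq[OF z(1,2), of "fst (pt z)"]) (use z \<rho> in auto)
  qed
  define h where "h \<xi> = snd (pt (inv_into GZ ?f \<xi>)) - \<psi> \<xi>" for \<xi>
  have h: "h (fst (pt z)) = snd (pt z) - \<psi> (fst (pt z))" if "z \<in> GZ" for z
    using inv_into_f_f[OF inj that] by (simp add: h_def)
  have "\<exists>\<phi>\<in>Ck_cube k. Ck_dist k \<psi> \<phi> \<le> C * s / \<rho> ^ k \<and> (\<forall>z\<in>?f ` GZ. z \<in> unit_cube \<longrightarrow> \<phi> z = \<psi> z + h z)"
  proof (rule C)
    show "\<forall>z\<in>?f ` GZ. \<bar>h z\<bar> \<le> s" using h pt(4) by auto
    show "\<forall>z\<in>?f ` GZ. \<forall>z'\<in>?f ` GZ. \<forall>x. (\<forall>i. \<bar>x $ i - z $ i\<bar> < \<rho>) \<longrightarrow> (\<forall>i. \<bar>x $ i - z' $ i\<bar> < \<rho>) \<longrightarrow> z = z'"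
      using uniq by blast
  qed (use GZ \<rho> s in auto)
  moreover have "C * s / \<rho> ^ k = C * s * (4 * m) ^ k" by (simp add: \<rho>_def power_divide)
  ultimately obtain \<phi> where "\<phi> \<in> Ck_cube k" "Ck_dist k \<psi> \<phi> \<le> C * s * (4 * m) ^ k"
    "\<forall>z\<in>?f ` GZ. z \<in> unit_cube \<longrightarrow> \<phi> z = \<psi> z + h z" by auto
  then show ?thesis using pt(3) h by (intro bexI[of _ \<phi>]) auto
qed

text \<open>
  The function \<open>f\<close> is the indicator of caps of radius comparable to \<open>1 / R\<close> around the points where the
  surface meets the progression. All estimates have room for replacing \<open>\<phi>\<close> by a function within
  \<open>1 / (12 R)\<close> of it, which is what makes the set of violating surfaces contain an open set.
\<close>

lemma inequality_near:
  fixes \<phi> \<psi> :: "real^'d::finite \<Rightarrow> real" and x :: "('d \<Rightarrow> nat) \<Rightarrow> (nat \<Rightarrow> int) \<times> ('d option \<Rightarrow> int)"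
    and R \<tau> B1 r \<Gamma> :: real and m :: nat
  assumes \<phi>: "\<phi> \<in> Ck_cube k" "k \<ge> 1" and \<psi>: "\<psi> \<in> Ck_cube k"
    and B1: "\<And>i x. x \<in> unit_cube \<Longrightarrow> \<bar>iter_partial [i] \<phi> x\<bar> \<le> B1" "B1 \<ge> 0"
    and close: "\<And>x. x \<in> unit_cube \<Longrightarrow> \<bar>\<psi> x - \<phi> x\<bar> \<le> 1 / (12 * R)"
    and R: "R \<ge> 1" "R \<ge> m" and m: "m > 0"
    and GZ: "finite GZ" "GZ \<noteq> {}" "\<And>z i. z \<in> GZ \<Longrightarrow> z i < m"
    and xb: "\<And>z. z \<in> GZ \<Longrightarrow> x z \<in> gen_box M L"
    and pt: "\<And>z i. z \<in> GZ \<Longrightarrow> (z i + 1 / 4) / m \<le> fst (gen_point M q g (x z)) $ i"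
      "\<And>z i. z \<in> GZ \<Longrightarrow> fst (gen_point M q g (x z)) $ i \<le> (z i + 3 / 4) / m"
      "\<And>z. z \<in> GZ \<Longrightarrow> \<phi> (fst (gen_point M q g (x z))) = snd (gen_point M q g (x z))"
    and g: "g \<in> gens M q" "g \<notin> bad_gens M q p (8 * L) Q (3 * \<tau> * Q * q)"
    and q: "q > 0" and L: "L \<ge> 0" and \<tau>: "\<tau> > 0"
    and Q: "Q \<ge> 2 * int CARD('d option)" "real CARD('d option) * M * real_of_int (8 * L) \<le> \<tau> * Q"
    and tail: "(4 * real_of_int L + 1) ^ (M + CARD('d option)) * exp (- (R * \<tau>)\<^sup>2) \<le> 1"
    and r: "r = 1 / (12 * CARD('d) * (1 + B1))" and \<Gamma>: "\<Gamma> \<ge> 0"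
    and final: "\<Gamma> * (16 * (exp (1 / 2) * sqrt (2 * pi))\<^sup>2 * 2 ^ CARD('d) * (2 * (real CARD('d) + 1)) ^ (2 * (CARD('d) + 1))
        * ((8 * real_of_int L + 1) ^ (CARD('d option) + p) + 1)\<^sup>2)
      \<le> card GZ * (2 * r) ^ CARD('d) * (1 / 2 ^ (M + CARD('d option)))\<^sup>2"
  shows "violates \<Gamma> \<psi> R"
proof -
  let ?d = "CARD('d)" and ?n = "CARD('d option)"
  let ?P = "gen_point M q g"
  \<comment> \<open>Moving each horizontal coordinate by \<open>r0\<close> moves a point of the graph of \<open>\<phi>\<close> by at most
     \<open>(1 + B1) d r0 = 1 / (12 R)\<close>. The distance of \<open>\<psi>\<close> to \<open>\<phi>\<close> adds another \<open>1 / (12 R)\<close>.\<close>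
  define r0 where "r0 = r / R"
  have d1: "real ?d \<ge> 1" using zero_less_card_finite[where 'a = 'd] by linarith
  have r_pos: "r > 0" unfolding r using d1 B1(2) by simp
  have r0: "r0 > 0" using r_pos R by (simp add: r0_def)
  have r12: "(1 + B1) * (?d * r0) = 1 / (12 * R)"
  proof -
    have "b * (D * (1 / (12 * D * b) / R)) = 1 / (12 * R)" if "b > 0" "D > 0" for b D :: real
      using that R by (simp add: field_simps)
    then show ?thesis unfolding r0_def r using d1 B1(2) by simp
  qed
  have r0m: "r0 \<le> 1 / (12 * real m)"
  proof -
    have "1 * 1 \<le> real ?d * (1 + B1)" using d1 B1(2) by (intro mult_mono) auto
    then have "r \<le> 1 / 12" unfolding r using d1 B1(2) by (simp add: divide_le_eq)
    then have "r0 \<le> (1 / 12) / R" unfolding r0_def using R by (intro divide_right_mono) auto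
    also have "\<dots> \<le> (1 / 12) / m" using R m by (intro divide_left_mono) auto
    finally show ?thesis by simp
  qed
  define \<xi> where "\<xi> z = fst (?P (x z))" for z
  have cell: "(z i + 1 / 4) / m \<le> \<xi> z $ i" "\<xi> z $ i \<le> (z i + 3 / 4) / m" if "z \<in> GZ" for z i
    using pt(1,2)[OF that] by (simp_all add: \<xi>_def)
  define cap where "cap z = cbox (\<xi> z - vec r0) (\<xi> z + vec r0)" for z
  have cap: "y \<in> cap z \<longleftrightarrow> (\<forall>i. \<bar>y $ i - \<xi> z $ i\<bar> \<le> r0)" for y z
    by (auto simp: cap_def mem_box_cart abs_le_iff algebra_simps)
  define C where "C = (\<Union>z\<in>GZ. cap z)"
  have capcube: "cap z \<subseteq> unit_cube" if z: "z \<in> GZ" for z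
  proof
    fix y assume y: "y \<in> cap z"
    have "0 \<le> y $ i \<and> y $ i \<le> 1" for i
    proof -
      have gen: "0 \<le> ya \<and> ya \<le> 1"
        if "\<bar>ya - yb\<bar> \<le> e" "e \<le> b" "lo = a + b" "hi = w - b" "lo \<le> yb" "yb \<le> hi" "0 \<le> a" "w \<le> 1"
        for ya yb a b e lo hi w :: real
        using that by linarith
      show ?thesis
      proof (rule gen[where yb = "\<xi> z $ i" and e = "1 / (12 * real m)" and b = "(1 / 4) / m"
            and lo = "(z i + 1 / 4) / m" and hi = "(z i + 3 / 4) / m" and a = "real (z i) / m" and w = "(real (z i) + 1) / m"])
        show "\<bar>y $ i - \<xi> z $ i\<bar> \<le> 1 / (12 * real m)" using y r0m order_trans unfolding cap by blast
        show "1 / (12 * real m) \<le> (1 / 4) / m" using m by (simp add: field_simps)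
        show "(z i + 1 / 4) / m = real (z i) / m + (1 / 4) / m" "(z i + 3 / 4) / m = (real (z i) + 1) / m - (1 / 4) / m"
          using m by (simp_all add: field_simps)
        have "real (z i) + 1 \<le> m" using GZ(3)[OF z, of i] by linarith
        then show "(real (z i) + 1) / m \<le> 1" using m by simp
      qed (use cell[OF z, of i] in auto)
    qed
    then show "y \<in> unit_cube" by (simp add: mem_box_cart)
  qed
  have \<xi>cube: "\<xi> z \<in> unit_cube" if "z \<in> GZ" for z
  proof -
    have "\<xi> z \<in> cap z" using r0 by (simp add: cap)
    then show ?thesis using capcube[OF that] by blast
  qed
  have disj: "disjoint_family_on cap GZ"
    unfolding disjoint_family_on_def
  proof (intro ballI impI, rule ccontr)
    fix z z' assume z: "z \<in> GZ" "z' \<in> GZ" "z \<noteq> z'" and "cap z \<inter> cap z' \<noteq> {}"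
    then obtain y where y: "y \<in> cap z" "y \<in> cap z'" by blast
    have "z i = z' i" for i
    proof (rule cell_unique[OF m cell[OF z(1)] cell[OF z(2)]])
      have "\<bar>y $ i - \<xi> z $ i\<bar> \<le> 1 / (12 * real m)" "\<bar>y $ i - \<xi> z' $ i\<bar> \<le> 1 / (12 * real m)"
        using y r0m order_trans unfolding cap by blast+
      moreover have "1 / (12 * real m) + 1 / (12 * real m) < 1 / (2 * real m)" using m by (simp add: field_simps)
      moreover have "\<bar>a - b\<bar> < f" if "\<bar>y - a\<bar> \<le> e" "\<bar>y - b\<bar> \<le> e" "e + e < f" for a b e f y :: real
        using that by linarith
      ultimately show "\<bar>\<xi> z $ i - \<xi> z' $ i\<bar> < 1 / (2 * real m)" by blast
    qed
    then show False using z(3) by blast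
  qed
  have mcap: "measure lborel (cap z) = (2 * r0) ^ ?d" for z
  proof -
    have "\<xi> z \<in> cbox (\<xi> z - vec r0) (\<xi> z + vec r0)" using r0 by (simp add: mem_box_cart)
    then have "cbox (\<xi> z - vec r0) (\<xi> z + vec r0) \<noteq> {}" by blast
    then show ?thesis unfolding cap_def by (subst content_cbox_cart) auto
  qed
  have CV: "measure lborel C = card GZ * (2 * r0) ^ ?d"
  proof -
    have "measure lborel C = (\<Sum>z\<in>GZ. measure lborel (cap z))"
      unfolding C_def
      by (rule measure_finite_Union[OF GZ(1) _ disj]) (auto simp: cap_def emeasure_lborel_cbox_eq)
    then show ?thesis by (simp add: mcap)
  qed
  have Cb: "C \<in> sets borel" unfolding C_def cap_def using GZ(1) by (intro sets.finite_UN) auto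
  have Cc: "C \<subseteq> unit_cube" using capcube by (auto simp: C_def)
  define Y where "Y = C \<times> (UNIV :: real set)"
  have Yb: "Y \<in> sets borel"
  proof -
    have "Y \<in> sets (borel \<Otimes>\<^sub>M borel)" unfolding Y_def by (rule pair_measureI[OF Cb]) simp
    then show ?thesis unfolding borel_prod .
  qed
  let ?\<sigma> = "surface_measure \<psi>"
  note SF = surface_measure_facts[OF \<psi> \<phi>(2)]
  define V where "V = card GZ * (2 * r0) ^ ?d"
  have V0: "V > 0" unfolding V_def using GZ r0 by (simp add: card_gt_0_iff)
  have VY: "V \<le> measure ?\<sigma> Y" using SF(4)[OF Cb Cc] unfolding CV V_def Y_def .
  define X where "X = (gen_box M (2 * L) :: ((nat \<Rightarrow> int) \<times> ('d option \<Rightarrow> int)) set)"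
  define \<kappa> where "\<kappa> = 1 / (2::real) ^ (M + ?n)"
  define K where "K = (8 * real_of_int L + 1) ^ (?n + p)"
  have cX: "real (card X) = (4 * real_of_int L + 1) ^ (M + ?n)"
    unfolding X_def card_gen_box using L by simp
  have near: "AE y in ?\<sigma>. y \<in> Y \<longrightarrow> \<kappa> * card X \<le> card {(a, a') \<in> X \<times> X. norm (?P a - ?P a' + y) \<le> 1 / (3 * R)}"
    using SF(3)
  proof (rule AE_mp, intro AE_I2 impI)
    fix y assume y: "fst y \<in> unit_cube \<and> snd y = \<psi> (fst y)" and yY: "y \<in> Y"
    obtain z where z: "z \<in> GZ" "fst y \<in> cap z" using yY by (auto simp: Y_def C_def)
    have l1: "(\<Sum>i\<in>UNIV. \<bar>fst y $ i - \<xi> z $ i\<bar>) \<le> ?d * r0"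
      using z(2) sum_bounded_above[of UNIV "\<lambda>i. \<bar>fst y $ i - \<xi> z $ i\<bar>" r0] unfolding cap by simp
    have "norm (fst y - \<xi> z) \<le> (\<Sum>i\<in>UNIV. \<bar>(fst y - \<xi> z) $ i\<bar>)" by (rule norm_le_l1_cart)
    then have n1: "norm (fst y - \<xi> z) \<le> ?d * r0" using l1 by simp
    have "\<bar>\<phi> (fst y) - \<phi> (\<xi> z)\<bar> \<le> B1 * (\<Sum>i\<in>UNIV. \<bar>fst y $ i - \<xi> z $ i\<bar>)"
      by (rule Lipschitz_of_partials[OF \<phi> B1(1)]) (use y \<xi>cube[OF z(1)] in auto)
    also have "\<dots> \<le> B1 * (?d * r0)" using l1 B1(2) by (rule mult_left_mono)
    finally have n2: "\<bar>\<phi> (fst y) - \<phi> (\<xi> z)\<bar> \<le> B1 * (?d * r0)" .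
    have "\<phi> (\<xi> z) = snd (?P (x z))" unfolding \<xi>_def by (rule pt(3)[OF z(1)])
    then have "norm (y - ?P (x z)) = norm (fst y - \<xi> z, snd y - \<phi> (\<xi> z))"
      by (cases y) (simp add: \<xi>_def minus_prod_def)
    also have "\<dots> \<le> norm (fst y - \<xi> z) + norm (snd y - \<phi> (\<xi> z))" by (rule norm_Pair_le)
    also have "\<dots> \<le> ?d * r0 + (1 / (12 * R) + B1 * (?d * r0))"
      using n1 n2 close[of "fst y"] y by simp
    also have "\<dots> = (1 + B1) * (?d * r0) + 1 / (12 * R)" by (simp add: algebra_simps)
    also have "\<dots> = 1 / (12 * R) + 1 / (12 * R)" unfolding r12 ..
    also have "\<dots> \<le> 1 / (3 * R)" using R by (simp add: field_simps)
    finally have "norm (y - ?P (x z)) \<le> 1 / (3 * R)" .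
    from pairs_near_gen_point[OF xb[OF z(1)] this L]
    have "real (nat (2 * L + 1) ^ (M + ?n)) \<le> real (card {(a, a') \<in> X \<times> X. norm (?P a - ?P a' + y) \<le> 1 / (3 * R)})"
      unfolding X_def of_nat_le_iff .
    moreover have "\<kappa> * card X \<le> real (nat (2 * L + 1) ^ (M + ?n))"
    proof -
      have "(4 * real_of_int L + 1) ^ (M + ?n) \<le> (2 * (2 * real_of_int L + 1)) ^ (M + ?n)"
        using L by (intro power_mono) auto
      also have "\<dots> = 2 ^ (M + ?n) * (2 * real_of_int L + 1) ^ (M + ?n)" by (rule power_mult_distrib)
      finally have "\<kappa> * (4 * real_of_int L + 1) ^ (M + ?n) \<le> (2 * real_of_int L + 1) ^ (M + ?n)"
        unfolding \<kappa>_def by (simp add: divide_le_eq mult.commute)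
      then show ?thesis unfolding cX using L by simp
    qed
    ultimately show "\<kappa> * card X \<le> card {(a, a') \<in> X \<times> X. norm (?P a - ?P a' + y) \<le> 1 / (3 * R)}" by linarith
  qed
  have K0: "K \<ge> 0" unfolding K_def using L by simp
  have Kr: "real (nat (8 * L + 1) ^ (?n + p)) = K" unfolding K_def using L by simp
  have core: "\<exists>w. weight_on_ball R w \<and> \<not> (AE x in lborel. w x = 0) \<and> Xray_norm w < \<infinity> \<and>
    ennreal \<Gamma> * Xray_norm w * L2_norm_sq ?\<sigma> (indicator Y)
      \<le> L2_norm_sq (density lborel (\<lambda>x. ennreal (w x)))
          (\<lambda>x. LINT y|?\<sigma>. exp (2 * of_real pi * \<i> * of_real (x \<bullet> y)) * indicator Y y)"
  proof (rule weighted_extension_lower_bound[where P = ?P and X = X and K = K and \<tau> = \<tau> and \<kappa> = \<kappa> and V = V])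
    show "finite X" unfolding X_def by (rule finite_gen_box)
    have "real (card X) > 0" unfolding cX using L by simp
    then show "X \<noteq> {}" by auto
    show "real (card {a'\<in>X. \<bar>(?P a - ?P a') \<bullet> u\<bar> < \<tau>}) \<le> K" if "norm u = 1" "a \<in> X" for u a
    proof -
      have "card {a'\<in>X. \<bar>(?P a - ?P a') \<bullet> u\<bar> < \<tau>} \<le> nat (8 * L + 1) ^ (?n + p)"
        unfolding X_def by (rule card_gen_box_plank[OF g q L \<tau> Q that(1)]) (use that in \<open>simp add: X_def\<close>)
      then show ?thesis unfolding Kr[symmetric] of_nat_le_iff .
    qed
    show "real (card X) * exp (- (R * \<tau>)\<^sup>2) \<le> 1" unfolding cX by (rule tail)
    show "\<Gamma> * (16 * (exp (1 / 2) * sqrt (2 * pi))\<^sup>2 * (K + 1)\<^sup>2 * 2 ^ DIM(real^'d) *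
        (2 * real DIM((real^'d) \<times> real)) ^ (2 * DIM((real^'d) \<times> real))) \<le> V * \<kappa>\<^sup>2 * R ^ DIM(real^'d)"
    proof -
      have "V * \<kappa>\<^sup>2 * R ^ ?d = card GZ * (2 * r) ^ ?d * \<kappa>\<^sup>2"
        unfolding V_def r0_def using R by (simp add: power_divide power_mult_distrib)
      moreover have "DIM(real^'d) = ?d" "DIM((real^'d) \<times> real) = ?d + 1" by simp_all
      ultimately show ?thesis
        using final unfolding K_def[symmetric] \<kappa>_def[symmetric] by (simp only: of_nat_add of_nat_1 mult_ac)
    qed
  qed (use SF Yb R \<tau> K0 \<Gamma> near V0 VY in \<open>auto simp: \<kappa>_def\<close>)
  have Ym: "(indicator Y :: (real^'d) \<times> real \<Rightarrow> complex) \<in> borel_measurable ?\<sigma>"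
    using Yb SF(2) by (intro borel_measurable_indicator) simp
  interpret S: finite_measure ?\<sigma> by (rule SF(1))
  have L2: "L2_norm_sq ?\<sigma> (indicator Y) < \<infinity>"
  proof -
    have "L2_norm_sq ?\<sigma> (indicator Y) = (\<integral>\<^sup>+y. indicator Y y \<partial>?\<sigma>)"
      unfolding L2_norm_sq_def by (intro nn_integral_cong) (simp add: indicator_def)
    also have "\<dots> = emeasure ?\<sigma> Y" using Yb SF(2) by simp
    finally show ?thesis using less_top[THEN iffD1, OF S.emeasure_finite[of Y]] by simp
  qed
  have nz: "\<not> (AE y in ?\<sigma>. indicator Y y = (0::complex))"
  proof
    assume "AE y in ?\<sigma>. indicator Y y = (0::complex)"
    then have "AE y in ?\<sigma>. y \<notin> Y" by (rule AE_mp) (auto simp: indicator_def)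
    then have "emeasure ?\<sigma> Y = 0"
      using Yb SF(2) by (subst (asm) AE_iff_measurable[of Y]) (auto simp: sets_eq_imp_space_eq[OF SF(2)])
    then show False using VY V0 by (simp add: measure_def)
  qed
  from core obtain w where "weight_on_ball R w" "\<not> (AE x in lborel. w x = 0)" "Xray_norm w < \<infinity>"
    "ennreal \<Gamma> * Xray_norm w * L2_norm_sq ?\<sigma> (indicator Y)
      \<le> L2_norm_sq (density lborel (\<lambda>x. ennreal (w x)))
          (\<lambda>x. LINT y|?\<sigma>. exp (2 * of_real pi * \<i> * of_real (x \<bullet> y)) * indicator Y y)"
    by blast
  then show ?thesis
    unfolding violates_def extension_op_def[abs_def]
    using Ym L2 nz by (intro exI[of _ "indicator Y"] exI[of _ w]) (simp add: L2_space_def)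
qed

section \<open>Genericity\<close>

text \<open>
  The rank condition \<open>p \<le> M n\<close>, which follows from \<open>t \<ge> 4\<close>, allows the powers of \<open>q\<close> to cancel.
\<close>

lemma gens_half_good:
  fixes A t M p L Q :: nat and \<tau> :: real and q :: int
  assumes t: "t \<ge> 4" and M: "M = t\<^sup>2" and p: "p = 4 * CARD('c) * t"
    and L: "L = (M + 2) * A" and \<tau>: "\<tau> = 1 / real A ^ (M + t)"
    and Q: "Q = 8 * CARD('c) * M * (M + 2) * A ^ (M + t + 1)"
    and A: "A \<ge> 1" and q: "q \<ge> int A ^ (M + t)"
    and par: "2 * ((2 * (8 * real CARD('c) * M * (M + 2) * real A ^ (M + t + 1)) + 1) ^ CARD('c) *
    (CARD('c) * (2 ^ M * ((16 * (real M + 2) * real A + 1) ^ (M * p) * (14 * CARD('c) / real A ^ (M + t)) ^ p)))) \<le> 1"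
  shows "2 * card (bad_gens M q p (8 * int L) (int Q) (3 * \<tau> * Q * q) :: (nat \<times> 'c::finite \<Rightarrow> int) set)
    \<le> card (gens M q :: (nat \<times> 'c \<Rightarrow> int) set)"
proof -
  let ?n = "CARD('c)"
  have n1: "real ?n \<ge> 1" using zero_less_card_finite[where 'a = 'c] by linarith
  have q1: "int A ^ (M + t) \<ge> 1" using A by simp
  then have q0: "q > 0" using q by linarith
  have A0: "real A > 0" using A by simp
  have M0: "M > 0" using t M by simp
  have Q0: "Q > 0" unfolding Q using M0 A by simp
  have pM: "p \<le> M * ?n"
  proof -
    have "4 * t \<le> t * t" using t by simp
    then have "4 * t * ?n \<le> t * t * ?n" by (rule mult_le_mono1)
    then show ?thesis unfolding p M power2_eq_square by (simp add: mult_ac)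
  qed
  have qt: "1 \<le> \<tau> * real_of_int q"
  proof -
    have "real_of_int (int A ^ (M + t)) \<le> real_of_int q" using q by (simp only: of_int_le_iff)
    then show ?thesis unfolding \<tau> using A0 by (simp add: le_divide_eq)
  qed
  have \<tau>0: "\<tau> > 0" unfolding \<tau> using A0 by simp
  have base: "4 * real ?n * (3 * \<tau> * Q * q) / Q + 2 \<le> real_of_int q * (14 * ?n / real A ^ (M + t))"
  proof -
    have a1: "4 * real ?n * (3 * \<tau> * Q * q) / Q = 12 * (real ?n * (\<tau> * q))" using Q0 by simp
    have a2: "1 * 1 \<le> real ?n * (\<tau> * q)" using n1 qt by (intro mult_mono) auto
    have a3: "real_of_int q * (14 * ?n / real A ^ (M + t)) = 14 * (real ?n * (\<tau> * q))"
      unfolding \<tau> by simp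
    show ?thesis unfolding a1 a3 using a2 by linarith
  qed
  have "real (card (bad_gens M q p (8 * int L) (int Q) (3 * \<tau> * Q * q) :: (nat \<times> 'c \<Rightarrow> int) set)) \<le>
    (2 * real Q + 1) ^ ?n * (?n * (2 ^ M * ((16 * real L + 1) ^ (M * p) *
      (real_of_int q ^ (M * ?n - p) * (4 * real ?n * (3 * \<tau> * Q * q) / Q + 2) ^ p))))"
    using card_bad_gens[where ?'c = 'c, OF q0, of "int Q" "8 * int L" "3 * \<tau> * Q * q" M p] Q0 \<tau>0 q0
    by simp
  also have "\<dots> \<le> (2 * real Q + 1) ^ ?n * (?n * (2 ^ M * ((16 * real L + 1) ^ (M * p) *
      (real_of_int q ^ (M * ?n - p) * (real_of_int q * (14 * ?n / real A ^ (M + t))) ^ p))))"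
    using q0 \<tau>0 by (intro mult_left_mono power_mono base) auto
  also have "\<dots> = (2 * real Q + 1) ^ ?n * (?n * (2 ^ M * ((16 * real L + 1) ^ (M * p) *
      (14 * ?n / real A ^ (M + t)) ^ p))) * (real_of_int q ^ (M * ?n - p) * real_of_int q ^ p)"
    by (simp only: power_mult_distrib mult_ac)
  also have "real_of_int q ^ (M * ?n - p) * real_of_int q ^ p = real_of_int q ^ (M * ?n)"
    unfolding power_add[symmetric] using pM by simp
  also have "(2 * real Q + 1) ^ ?n * (?n * (2 ^ M * ((16 * real L + 1) ^ (M * p) *
      (14 * ?n / real A ^ (M + t)) ^ p))) \<le> 1 / 2"
  proof -
    have QQ: "2 * real Q = 2 * (8 * real ?n * M * (M + 2) * real A ^ (M + t + 1))"
      unfolding Q by (simp only: of_nat_mult of_nat_power of_nat_add of_nat_numeral)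
    have LL: "16 * real L = 16 * (real M + 2) * real A"
      unfolding L by (simp only: of_nat_mult of_nat_add of_nat_numeral mult.assoc)
    show ?thesis unfolding QQ LL using par by linarith
  qed
  finally have "real (card (bad_gens M q p (8 * int L) (int Q) (3 * \<tau> * Q * q) :: (nat \<times> 'c \<Rightarrow> int) set))
      \<le> 1 / 2 * real_of_int q ^ (M * ?n)"
    using q0 by (simp add: mult_right_mono)
  moreover have "real (card (gens M q :: (nat \<times> 'c \<Rightarrow> int) set)) = real_of_int q ^ (M * ?n)"
    unfolding card_gens using q0 by simp
  ultimately have "real (2 * card (bad_gens M q p (8 * int L) (int Q) (3 * \<tau> * Q * q) :: (nat \<times> 'c \<Rightarrow> int) set))
      \<le> real (card (gens M q :: (nat \<times> 'c \<Rightarrow> int) set))" by simp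
  then show ?thesis by (simp only: of_nat_le_iff)
qed

text \<open>
  The expected number of hits in a cell is at least a constant times \<open>A \<eta>\<close>.
\<close>

lemma cells_hit:
  fixes \<psi> :: "real^'d::finite \<Rightarrow> real" and A m M k Z :: nat and q :: int and s \<eta> :: real
  assumes M: "M \<ge> 2" and A: "A = Z ^ (CARD('d) + k)" and m: "m = Z ^ (M - 2)" and Z: "Z \<ge> 1"
    and s: "s = \<eta> / real m ^ k" "\<eta> > 0" "\<eta> \<le> 1" and A\<eta>: "16 * 4 ^ CARD('d) \<le> real A * \<eta>"
    and q: "q \<ge> 4 * int m" "s * q \<ge> 2" and z: "\<And>i. z i < m"
  shows "8 * nat q ^ CARD('d option) \<le> card (lead_one M (int A)) * card (cell_targets \<psi> m s q z)"
proof -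
  let ?d = "CARD('d)"
  have m0: "m > 0" using m Z by simp
  have m1: "real m ^ k \<ge> 1" using m0 by (intro one_le_power) simp
  have s1: "s \<le> 1" using s m1 by (simp add: divide_le_eq)
  have q0: "q > 0" using q(1) m0 by linarith
  have mA: "real m ^ (?d + k) = real A ^ (M - 2)"
    unfolding m A by (simp add: power_mult[symmetric] mult.commute)
  have AM: "real A ^ (M - 1) = real A * real A ^ (M - 2)"
    using M by (metis One_nat_def Suc_1 Suc_diff_Suc Suc_le_lessD power_Suc)
  have mk: "real m ^ (?d + k) > 0" using m0 by simp
  have "8 * real_of_int q ^ (?d + 1) \<le> real A * \<eta> / (2 * 4 ^ ?d) * real_of_int q ^ (?d + 1)"
    using A\<eta> q0 by (intro mult_right_mono) (auto simp: le_divide_eq)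
  also have "\<dots> = real A * (real m ^ (?d + k)) * ((real_of_int q / (4 * real m)) ^ ?d * (s * q / 2))"
    using m0 unfolding s by (simp add: power_divide power_mult_distrib power_add field_simps)
  also have "\<dots> = real A ^ (M - 1) * ((real_of_int q / (4 * real m)) ^ ?d * (s * q / 2))"
    unfolding mA AM ..
  also have "\<dots> \<le> real A ^ (M - 1) * card (cell_targets \<psi> m s q z)"
    by (intro mult_left_mono card_cell_targets q m0 s1 z) simp
  also have "\<dots> = real (card (lead_one M (int A)) * card (cell_targets \<psi> m s q z))"
    using M by (simp add: card_lead_one)
  finally have "real (8 * nat q ^ CARD('d option)) \<le> real (card (lead_one M (int A)) * card (cell_targets \<psi> m s q z))"
    using q0 by simp
  then show ?thesis by (simp only: of_nat_le_iff)
qed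

lemma choose_rank:
  fixes n d :: nat and \<delta> :: real
  assumes \<delta>: "\<delta> > 0" and n: "n = d + 1"
  shows "\<exists>t\<ge>4. real (d * (t + 3) + 2 * (n + 4 * n * t) + 1) \<le> \<delta> * (t\<^sup>2 + t + 1)"
proof -
  define t where "t = nat \<lceil>15 * n / \<delta>\<rceil> + 4"
  have t4: "t \<ge> 4" by (simp add: t_def)
  have "15 * n / \<delta> \<le> t" unfolding t_def by linarith
  then have 1: "15 * real n \<le> \<delta> * t" using \<delta> by (simp add: divide_le_eq mult.commute)
  have "d * (t + 3) + 2 * (n + 4 * n * t) + 1 \<le> n * (t + 3) + 2 * (n + 4 * n * t) + n"
    using n by (intro add_mono mult_le_mono1) auto
  also have "\<dots> = n * (9 * t + 6)" by (simp add: algebra_simps)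
  also have "\<dots> \<le> n * (15 * t)" using t4 by (intro mult_le_mono2) auto
  finally have "real (d * (t + 3) + 2 * (n + 4 * n * t) + 1) \<le> real (n * (15 * t))"
    by (simp only: of_nat_le_iff)
  also have "\<dots> = 15 * real n * t" by simp
  also have "\<dots> \<le> \<delta> * t * t" using 1 by (intro mult_right_mono) auto
  also have "\<dots> \<le> \<delta> * (t\<^sup>2 + t + 1)" using \<delta> by (simp add: power2_eq_square algebra_simps)
  finally show ?thesis using t4 by blast
qed

text \<open>
  All choices are made in the order: the rank from \<open>\<delta>\<close>, the constants from \<open>\<psi>\<close> and \<open>\<eta>\<close>, the scale \<open>Z\<close>
  large in terms of these, and finally the modulus \<open>q\<close> large in terms of everything.
\<close>

lemma violation_dense:
  fixes \<psi> :: "real^'d::finite \<Rightarrow> real" and \<delta> \<eta> R0 :: real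
  assumes \<psi>: "\<psi> \<in> Ck_cube k" and k: "k \<ge> 1" and \<delta>: "\<delta> > 0" and \<eta>: "\<eta> > 0"
  shows "\<exists>\<phi>\<in>Ck_cube k. Ck_dist k \<psi> \<phi> < \<eta> \<and> (\<exists>R\<ge>R0. R \<ge> 1 \<and> (\<exists>\<rho>>0. \<forall>\<psi>'\<in>Ck_cube k. Ck_dist k \<phi> \<psi>' < \<rho> \<longrightarrow>
     violates (R powr (real CARD('d) / real (CARD('d) + k)) * R powr (- \<delta>)) \<psi>' R))"
proof -
  let ?d = "CARD('d)" and ?n = "CARD('d option)"
  have nd: "?n = ?d + 1" by simp
  have d1: "?d \<ge> 1" by (simp add: Suc_leI)
  obtain t where t: "t \<ge> 4" and ex: "real (?d * (t + 3) + 2 * (?n + 4 * ?n * t) + 1) \<le> \<delta> * (t\<^sup>2 + t + 1)"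
    using choose_rank[OF \<delta> nd] by blast
  define M where "M = t\<^sup>2"
  define p where "p = 4 * ?n * t"
  have M2: "M \<ge> 2" using t unfolding M_def power2_eq_square by (intro order_trans[OF _ mult_le_mono[of 4 t 4 t]]) auto
  obtain B0 where B0: "B0 \<ge> 0" "\<And>\<alpha> x. length \<alpha> \<le> k \<Longrightarrow> x \<in> unit_cube \<Longrightarrow> \<bar>iter_partial \<alpha> \<psi> x\<bar> \<le> B0"
    using Ck_partials_bounded[OF \<psi>] by blast
  define B where "B = \<lceil>B0\<rceil>"
  have B: "B \<ge> 0" "\<And>x. x \<in> unit_cube \<Longrightarrow> \<bar>\<psi> x\<bar> \<le> real_of_int B"
  proof -
    show "B \<ge> 0" using B0(1) by (simp add: B_def)
    show "\<bar>\<psi> x\<bar> \<le> real_of_int B" if "x \<in> unit_cube" for x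
      using order_trans[OF B0(2)[of "[]" x] le_of_int_ceiling[of B0]] that unfolding B_def by simp
  qed
  obtain C where C: "C > 0" and Cp: "\<forall>(\<psi> :: real^'d \<Rightarrow> real) (Z :: (real^'d) set) h \<rho> s. \<psi> \<in> Ck_cube k \<longrightarrow> finite Z \<longrightarrow>
    0 < \<rho> \<longrightarrow> \<rho> \<le> 1 \<longrightarrow> 0 \<le> s \<longrightarrow> (\<forall>z\<in>Z. \<bar>h z\<bar> \<le> s) \<longrightarrow>
    (\<forall>z\<in>Z. \<forall>z'\<in>Z. \<forall>x. (\<forall>i. \<bar>x $ i - z $ i\<bar> < \<rho>) \<longrightarrow> (\<forall>i. \<bar>x $ i - z' $ i\<bar> < \<rho>) \<longrightarrow> z = z') \<longrightarrow>
    (\<exists>\<phi>\<in>Ck_cube k. Ck_dist k \<psi> \<phi> \<le> C * s / \<rho> ^ k \<and>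
       (\<forall>z\<in>Z. z \<in> unit_cube \<longrightarrow> \<phi> z = \<psi> z + h z))"
    using Ck_perturb[of k, where 'd = 'd] by blast
  define e where "e = min 1 (\<eta> / (2 * C * 4 ^ k))"
  have e: "e > 0" "e \<le> 1" "C * e * 4 ^ k < \<eta>"
  proof -
    show "e > 0" "e \<le> 1" using \<eta> C by (auto simp: e_def)
    have "e \<le> \<eta> / (2 * C * 4 ^ k)" by (simp add: e_def)
    then have "C * e * 4 ^ k \<le> \<eta> / 2" using C by (simp add: le_divide_eq mult_ac)
    then show "C * e * 4 ^ k < \<eta>" using \<eta> by linarith
  qed
  define B1 where "B1 = B0 + \<eta>"
  define r where "r = 1 / (12 * real ?d * (1 + B1))"
  have B1: "B1 \<ge> 0" using B0 \<eta> by (simp add: B1_def)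
  have r0: "r > 0" unfolding r_def using d1 B1 by simp
  define C1 where "C1 = 16 * (exp (1 / 2) * sqrt (2 * pi))\<^sup>2 * 2 ^ ?d * (2 * (real ?d + 1)) ^ (2 * (?d + 1))"
  define C6 where "C6 = 1 / 2 * (2 * r) ^ ?d * (1 / 2 ^ (M + ?n))\<^sup>2"
  have C1: "C1 \<ge> 0" by (simp add: C1_def)
  have C6: "C6 > 0" using r0 by (simp add: C6_def)
  obtain Ab where Ab: "\<And>A. A \<ge> Ab \<Longrightarrow> 2 * ((2 * (8 * real ?n * M * (M + 2) * A ^ (M + t + 1)) + 1) ^ ?n *
    (?n * (2 ^ M * ((16 * (real M + 2) * A + 1) ^ (M * p) * (14 * ?n / A ^ (M + t)) ^ p)))) \<le> 1"
    using bad_count_negligible[of ?n t M p] t M_def p_def by auto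
  obtain At where At: "\<And>A. A \<ge> At \<Longrightarrow> (4 * (real M + 2) * A + 1) ^ (M + ?n) * exp (- A\<^sup>2) \<le> 1"
    using gaussian_tail_negligible[of "real M + 2" "M + ?n"] by auto
  have exM: "real (?d * (t + 3) + 2 * (?n + p) + 1) \<le> \<delta> * (M + t + 1)"
    using ex unfolding p_def M_def by simp
  obtain Zf where Zf: "\<And>Z. Z \<ge> Zf \<Longrightarrow> real ((Z ^ (?d + k)) ^ (M + t + 1)) powr (?d / (?d + k)) * real ((Z ^ (?d + k)) ^ (M + t + 1)) powr (- \<delta>) *
      (C1 * ((8 * (real M + 2) * real (Z ^ (?d + k)) + 1) ^ (?n + p) + 1)\<^sup>2) \<le> C6 * real Z ^ (?d * (M - 2))"
    using gain_beats_losses[OF d1 M2 C1 C6 _ exM, of "8 * (real M + 2)" k] by auto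
  \<comment> \<open>Besides the three thresholds: \<open>A \<ge> B + 2\<close> lets the integer box cover the vertical range of the graph,
     and \<open>A e \<ge> 16 4\<^sup>d\<close> makes the expected number of hits in a cell at least \<open>8\<close>.\<close>
  define Z where "Z = Zf + nat \<lceil>Ab\<rceil> + nat \<lceil>At\<rceil> + nat \<lceil>R0\<rceil> + nat B + 2 + nat \<lceil>16 * 4 ^ ?d / e\<rceil>"
  define A where "A = Z ^ (?d + k)"
  define m where "m = Z ^ (M - 2)"
  define Rn where "Rn = A ^ (M + t + 1)"
  define R where "R = real Rn"
  define \<tau> where "\<tau> = 1 / real A ^ (M + t)"
  define L where "L = (M + 2) * A"
  define Q where "Q = 8 * ?n * M * (M + 2) * A ^ (M + t + 1)"
  define s where "s = e / real m ^ k"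
  have Z2: "Z \<ge> 2" by (simp add: Z_def)
  have ZA: "Z \<le> A"
  proof -
    have "1 \<le> ?d + k" using d1 by linarith
    then have "Z ^ 1 \<le> Z ^ (?d + k)" using Z2 by (intro power_increasing) auto
    then show ?thesis by (simp add: A_def)
  qed
  have A2: "A \<ge> 2" using Z2 ZA by linarith
  have AZ: "real A \<ge> real Z" using ZA by simp
  have "real Z \<ge> Ab" "real Z \<ge> At" "real Z \<ge> R0" "real Z \<ge> 16 * 4 ^ ?d / e" "int Z \<ge> B + 2" and ZZf: "Z \<ge> Zf"
    unfolding Z_def using B(1) by linarith+
  then have Abs: "real A \<ge> Ab" "real A \<ge> At" "real A \<ge> R0" "real A \<ge> 16 * 4 ^ ?d / e" "int A \<ge> B + 2"
    using AZ ZA by linarith+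
  have Ae: "16 * 4 ^ ?d \<le> real A * e" using Abs(4) e(1) by (simp add: divide_le_eq)
  have m0: "m > 0" using Z2 by (simp add: m_def)
  have s0: "s > 0" using e m0 by (simp add: s_def)
  have s1: "s \<le> 1"
  proof -
    have "1 \<le> real m ^ k" using m0 by (intro one_le_power) simp
    then show ?thesis using e by (simp add: s_def divide_le_eq)
  qed
  have AR: "A \<le> Rn"
  proof -
    have "A ^ 1 \<le> A ^ (M + t + 1)" using A2 by (intro power_increasing) auto
    then show ?thesis by (simp add: Rn_def)
  qed
  have mR: "m \<le> Rn"
  proof -
    have "Z ^ (M - 2) \<le> Z ^ (M + t + 1)" using Z2 by (intro power_increasing) auto
    also have "\<dots> \<le> A ^ (M + t + 1)" using ZA by (rule power_mono) simp
    finally show ?thesis by (simp add: m_def Rn_def)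
  qed
  obtain q0 :: nat where q0: "prime q0" "q0 > A + 4 * m + A ^ (M + t) + nat \<lceil>2 / s\<rceil>"
    using bigger_prime by blast
  define q where "q = int q0"
  have q: "prime q" "q > 0" "int A \<le> q" "q \<ge> 4 * int m" "q \<ge> int A ^ (M + t)"
    using q0 by (auto simp: q_def prime_gt_0_nat simp flip: of_nat_power)
  have sq: "s * q \<ge> 2"
  proof -
    have "2 / s \<le> real q0" using q0(2) by linarith
    then show ?thesis using s0 by (simp add: q_def divide_le_eq mult.commute)
  qed
  let ?bad = "bad_gens M q p (8 * int L) (int Q) (3 * \<tau> * Q * q) :: (nat \<times> 'd option \<Rightarrow> int) set"
  have half: "2 * card ?bad \<le> card (gens M q :: (nat \<times> 'd option \<Rightarrow> int) set)"
    by (rule gens_half_good[OF t M_def p_def L_def \<tau>_def Q_def _ q(5) Ab]) (use A2 Abs in auto)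
  define Zs where "Zs = PiE (UNIV :: 'd set) (\<lambda>_. {..<m})"
  have Zs: "finite Zs" "card Zs = m ^ ?d" unfolding Zs_def by (auto intro!: finite_PiE simp: card_PiE)
  have Zm: "z i < m" if "z \<in> Zs" for z i using that by (auto simp: Zs_def)
  have tgt: "cell_targets \<psi> m s q z \<subseteq> residues q" for z by (auto simp: cell_targets_def)
  have badsub: "?bad \<subseteq> gens M q" by (auto simp: bad_gens_def)
  have hit: "8 * nat q ^ ?n \<le> card (lead_one M (int A)) * card (cell_targets \<psi> m s q z)" if "z \<in> Zs" for z
    by (rule cells_hit[OF M2 A_def m_def _ s_def e(1,2) Ae q(4) sq Zm[OF that]]) (use Z2 in simp)
  have A2': "int A \<ge> 2" using A2 by simp
  obtain g where g: "g \<in> gens M q" "g \<notin> ?bad"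
    and cov: "card Zs \<le> 2 * card {z \<in> Zs. \<exists>a\<in>lead_one M (int A). comb_mod M q a g \<in> cell_targets \<psi> m s q z}"
    using good_gens_exist[where T = "cell_targets \<psi> m s q" and Z = Zs, OF q(1,3) M2 A2' Zs(1) tgt hit half badsub]
    by blast
  define GZ where "GZ = {z \<in> Zs. \<exists>a\<in>lead_one M (int A). comb_mod M q a g \<in> cell_targets \<psi> m s q z}"
  have GZf: "finite GZ" using Zs(1) by (simp add: GZ_def)
  have cGZ: "real m ^ ?d / 2 \<le> card GZ"
  proof -
    have "real (card Zs) \<le> real (2 * card GZ)" using cov unfolding GZ_def of_nat_le_iff .
    then show ?thesis by (simp add: Zs)
  qed
  have GZne: "GZ \<noteq> {}"
  proof
    assume "GZ = {}"
    then have "real m ^ ?d / 2 \<le> 0" using cGZ by simp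
    moreover have "real m ^ ?d > 0" using m0 by simp
    ultimately show False by linarith
  qed
  have LB: "int L \<ge> int M * int A + B + 1"
    using Abs(5) A2 by (simp add: L_def algebra_simps)
  have "\<forall>z\<in>GZ. \<exists>x. x \<in> gen_box M (int L) \<and> (\<forall>i. (z i + 1 / 4) / m \<le> fst (gen_point M q g x) $ i \<and>
      fst (gen_point M q g x) $ i \<le> (z i + 3 / 4) / m) \<and>
    fst (gen_point M q g x) \<in> unit_cube \<and>
    \<bar>snd (gen_point M q g x) - \<psi> (fst (gen_point M q g x))\<bar> \<le> s"
  proof
    fix z assume "z \<in> GZ"
    then obtain a where z: "z \<in> Zs" and a: "a \<in> lead_one M (int A)" "comb_mod M q a g \<in> cell_targets \<psi> m s q z"
      by (auto simp: GZ_def)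
    show "\<exists>x. x \<in> gen_box M (int L) \<and> (\<forall>i. (z i + 1 / 4) / m \<le> fst (gen_point M q g x) $ i \<and>
      fst (gen_point M q g x) $ i \<le> (z i + 3 / 4) / m) \<and>
    fst (gen_point M q g x) \<in> unit_cube \<and>
    \<bar>snd (gen_point M q g x) - \<psi> (fst (gen_point M q g x))\<bar> \<le> s"
      using cell_target_point[OF g(1) q(2) _ _ a s1 B(2) LB m0 Zm[OF z] B(1)] A2 M2 by auto
  qed
  then obtain x where x: "\<And>z. z \<in> GZ \<Longrightarrow> x z \<in> gen_box M (int L)"
    "\<And>z i. z \<in> GZ \<Longrightarrow> (z i + 1 / 4) / m \<le> fst (gen_point M q g (x z)) $ i"
    "\<And>z i. z \<in> GZ \<Longrightarrow> fst (gen_point M q g (x z)) $ i \<le> (z i + 3 / 4) / m"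
    "\<And>z. z \<in> GZ \<Longrightarrow> fst (gen_point M q g (x z)) \<in> unit_cube"
    "\<And>z. z \<in> GZ \<Longrightarrow> \<bar>snd (gen_point M q g (x z)) - \<psi> (fst (gen_point M q g (x z)))\<bar> \<le> s"
    unfolding bchoice_iff by blast
  have "\<exists>\<phi>\<in>Ck_cube k. Ck_dist k \<psi> \<phi> \<le> C * s * (4 * m) ^ k \<and>
      (\<forall>z\<in>GZ. \<phi> (fst (gen_point M q g (x z))) = snd (gen_point M q g (x z)))"
    by (rule perturbed_surface[OF _ m0 _ GZf x(2-5)]) (use Cp \<psi> s0 in auto)
  then obtain \<phi> where \<phi>: "\<phi> \<in> Ck_cube k" "Ck_dist k \<psi> \<phi> \<le> C * s * (4 * m) ^ k"
    "\<And>z. z \<in> GZ \<Longrightarrow> \<phi> (fst (gen_point M q g (x z))) = snd (gen_point M q g (x z))" by blast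
  have se: "C * s * (4 * m) ^ k = C * e * 4 ^ k"
    using m0 by (simp add: s_def power_mult_distrib)
  have dist: "Ck_dist k \<psi> \<phi> < \<eta>" by (rule order_le_less_trans[OF \<phi>(2)[unfolded se] e(3)])
  have \<phi>B: "\<bar>iter_partial [i] \<phi> y\<bar> \<le> B1" if "y \<in> unit_cube" for i y
    using Ck_dist_upper[OF \<psi> \<phi>(1), of "[i]" y] B0(2)[of "[i]" y] that k dist unfolding B1_def by simp
  have R1: "R \<ge> 1" using AR A2 by (simp add: R_def)
  have R0: "R \<ge> R0" using Abs(3) AR unfolding R_def by linarith
  have R\<tau>: "R * \<tau> = A"
    unfolding R_def Rn_def \<tau>_def using A2 by (simp add: power_add)
  have gQ: "g \<notin> bad_gens M q p (8 * int L) (int Q) (3 * \<tau> * real_of_int (int Q) * real_of_int q)"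
    using g(2) by simp
  let ?\<Gamma> = "R powr (real ?d / real (?d + k)) * R powr (- \<delta>)"
  have viol: "violates ?\<Gamma> \<psi>' R" if \<psi>': "\<psi>' \<in> Ck_cube k" "Ck_dist k \<phi> \<psi>' < 1 / (12 * R)" for \<psi>'
  proof (rule inequality_near[where x = x and GZ = GZ and m = m and r = r and \<tau> = \<tau> and ?B1.0 = B1,
        OF \<phi>(1) k \<psi>'(1) \<phi>B B1 _ R1 _ m0 GZf GZne _ x(1-3) \<phi>(3) g(1) gQ q(2)])
    show "\<bar>\<psi>' y - \<phi> y\<bar> \<le> 1 / (12 * R)" if "y \<in> unit_cube" for y
      using Ck_dist_upper[OF \<phi>(1) \<psi>'(1), of "[]" y] that \<psi>'(2) by (simp add: abs_minus_commute)
    show "real m \<le> R" using mR by (simp add: R_def)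
    show "\<tau> > 0" using A2 by (simp add: \<tau>_def)
    show "2 * int ?n \<le> int Q"
    proof -
      have "1 * 1 * 1 \<le> M * (M + 2) * A ^ (M + t + 1)" using M2 A2 by (intro mult_le_mono) auto
      then have "2 * ?n * 1 \<le> 8 * ?n * (M * (M + 2) * A ^ (M + t + 1))" by (intro mult_le_mono) auto
      then have "2 * ?n \<le> Q" unfolding Q_def by (simp only: mult.assoc mult_1_right)
      then show ?thesis by linarith
    qed
    show "real ?n * real M * real_of_int (8 * int L) \<le> \<tau> * real_of_int (int Q)"
      unfolding \<tau>_def Q_def L_def using A2 by (simp add: power_add field_simps)
    show "(4 * real_of_int (int L) + 1) ^ (M + ?n) * exp (- (R * \<tau>)\<^sup>2) \<le> 1"
    proof -
      have "4 * real_of_int (int L) = 4 * (real M + 2) * real A"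
        unfolding L_def of_int_of_nat_eq by (simp only: of_nat_mult of_nat_add of_nat_numeral mult.assoc)
      then show ?thesis using At[OF Abs(2)] unfolding R\<tau> by (simp only:)
    qed
    show "r = 1 / (real (12 * ?d) * (1 + B1))" by (simp add: r_def)
    have L8: "8 * real_of_int (int L) = 8 * (real M + 2) * real A"
      unfolding L_def of_int_of_nat_eq by (simp only: of_nat_mult of_nat_add of_nat_numeral mult.assoc)
    have "?\<Gamma> * (C1 * ((8 * (real M + 2) * real A + 1) ^ (?n + p) + 1)\<^sup>2) \<le> C6 * real Z ^ (?d * (M - 2))"
      using Zf[OF ZZf] unfolding A_def[symmetric] Rn_def[symmetric] R_def[symmetric] by simp
    also have "\<dots> = real m ^ ?d / 2 * ((2 * r) ^ ?d * (1 / 2 ^ (M + ?n))\<^sup>2)"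
      unfolding C6_def m_def by (simp add: power_mult[symmetric] mult.commute)
    also have "\<dots> \<le> card GZ * ((2 * r) ^ ?d * (1 / 2 ^ (M + ?n))\<^sup>2)"
      using cGZ r0 by (intro mult_right_mono) auto
    finally show "?\<Gamma> * (16 * (exp (1 / 2) * sqrt (2 * pi))\<^sup>2 * 2 ^ ?d * (2 * (real ?d + 1)) ^ (2 * (?d + 1))
        * ((8 * real_of_int (int L) + 1) ^ (?n + p) + 1)\<^sup>2)
      \<le> card GZ * (2 * r) ^ ?d * (1 / 2 ^ (M + ?n))\<^sup>2"
      unfolding C1_def L8 by (simp only: mult.assoc)
  qed (use Zm in \<open>auto simp: GZ_def\<close>)
  have "1 / (12 * R) > 0" using R1 by simp
  then show ?thesis using \<phi>(1) dist R0 R1 viol by blast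
qed

theorem mainTheorem2:
  fixes n k :: nat and \<delta> :: real
  assumes "n \<ge> 2" and "k \<ge> 2" and "\<delta> > 0"
    and dim: "CARD('d::finite) = n - 1"
  shows "\<exists>c::real. c > 0 \<and>
    (\<exists>G. gdelta_in (Ck_topology k) G \<and>
         (Ck_topology k) closure_of G = topspace (Ck_topology k) \<and>
         G \<subseteq> {\<psi> \<in> Ck_cube k :: (real^'d \<Rightarrow> real) set.
           \<forall>R0. \<exists>R\<ge>R0. R \<ge> 1 \<and>
             (\<exists>f w. f \<in> L2_space (surface_measure \<psi>) \<and>
                \<not> (AE y in surface_measure \<psi>. f y = 0) \<and>
                weight_on_ball R w \<and>
                \<not> (AE x in lborel. w x = 0) \<and>
                Xray_norm w < \<infinity> \<and>
                L2_norm_sq (density lborel (\<lambda>x. ennreal (w x))) (extension_op \<psi> f)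
                  \<ge> ennreal (c * R powr (real (n - 1) / real (n - 1 + k)) * R powr (- \<delta>))
                      * Xray_norm w * L2_norm_sq (surface_measure \<psi>) f)})"
proof -
  interpret Ck: Metric_space "Ck_cube k" "Ck_dist k :: (real^'d \<Rightarrow> real) \<Rightarrow> _"
    by (rule Metric_space_Ck)
  let ?\<Gamma> = "\<lambda>R. R powr (real CARD('d) / real (CARD('d) + k)) * R powr (- \<delta>)"
  have k1: "k \<ge> 1" using assms(2) by simp
  define U :: "nat \<Rightarrow> (real^'d \<Rightarrow> real) set" where
    "U j = {\<psi> \<in> Ck_cube k. \<exists>\<phi>\<in>Ck_cube k. \<exists>R\<ge>real j. R \<ge> 1 \<and> (\<exists>\<rho>>0. Ck_dist k \<phi> \<psi> < \<rho> \<and>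
      (\<forall>\<psi>'\<in>Ck_cube k. Ck_dist k \<phi> \<psi>' < \<rho> \<longrightarrow> violates (?\<Gamma> R) \<psi>' R))}" for j
  have U_open: "openin Ck.mtopology (U j)" for j
    unfolding Ck.openin_mtopology
  proof (intro conjI allI impI)
    show "U j \<subseteq> Ck_cube k" by (auto simp: U_def)
    fix \<psi> assume "\<psi> \<in> U j"
    then obtain \<phi> R \<rho> where \<psi>: "\<psi> \<in> Ck_cube k" and \<phi>: "\<phi> \<in> Ck_cube k" and R: "R \<ge> real j" "R \<ge> 1"
      and \<rho>: "\<rho> > 0" "Ck_dist k \<phi> \<psi> < \<rho>"
      and v: "\<forall>\<psi>'\<in>Ck_cube k. Ck_dist k \<phi> \<psi>' < \<rho> \<longrightarrow> violates (?\<Gamma> R) \<psi>' R"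
      unfolding U_def by blast
    have "Ck.mball \<psi> (\<rho> - Ck_dist k \<phi> \<psi>) \<subseteq> U j"
    proof
      fix \<psi>' assume "\<psi>' \<in> Ck.mball \<psi> (\<rho> - Ck_dist k \<phi> \<psi>)"
      then have \<psi>': "\<psi>' \<in> Ck_cube k" "Ck_dist k \<psi> \<psi>' < \<rho> - Ck_dist k \<phi> \<psi>" by auto
      then have "Ck_dist k \<phi> \<psi>' < \<rho>" using Ck.triangle[OF \<phi> \<psi> \<psi>'(1)] by linarith
      then show "\<psi>' \<in> U j" unfolding U_def using \<psi>'(1) \<phi> R \<rho>(1) v by blast
    qed
    then show "\<exists>r>0. Ck.mball \<psi> r \<subseteq> U j"
      using \<rho>(2) by (intro exI[of _ "\<rho> - Ck_dist k \<phi> \<psi>"]) simp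
  qed
  have U_dense: "Ck.mtopology closure_of (U j) = Ck_cube k" for j
  proof -
    have "\<exists>\<phi>\<in>U j. \<phi> \<in> Ck.mball \<psi> r" if \<psi>: "\<psi> \<in> Ck_cube k" and r: "r > 0" for \<psi> r
    proof -
      from violation_dense[OF \<psi> k1 assms(3) r, of "real j"]
      obtain \<phi> where \<phi>: "\<phi> \<in> Ck_cube k" "Ck_dist k \<psi> \<phi> < r"
        and v: "\<exists>R\<ge>real j. R \<ge> 1 \<and> (\<exists>\<rho>>0. \<forall>\<psi>'\<in>Ck_cube k. Ck_dist k \<phi> \<psi>' < \<rho> \<longrightarrow> violates (?\<Gamma> R) \<psi>' R)"
        by blast
      have "Ck_dist k \<phi> \<phi> = 0" using \<phi>(1) by simp
      moreover obtain R \<rho> where "R \<ge> real j" "R \<ge> 1" "\<rho> > 0"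
        "\<forall>\<psi>'\<in>Ck_cube k. Ck_dist k \<phi> \<psi>' < \<rho> \<longrightarrow> violates (?\<Gamma> R) \<psi>' R"
        using v by blast
      ultimately have "\<phi> \<in> U j" unfolding U_def using \<phi>(1) by force
      then show ?thesis using \<phi> \<psi> by auto
    qed
    then show ?thesis unfolding Ck.metric_closure_of by auto
  qed
  define G where "G = (\<Inter>j. U j)"
  have "gdelta_in Ck.mtopology G"
    unfolding G_def by (rule gdelta_in_Inter) (auto intro!: open_imp_gdelta_in U_open)
  moreover have "Ck.mtopology closure_of G = Ck_cube k"
    unfolding G_def by (rule Ck.metric_Baire_category[OF Ck_complete]) (auto simp: U_open U_dense)
  moreover have "G \<subseteq> {\<psi> \<in> Ck_cube k. \<forall>R0. \<exists>R\<ge>R0. R \<ge> 1 \<and> violates (?\<Gamma> R) \<psi> R}"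
  proof
    fix \<psi> assume \<psi>: "\<psi> \<in> G"
    have "\<exists>R\<ge>R0. R \<ge> 1 \<and> violates (?\<Gamma> R) \<psi> R" for R0
    proof -
      obtain j :: nat where j: "R0 \<le> real j" using real_arch_simple by blast
      have "\<psi> \<in> U j" using \<psi> by (simp add: G_def)
      then obtain R where R: "R \<ge> real j" "R \<ge> 1" "violates (?\<Gamma> R) \<psi> R" unfolding U_def by blast
      have "R \<ge> R0" using j R(1) by linarith
      then show ?thesis using R by blast
    qed
    moreover have "\<psi> \<in> Ck_cube k" using \<psi> by (auto simp: G_def U_def)
    ultimately show "\<psi> \<in> {\<psi> \<in> Ck_cube k. \<forall>R0. \<exists>R\<ge>R0. R \<ge> 1 \<and> violates (?\<Gamma> R) \<psi> R}" by blast
  qed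
  ultimately show ?thesis
    unfolding violates_def dim Ck_topology_def Ck.topspace_mtopology
    by (intro exI[of _ 1] conjI exI[of _ G]) (simp_all only: mult_1_left zero_less_one)
qed

end
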